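(* Let $b>R$. Let the coefficients $a_{ij}$ of the operator $L_0u=\sum_{i,j=1}^n a_{ij}(\mathbf{x})u_{x_ix_j}$ satisfy $a_{ij}(\mathbf{x})=a_{ji}(\mathbf{x})$ for all $\mathbf{x}\in\mathbb{R}^n$, $1\le i,j\le n$; $$\mu_1|\xi|^2\le\sum_{i,j=1}^n a_{ij}(\mathbf{x})\xi_i\xi_j\le\mu_2|\xi|^2\quad\text{for all }\mathbf{x},\xi\in\mathbb{R}^n,$$ where $0<\mu_1\le\mu_2$ are constants; and $a_{ij}\in C^1(\overline\Omega)$. Suppose that $$a_{in}(\mathbf{x})=0\quad\text{for }\mathbf{x}\in\partial\Omega\setminus\{z=\pm R\},\ i\ne n .$$ Then there exist numbers $$p_0=p_0\Bigl(\mu_1,\mu_2,b,n,R,\max_{i,j}\|a_{ij}\|_{C^1(\overline\Omega)}\Bigr)>1,\qquad \lambda_0=\lambda_0\Bigl(\mu_1,\mu_2,b,n,R,\max_{i,j}\|a_{ij}\|_{C^1(\overline\Omega)}\Bigr)\ge1,$$ both depending only on the listed parameters, such that $$\int_\Omega (L_0u)^2\exp\left[2\lambda(z+b)^p\right]d\mathbf{x}\ \ge\ C_2\lambda\int_\Omega\left[(\nabla u)^2+\lambda^2u^2\right]\exp\left[2\lambda(z+b)^p\right]d\mathbf{x}$$ for all $\lambda\ge\lambda_0$, $p\ge p_0$ and $u\in H^2_{0,\#}(\Omega)$. Here the constant $$C_2=C_2\Bigl(\mu_1,\mu_2,b,p,n,R,\max_{i,j}\|a_{ij}\|_{C^1(\overline\Omega)}\Bigr)>0$$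 depends only on the listed parameters.
   Context: Points of $\mathbb{R}^n$ are written $\mathbf{x}=(x_1,\dots,x_{n-1},z)$, so $x_n=z$. $R\ge1$, $\Omega=(-R,R)^n$, $\Gamma_+=\{\mathbf{x}\in\partial\Omega:z=R\}$, and $\nu$ is the unit outward normal on $\partial\Omega$. The coefficients $a_{ij}$ are real-valued functions on $\mathbb{R}^n$. In this statement $$H^2_{0,\#}(\Omega)=\{w\in H^2(\Omega): w|_{\partial\Omega}=0,\ \partial_\nu w|_{\Gamma_+}=0\}$$ consists of real-valued scalar functions (boundary values in the sense of traces), and $(\nabla u)^2=|\nabla u|^2$. *)

theory Defs
  imports "HOL-Analysis.Analysis"
begin

definition partial :: "'n::finite \<Rightarrow> (real ^ 'n \<Rightarrow> real) \<Rightarrow> real ^ 'n \<Rightarrow> real" where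
  "partial i f x = frechet_derivative f (at x) (axis i 1)"

primrec Ck :: "nat \<Rightarrow> (real ^ 'n::finite \<Rightarrow> real) \<Rightarrow> bool" where
  "Ck 0 f \<longleftrightarrow> continuous_on UNIV f"
| "Ck (Suc k) f \<longleftrightarrow> (\<forall>x. f differentiable (at x)) \<and> (\<forall>i. Ck k (partial i f))"

definition smooth :: "(real ^ 'n::finite \<Rightarrow> real) \<Rightarrow> bool" where
  "smooth f \<longleftrightarrow> (\<forall>k. Ck k f)"

definition test_function :: "(real ^ 'n::finite) set \<Rightarrow> (real ^ 'n \<Rightarrow> real) \<Rightarrow> bool" where
  "test_function \<Omega> \<phi> \<longleftrightarrow>
     smooth \<phi> \<and> compact (closure {x. \<phi> x \<noteq> 0}) \<and> closure {x. \<phi> x \<noteq> 0} \<subseteq> \<Omega>"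

text \<open>The space \<open>C\<^sup>1\<close> of the closure of an open set \<open>\<Omega>\<close>: \<open>f\<close> is continuous on the closure, and its
  first derivatives in \<open>\<Omega>\<close> are continuous up to the boundary.\<close>

definition C1_closure :: "(real ^ 'n::finite) set \<Rightarrow> (real ^ 'n \<Rightarrow> real) \<Rightarrow> bool" where
  "C1_closure \<Omega> f \<longleftrightarrow>
     continuous_on (closure \<Omega>) f \<and> (\<forall>x\<in>\<Omega>. f differentiable (at x)) \<and>
     (\<forall>i. \<exists>g. continuous_on (closure \<Omega>) g \<and> (\<forall>x\<in>\<Omega>. g x = partial i f x))"

text \<open>For \<open>C1_closure \<Omega> f\<close>, the supremum of a derivative over \<open>\<Omega>\<close> is that of its continuous
  extension over the closure.\<close>

definition C1_norm :: "(real ^ 'n::finite) set \<Rightarrow> (real ^ 'n \<Rightarrow> real) \<Rightarrow> real" where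
  "C1_norm \<Omega> f =
     (SUP x\<in>closure \<Omega>. \<bar>f x\<bar>) + (\<Sum>i\<in>UNIV. SUP x\<in>\<Omega>. \<bar>partial i f x\<bar>)"

text \<open>Sobolev spaces. Elements are functions on the whole space, of which only the restriction to
  \<open>\<Omega>\<close> matters, and they are not identified when they agree almost everywhere.\<close>

definition L2 :: "(real ^ 'n::finite) set \<Rightarrow> (real ^ 'n \<Rightarrow> real) set" where
  "L2 \<Omega> = {f. f \<in> borel_measurable (lebesgue_on \<Omega>) \<and>
              integrable (lebesgue_on \<Omega>) (\<lambda>x. (f x)\<^sup>2)}"

text \<open>Only used for \<open>u\<close> and \<open>g\<close> in \<open>L2 \<Omega>\<close>, where both integrands are integrable.\<close>

definition is_weak_partial ::
  "(real ^ 'n::finite) set \<Rightarrow> 'n \<Rightarrow> (real ^ 'n \<Rightarrow> real) \<Rightarrow> (real ^ 'n \<Rightarrow> real) \<Rightarrow> bool" where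
  "is_weak_partial \<Omega> i u g \<longleftrightarrow>
     (\<forall>\<phi>. test_function \<Omega> \<phi> \<longrightarrow>
        (LINT x|lebesgue_on \<Omega>. u x * partial i \<phi> x) = - (LINT x|lebesgue_on \<Omega>. g x * \<phi> x))"

primrec Hk :: "(real ^ 'n::finite) set \<Rightarrow> nat \<Rightarrow> (real ^ 'n \<Rightarrow> real) set" where
  "Hk \<Omega> 0 = L2 \<Omega>"
| "Hk \<Omega> (Suc k) = {u \<in> L2 \<Omega>. \<forall>i. \<exists>g \<in> Hk \<Omega> k. is_weak_partial \<Omega> i u g}"

text \<open>A representative of the weak derivative, which is determined almost everywhere.\<close>

definition weak_partial ::
  "(real ^ 'n::finite) set \<Rightarrow> 'n \<Rightarrow> (real ^ 'n \<Rightarrow> real) \<Rightarrow> real ^ 'n \<Rightarrow> real" where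
  "weak_partial \<Omega> i u = (SOME g. g \<in> L2 \<Omega> \<and> is_weak_partial \<Omega> i u g)"

definition weak_grad ::
  "(real ^ 'n::finite) set \<Rightarrow> (real ^ 'n \<Rightarrow> real) \<Rightarrow> real ^ 'n \<Rightarrow> real ^ 'n" where
  "weak_grad \<Omega> u x = (\<chi> i. weak_partial \<Omega> i u x)"

definition L0 ::
  "(real ^ 'n::finite) set \<Rightarrow> ('n \<Rightarrow> 'n \<Rightarrow> real ^ 'n \<Rightarrow> real) \<Rightarrow> (real ^ 'n \<Rightarrow> real) \<Rightarrow> real ^ 'n \<Rightarrow> real"
  where
  "L0 \<Omega> a u x = (\<Sum>i\<in>UNIV. \<Sum>j\<in>UNIV. a i j x * weak_partial \<Omega> j (weak_partial \<Omega> i u) x)"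

definition cube :: "real \<Rightarrow> (real ^ 'n::finite) set" where
  "cube R = box (vec (- R)) (vec R)"

text \<open>The index \<open>n\<close> is that of the distinguished coordinate, called \<open>x\<^sub>n = z\<close> on paper; in an
  unordered index type any index can play this role.\<close>

definition Gamma_plus :: "real \<Rightarrow> 'n::finite \<Rightarrow> (real ^ 'n) set" where
  "Gamma_plus R n = {x \<in> frontier (cube R). x $ n = R}"

definition embed_hyperplane :: "'n::finite \<Rightarrow> real \<Rightarrow> ('n \<Rightarrow> real) \<Rightarrow> real ^ 'n" where
  "embed_hyperplane i s y = (\<chi> j. if j = i then s else y j)"

definition hyperplane_measure :: "'n::finite \<Rightarrow> real \<Rightarrow> (real ^ 'n) measure" where
  "hyperplane_measure i s =
     distr (\<Pi>\<^sub>M j\<in>UNIV - {i}. lborel) borel (embed_hyperplane i s)"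

text \<open>The surface measure on the boundary of the cube, extended by zero to the whole space: on each
  of the \<open>2n\<close> faces it is the \<open>(n-1)\<close>-dimensional Lebesgue measure.\<close>

definition surface_measure :: "real \<Rightarrow> (real ^ 'n::finite) measure" where
  "surface_measure R = measure_of UNIV (sets borel)
     (\<lambda>A. \<Sum>i\<in>UNIV. \<Sum>s\<in>{R, - R}. emeasure (hyperplane_measure i s) (A \<inter> frontier (cube R)))"

text \<open>On the interior of each face exactly one component of the vector below is nonzero. The value
  on the edges, a null set, is immaterial.\<close>

definition outward_normal :: "real \<Rightarrow> real ^ 'n::finite \<Rightarrow> real ^ 'n" where
  "outward_normal R x = sgn (\<chi> i. if x $ i = R then 1 else if x $ i = - R then - 1 else 0)"

text \<open>\<open>g\<close> is the trace on the part \<open>\<Gamma>\<close> of the boundary of a function \<open>w\<close> in \<open>H\<^sup>1\<close>: the trace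
  operator is the extension by continuity, from \<open>H\<^sup>1\<close> to \<open>L\<^sup>2\<close> of the boundary, of the restriction of
  functions smooth up to the boundary.\<close>

definition has_trace ::
  "real \<Rightarrow> (real ^ 'n::finite) set \<Rightarrow> (real ^ 'n \<Rightarrow> real) \<Rightarrow> (real ^ 'n \<Rightarrow> real) \<Rightarrow> bool" where
  "has_trace R \<Gamma> w g \<longleftrightarrow>
     g \<in> borel_measurable borel \<and>
     (\<exists>\<phi> :: nat \<Rightarrow> real ^ 'n \<Rightarrow> real.
        (\<forall>k. smooth (\<phi> k)) \<and>
        (\<lambda>k. LINT x|lebesgue_on (cube R). (\<phi> k x - w x)\<^sup>2) \<longlonglongrightarrow> 0 \<and>
        (\<forall>i. (\<lambda>k. LINT x|lebesgue_on (cube R).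
                 (partial i (\<phi> k) x - weak_partial (cube R) i w x)\<^sup>2) \<longlonglongrightarrow> 0) \<and>
        (\<lambda>k. \<integral>\<^sup>+x\<in>\<Gamma>. ennreal ((\<phi> k x - g x)\<^sup>2) \<partial>surface_measure R) \<longlonglongrightarrow> 0)"

definition has_normal_trace ::
  "real \<Rightarrow> (real ^ 'n::finite) set \<Rightarrow> (real ^ 'n \<Rightarrow> real) \<Rightarrow> (real ^ 'n \<Rightarrow> real) \<Rightarrow> bool" where
  "has_normal_trace R \<Gamma> w h \<longleftrightarrow>
     (\<exists>g. (\<forall>i. has_trace R \<Gamma> (weak_partial (cube R) i w) (g i)) \<and>
          (AE x in surface_measure R. x \<in> \<Gamma> \<longrightarrow> h x = (\<Sum>i\<in>UNIV. outward_normal R x $ i * g i x)))"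

definition H2_0_sharp :: "real \<Rightarrow> 'n::finite \<Rightarrow> (real ^ 'n \<Rightarrow> real) set" where
  "H2_0_sharp R n = {w \<in> Hk (cube R) 2.
     has_trace R (frontier (cube R)) w (\<lambda>x. 0) \<and>
     has_normal_trace R (Gamma_plus R n) w (\<lambda>x. 0)}"

lemma embed_hyperplane_measurable:
  "embed_hyperplane i s \<in> borel_measurable (\<Pi>\<^sub>M j\<in>UNIV - {i}. lborel)"
proof -
  have "(\<lambda>y. if j = i then s else y j) \<in> borel_measurable (\<Pi>\<^sub>M j\<in>UNIV - {i}. lborel)" for j
    by (cases "j = i") auto
  then show ?thesis
    unfolding embed_hyperplane_def
    by (subst borel_measurable_euclidean_space)
       (auto simp: Basis_vec_def inner_axis)
qed

lemma sets_surface_measure [simp]: "sets (surface_measure R) = sets borel"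
  by (simp add: surface_measure_def sets.sigma_sets_eq[of borel, simplified])

text \<open>The set function in the definition of the surface measure is indeed a measure.\<close>

lemma emeasure_surface_measure:
  fixes A :: "(real ^ 'n::finite) set"
  assumes "A \<in> sets borel"
  shows "emeasure (surface_measure R) A =
    (\<Sum>i\<in>UNIV. \<Sum>s\<in>{R, - R}. emeasure (hyperplane_measure i s) (A \<inter> frontier (cube R)))"
proof (rule emeasure_measure_of[OF surface_measure_def])
  show "countably_additive (sets (surface_measure R :: (real ^ 'n) measure)) (\<lambda>A. \<Sum>i\<in>UNIV. \<Sum>s\<in>{R, - R}.
      emeasure (hyperplane_measure i s) (A \<inter> frontier (cube R)))"
    unfolding countably_additive_def
  proof (intro allI impI)
    fix A :: "nat \<Rightarrow> (real ^ 'n) set"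
    assume A: "range A \<subseteq> sets (surface_measure R)" "disjoint_family A"
    have "(\<Sum>k. emeasure (hyperplane_measure i s) (A k \<inter> frontier (cube R)))
        = emeasure (hyperplane_measure i s) ((\<Union>k. A k) \<inter> frontier (cube R))" for i s
    proof -
      have "range (\<lambda>k. A k \<inter> frontier (cube R)) \<subseteq> sets (hyperplane_measure i s)"
        using A(1) by (auto simp: hyperplane_measure_def)
      moreover have "disjoint_family (\<lambda>k. A k \<inter> frontier (cube R))"
        using A(2) by (auto simp: disjoint_family_on_def)
      ultimately show ?thesis
        by (subst suminf_emeasure) (auto intro: arg_cong[where f = "emeasure _"])
    qed
    then show "(\<Sum>k. \<Sum>i\<in>UNIV. \<Sum>s\<in>{R, - R}. emeasure (hyperplane_measure i s) (A k \<inter> frontier (cube R)))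
      = (\<Sum>i\<in>UNIV. \<Sum>s\<in>{R, - R}. emeasure (hyperplane_measure i s) ((\<Union>k. A k) \<inter> frontier (cube R)))"
      by (simp add: suminf_sum)
  qed
qed (use assms in \<open>auto simp: positive_def\<close>)

end

theory Submission imports Defs begin

text \<open>Let \<open>\<phi>(z) = (z + b)\<^sup>p\<close> and \<open>v = exp (lam \<phi>) u\<close>. Conjugation with the weight turns the operator into
  \<open>exp (lam \<phi>) L\<^sub>0 u = P\<^sub>1 + P\<^sub>2 + Q\<close>, where
  \<open>P\<^sub>1 = A + lam\<^sup>2 \<phi>'\<^sup>2 a\<^sub>n\<^sub>n v\<close>, \<open>P\<^sub>2 = - 2 lam \<phi>' S - 2 lam \<phi>'' a\<^sub>n\<^sub>n v\<close>, \<open>Q = lam \<phi>'' a\<^sub>n\<^sub>n v\<close>,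
  \<open>A = \<Sum> a\<^sub>k\<^sub>l v\<^sub>k\<^sub>l\<close> and \<open>S = \<Sum> a\<^sub>i\<^sub>n v\<^sub>i\<close>. The square of the sum is at least \<open>2 P\<^sub>1 P\<^sub>2 - Q\<^sup>2\<close>, and each product in
  \<open>P\<^sub>1 P\<^sub>2\<close> is integrated by parts. Write \<open>a(v)\<close> for the quadratic form of \<open>a\<close> on the gradient of \<open>v\<close>. Up to
  terms with a factor \<open>\<phi>'\<close> instead of \<open>\<phi>''\<close>, and terms of lower order in \<open>lam\<close>,
  \<open>\<integral>\<phi>' A S\<close> is at most \<open>\<integral> - \<phi>'' S\<^sup>2 + \<phi>'' a\<^sub>n\<^sub>n a(v) / 2\<close>,
  \<open>\<integral>\<phi>'' a\<^sub>n\<^sub>n A v\<close> is \<open>- \<integral>\<phi>'' a\<^sub>n\<^sub>n a(v)\<close>,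
  and \<open>\<integral>\<phi>'\<^sup>3 a\<^sub>n\<^sub>n S v\<close> is \<open>- 3/2 \<integral>\<phi>'\<^sup>2 \<phi>'' a\<^sub>n\<^sub>n\<^sup>2 v\<^sup>2\<close>
  (\<open>weighted_conormal_estimate\<close>, \<open>weighted_potential_estimate\<close>, \<open>weighted_transport_estimate\<close>).
  One zero order term of the operator is \<open>- lam \<phi>'' a\<^sub>n\<^sub>n v\<close>; twice this amount is put into \<open>P\<^sub>2\<close> and the
  difference \<open>Q\<close> is treated as an error, because with this multiple, and not with the natural one, both
  \<open>lam \<phi>'' a(v)\<close> and \<open>lam\<^sup>3 \<phi>'\<^sup>2 \<phi>'' v\<^sup>2\<close> are left with a positive coefficient. Since
  \<open>\<phi>''/\<phi>' = (p - 1)/(z + b)\<close> is at least \<open>(p - 1)/(b + R)\<close>, the errors with \<open>\<phi>'\<close> are absorbed once \<open>p\<close> is large,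
  independently of \<open>lam\<close>; the remaining ones are absorbed for \<open>lam \<ge> \<Lambda>(p)\<close>
  (\<open>carleman_large_parameter\<close>).

  The threshold for \<open>lam\<close> may not depend on \<open>p\<close>, but \<open>C\<^sub>2\<close> may. For \<open>1 \<le> lam \<le> \<Lambda>\<close> the weights for \<open>lam\<close> and for
  \<open>\<Lambda>\<close> differ by a factor of at most \<open>exp (2 \<Lambda> (b + R)\<^sup>p)\<close>, so the estimate for \<open>\<Lambda>\<close> implies the one for \<open>lam\<close>, and
  \<open>lam\<^sub>0 = 1\<close> is possible.

  In the integration by parts of \<open>A S\<close> (\<open>rellich_inequality\<close>) the boundary terms are harmless for three
  reasons. On a lateral face the tangential derivatives of \<open>v\<close> vanish, and \<open>a\<^sub>i\<^sub>n = 0\<close> removes the normal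
  one; on the top face the whole gradient vanishes; on the bottom face the term has the favourable sign.

  For \<open>u\<close> in \<open>H\<^sup>2\<close> this is justified by approximation. The traces in the boundary conditions provide
  smooth functions converging in \<open>H\<^sup>1\<close> to \<open>u\<close> and to each of its first derivatives. A boundary condition
  is kept in the form that the energy on a face of such an approximation tends to zero, and this
  energy is itself the integral of a derivative over the cube. What the definition does not provide is the
  vanishing of the tangential derivatives and the symmetry of the Hessian; both are derived by moving all
  derivatives onto smooth functions (\<open>tangential_zero_trace\<close>, \<open>weak_hessian_symmetric\<close>).\<close>

abbreviation (input) leb :: "real \<Rightarrow> (real ^ 'n::finite) measure" where
  "leb R \<equiv> lebesgue_on (cube R)"

abbreviation (input) C1 :: "real \<Rightarrow> (real ^ 'n::finite \<Rightarrow> real) \<Rightarrow> bool" where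
  "C1 R \<equiv> C1_closure (cube R)"

section \<open>Calculus of \<open>C\<^sup>1\<close> functions on a set\<close>

lemma partial_eqI:
  assumes "(f has_derivative f') (at x)"
  shows "partial i f x = f' (axis i 1)"
  using frechet_derivative_at[OF assms] by (simp add: partial_def)

lemma has_derivative_partials:
  fixes f :: "real ^ 'n::finite \<Rightarrow> real"
  assumes "f differentiable (at x)"
  shows "(f has_derivative (\<lambda>h. \<Sum>i\<in>UNIV. partial i f x * h $ i)) (at x)"
proof -
  obtain f' where f': "(f has_derivative f') (at x)"
    using assms by (auto simp: differentiable_def)
  have lin: "linear f'" by (rule has_derivative_linear[OF f'])
  have "f' h = (\<Sum>i\<in>UNIV. partial i f x * h $ i)" for h
  proof -
    have "f' h = f' (\<Sum>i\<in>UNIV. h $ i *s axis i 1)" by (simp add: basis_expansion)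
    also have "\<dots> = (\<Sum>i\<in>UNIV. h $ i * f' (axis i 1))"
      by (simp add: linear_sum[OF lin] scalar_mult_eq_scaleR linear_scale[OF lin])
    finally show ?thesis by (simp add: partial_eqI[OF f'] mult.commute)
  qed
  then have "f' = (\<lambda>h. \<Sum>i\<in>UNIV. partial i f x * h $ i)" by auto
  with f' show ?thesis by simp
qed

lemma partial_const [simp]: "partial i (\<lambda>x. c) x = 0"
  by (subst partial_eqI[OF has_derivative_const]) simp

lemma partial_add:
  assumes "f differentiable (at x)" "g differentiable (at x)"
  shows "partial i (\<lambda>x. f x + g x) x = partial i f x + partial i g x"
  by (subst partial_eqI[OF has_derivative_add[OF has_derivative_partials[OF assms(1)] has_derivative_partials[OF assms(2)]]])
     (simp add: axis_def if_distrib cong: if_cong)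

lemma partial_diff:
  assumes "f differentiable (at x)" "g differentiable (at x)"
  shows "partial i (\<lambda>x. f x - g x) x = partial i f x - partial i g x"
  by (subst partial_eqI[OF has_derivative_diff[OF has_derivative_partials[OF assms(1)] has_derivative_partials[OF assms(2)]]])
     (simp add: axis_def if_distrib cong: if_cong)

lemma partial_mult:
  assumes "f differentiable (at x)" "g differentiable (at x)"
  shows "partial i (\<lambda>x. f x * g x) x = partial i f x * g x + f x * partial i g x"
  by (subst partial_eqI[OF has_derivative_mult[OF has_derivative_partials[OF assms(1)] has_derivative_partials[OF assms(2)]]])
     (simp add: axis_def if_distrib cong: if_cong)

lemma partial_cong:
  assumes "open S" "x \<in> S" "\<And>y. y \<in> S \<Longrightarrow> f y = g y"
  shows "partial i f x = partial i g x"
proof -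
  have "(f has_derivative D) (at x) = (g has_derivative D) (at x)" for D
    using has_derivative_transform_within_open[of f D x UNIV S g]
      has_derivative_transform_within_open[of g D x UNIV S f] assms by auto
  then show ?thesis by (simp add: partial_def frechet_derivative_def)
qed

lemma has_derivative_comp_coordinate:
  fixes x :: "real ^ 'n::finite"
  assumes "(h has_real_derivative d) (at (x $ n))"
  shows "((\<lambda>x. h (x $ n)) has_derivative (\<lambda>v. d * v $ n)) (at x)"
proof -
  have 1: "((\<lambda>x. x $ n) has_derivative (\<lambda>v. v $ n)) (at x)"
    by (rule bounded_linear.has_derivative[OF bounded_linear_vec_nth has_derivative_ident])
  have 2: "(h has_derivative (*) d) (at (x $ n))"
    using assms by (simp add: has_field_derivative_def)
  show ?thesis by (rule has_derivative_compose[OF 1 2])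
qed

lemma partial_comp_coordinate:
  fixes x :: "real ^ 'n::finite"
  assumes "(h has_real_derivative d) (at (x $ n))"
  shows "partial i (\<lambda>x. h (x $ n)) x = (if i = n then d else 0)"
  by (subst partial_eqI[OF has_derivative_comp_coordinate[where h=h, OF assms]])
     (auto simp: axis_def)

lemma partial_coordinate [simp]: "partial i (\<lambda>x. x $ n) x = (if i = n then 1 else 0)"
  by (rule partial_comp_coordinate) (auto intro!: derivative_eq_intros)

lemma differentiable_comp_coordinate:
  fixes x :: "real ^ 'n::finite"
  assumes "(h has_real_derivative d) (at (x $ n))"
  shows "(\<lambda>x. h (x $ n)) differentiable (at x)"
  using has_derivative_comp_coordinate[where h=h, OF assms] by (auto simp: differentiable_def)

subsection \<open>Functions that are \<open>C\<^sup>1\<close> up to the boundary\<close>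

lemma C1_closureD:
  assumes "C1_closure \<Omega> f"
  shows "continuous_on (closure \<Omega>) f" "x \<in> \<Omega> \<Longrightarrow> f differentiable (at x)"
    "\<exists>g. continuous_on (closure \<Omega>) g \<and> (\<forall>x\<in>\<Omega>. g x = partial i f x)"
  using assms by (auto simp: C1_closure_def)

lemma C1_closure_partial_continuous:
  assumes "C1_closure \<Omega> f" shows "continuous_on \<Omega> (partial i f)"
proof -
  obtain g where "continuous_on (closure \<Omega>) g" "\<forall>x\<in>\<Omega>. g x = partial i f x"
    using C1_closureD(3)[OF assms] by blast
  then show ?thesis
    using continuous_on_subset[OF _ closure_subset] continuous_on_eq by blast
qed

lemma C1_closure_const [simp]: "C1_closure \<Omega> (\<lambda>x. c)"
  unfolding C1_closure_def by (auto intro!: exI[of _ "\<lambda>x. 0"] continuous_intros)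

lemma C1_closure_add [intro]:
  assumes f: "C1_closure \<Omega> f" and g: "C1_closure \<Omega> g"
  shows "C1_closure \<Omega> (\<lambda>x. f x + g x)"
  unfolding C1_closure_def
proof (intro conjI ballI allI)
  show "continuous_on (closure \<Omega>) (\<lambda>x. f x + g x)"
    using f g by (auto intro!: continuous_intros dest: C1_closureD)
  show "(\<lambda>x. f x + g x) differentiable at x" if "x \<in> \<Omega>" for x
    using C1_closureD(2)[OF f that] C1_closureD(2)[OF g that] by (rule differentiable_add)
  fix i
  obtain F G where F: "continuous_on (closure \<Omega>) F" "\<forall>x\<in>\<Omega>. F x = partial i f x"
    and G: "continuous_on (closure \<Omega>) G" "\<forall>x\<in>\<Omega>. G x = partial i g x"
    using C1_closureD(3)[OF f] C1_closureD(3)[OF g] by metis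
  show "\<exists>h. continuous_on (closure \<Omega>) h \<and> (\<forall>x\<in>\<Omega>. h x = partial i (\<lambda>x. f x + g x) x)"
    using F G f g by (intro exI[of _ "\<lambda>x. F x + G x"])
      (auto intro!: continuous_intros simp: partial_add C1_closureD(2))
qed

lemma C1_closure_mult [intro]:
  assumes f: "C1_closure \<Omega> f" and g: "C1_closure \<Omega> g"
  shows "C1_closure \<Omega> (\<lambda>x. f x * g x)"
  unfolding C1_closure_def
proof (intro conjI ballI allI)
  show "continuous_on (closure \<Omega>) (\<lambda>x. f x * g x)"
    using f g by (auto intro!: continuous_intros dest: C1_closureD)
  show "(\<lambda>x. f x * g x) differentiable at x" if "x \<in> \<Omega>" for x
    using C1_closureD(2)[OF f that] C1_closureD(2)[OF g that] by (rule differentiable_mult)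
  fix i
  obtain F G where F: "continuous_on (closure \<Omega>) F" "\<forall>x\<in>\<Omega>. F x = partial i f x"
    and G: "continuous_on (closure \<Omega>) G" "\<forall>x\<in>\<Omega>. G x = partial i g x"
    using C1_closureD(3)[OF f] C1_closureD(3)[OF g] by metis
  show "\<exists>h. continuous_on (closure \<Omega>) h \<and> (\<forall>x\<in>\<Omega>. h x = partial i (\<lambda>x. f x * g x) x)"
    using F G f g by (intro exI[of _ "\<lambda>x. F x * g x + f x * G x"])
      (auto intro!: continuous_intros simp: partial_mult C1_closureD)
qed

lemma C1_closure_diff [intro]:
  assumes f: "C1_closure \<Omega> f" and g: "C1_closure \<Omega> g"
  shows "C1_closure \<Omega> (\<lambda>x. f x - g x)"
proof -
  have "C1_closure \<Omega> (\<lambda>x. f x + (-1) * g x)" by (intro C1_closure_add C1_closure_mult f g C1_closure_const)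
  then show ?thesis by simp
qed

lemma C1_closure_power [intro]:
  assumes f: "C1_closure \<Omega> f"
  shows "C1_closure \<Omega> (\<lambda>x. f x ^ k)"
  by (induction k) (auto intro: f)

lemma C1_closure_comp_coordinate:
  assumes "\<And>x. x \<in> closure \<Omega> \<Longrightarrow> (h has_real_derivative h' (x $ n)) (at (x $ n))"
    and "continuous_on ((\<lambda>x. x $ n) ` closure \<Omega>) h'"
  shows "C1_closure \<Omega> (\<lambda>x. h (x $ n))"
  unfolding C1_closure_def
proof (intro conjI ballI allI)
  have "isCont h (x $ n)" if "x \<in> closure \<Omega>" for x
    using assms(1)[OF that] by (rule DERIV_isCont)
  then have "continuous_on ((\<lambda>x. x $ n) ` closure \<Omega>) h"
    by (auto intro!: continuous_at_imp_continuous_on)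
  then show "continuous_on (closure \<Omega>) (\<lambda>x. h (x $ n))"
    by (rule continuous_on_compose2) (auto intro!: continuous_intros)
  show "(\<lambda>x. h (x $ n)) differentiable at x" if "x \<in> \<Omega>" for x
    using assms(1) that closure_subset by (intro differentiable_comp_coordinate[where h=h]) blast
  fix i
  have "continuous_on (closure \<Omega>) (\<lambda>x. h' (x $ n))"
    using assms(2) by (rule continuous_on_compose2) (auto intro!: continuous_intros)
  moreover have "partial i (\<lambda>x. h (x $ n)) x = (if i = n then h' (x $ n) else 0)" if "x \<in> \<Omega>" for x
    using assms(1) that closure_subset by (intro partial_comp_coordinate[where h=h]) blast
  ultimately show "\<exists>g. continuous_on (closure \<Omega>) g \<and> (\<forall>x\<in>\<Omega>. g x = partial i (\<lambda>x. h (x $ n)) x)"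
    by (intro exI[of _ "\<lambda>x. if i = n then h' (x $ n) else 0"]) (cases "i = n", auto)
qed

lemma C1_closure_coordinate [simp, intro]: "C1_closure \<Omega> (\<lambda>x. x $ n)"
  by (rule C1_closure_comp_coordinate[where h="\<lambda>t. t" and h'="\<lambda>t. 1"]) (auto intro!: derivative_eq_intros)

subsection \<open>Smooth functions\<close>

lemma Ck_continuous: "Ck k f \<Longrightarrow> continuous_on UNIV f"
proof (cases k)
  case (Suc m)
  assume "Ck k f"
  then have "\<forall>x. isCont f x" using Suc by (simp add: differentiable_imp_continuous_within)
  then show ?thesis by (simp add: continuous_at_imp_continuous_on)
qed simp

lemma Ck_Suc_imp: "Ck (Suc k) f \<Longrightarrow> Ck k f"
proof (induction k arbitrary: f)
  case 0 then show ?case using Ck_continuous[OF 0] by simp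
next
  case (Suc k) then show ?case by (metis Ck.simps(2))
qed

lemma Ck_add: "Ck k f \<Longrightarrow> Ck k g \<Longrightarrow> Ck k (\<lambda>x. f x + g x)"
proof (induction k arbitrary: f g)
  case 0 then show ?case by (auto intro!: continuous_intros)
next
  case (Suc k)
  have "partial i (\<lambda>x. f x + g x) = (\<lambda>x. partial i f x + partial i g x)" for i
    using Suc.prems by (auto simp: partial_add)
  with Suc show ?case by auto
qed

lemma Ck_mult: "Ck k f \<Longrightarrow> Ck k g \<Longrightarrow> Ck k (\<lambda>x. f x * g x)"
proof (induction k arbitrary: f g)
  case 0 then show ?case by (auto intro!: continuous_intros)
next
  case (Suc k)
  have "partial i (\<lambda>x. f x * g x) = (\<lambda>x. partial i f x * g x + f x * partial i g x)" for i
    using Suc.prems by (auto simp: partial_mult)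
  moreover have "Ck k f" "Ck k g" using Suc.prems Ck_Suc_imp by blast+
  ultimately show ?case using Suc by (auto intro!: Ck_add)
qed

lemma Ck_const: "Ck k (\<lambda>x::real^'a. c)"
proof (induction k arbitrary: c)
  case (Suc k)
  have "partial i (\<lambda>x::real^'a. c) = (\<lambda>x. 0)" for i by auto
  with Suc show ?case by auto
qed auto

lemma Ck_coordinate: "Ck k (\<lambda>x. x $ n)"
proof (cases k)
  case (Suc m)
  have "partial i (\<lambda>x::real^'a. x $ n) = (\<lambda>x. if i = n then 1 else 0)" for i by auto
  then show ?thesis using Suc by (auto simp: Ck_const bounded_linear_imp_differentiable bounded_linear_vec_nth)
qed (auto intro!: continuous_intros)

lemma smooth_mult [intro]: "smooth f \<Longrightarrow> smooth g \<Longrightarrow> smooth (\<lambda>x. f x * g x)"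
  by (simp add: smooth_def Ck_mult)

lemma smooth_add [intro]: "smooth f \<Longrightarrow> smooth g \<Longrightarrow> smooth (\<lambda>x. f x + g x)"
  by (simp add: smooth_def Ck_add)

lemma smooth_const [intro]: "smooth (\<lambda>x. c)"
  by (simp add: smooth_def Ck_const)

lemma smooth_coordinate [intro]: "smooth (\<lambda>x. x $ n)"
  by (simp add: smooth_def Ck_coordinate)

lemma smooth_power [intro]: "smooth f \<Longrightarrow> smooth (\<lambda>x. f x ^ k)"
  by (induction k) auto

lemma smooth_partial [intro]: "smooth f \<Longrightarrow> smooth (partial i f)"
  unfolding smooth_def by (metis Ck.simps(2))

lemma smooth_differentiable: "smooth f \<Longrightarrow> f differentiable (at x)"
  unfolding smooth_def by (metis Ck.simps(2))

lemma smooth_continuous: "smooth f \<Longrightarrow> continuous_on A f"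
  unfolding smooth_def by (metis Ck_continuous continuous_on_subset subset_UNIV)

lemma smooth_imp_C1_closure: "smooth f \<Longrightarrow> C1_closure \<Omega> f"
  unfolding C1_closure_def
  by (auto simp: smooth_differentiable smooth_continuous intro!: exI[of _ "partial _ f"] smooth_continuous[OF smooth_partial])

text \<open>Both orders of differentiation are limits of the same second difference quotient, by the mean value
  theorem applied twice.\<close>

lemma partial_commute:
  fixes f :: "real ^ 'n::finite \<Rightarrow> real"
  assumes f: "smooth f"
  shows "partial i (partial j f) x = partial j (partial i f) x"
proof -
  have line: "((\<lambda>t. g (y + t *\<^sub>R axis k 1)) has_real_derivative partial k g (y + t *\<^sub>R axis k 1)) (at t)"
    if "smooth g" for g :: "real ^ 'n \<Rightarrow> real" and y k t
  proof -
    have "((\<lambda>t. y + t *\<^sub>R axis k 1) has_derivative (\<lambda>s. s *\<^sub>R axis k 1)) (at t)"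
      by (auto intro!: derivative_eq_intros)
    from has_derivative_compose[OF this has_derivative_partials[OF smooth_differentiable[OF that]]]
    show ?thesis
      by (simp add: has_field_derivative_def axis_def if_distrib mult_commute_abs cong: if_cong)
  qed
  \<comment> \<open>the second difference is symmetric in the two directions, its representation by the mean value theorem is not\<close>
  have diff: "\<exists>s t. 0 < s \<and> s < h \<and> 0 < t \<and> t < h \<and>
      f (x + h *\<^sub>R axis k 1 + h *\<^sub>R axis l 1) - f (x + h *\<^sub>R axis k 1) - f (x + h *\<^sub>R axis l 1) + f x
      = h * (h * partial l (partial k f) (x + s *\<^sub>R axis k 1 + t *\<^sub>R axis l 1))" if h: "0 < h" for h k l
  proof -
    define G where "G s = f ((x + h *\<^sub>R axis l 1) + s *\<^sub>R axis k 1) - f (x + s *\<^sub>R axis k 1)" for s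
    have "(G has_real_derivative (partial k f ((x + h *\<^sub>R axis l 1) + s *\<^sub>R axis k 1) - partial k f (x + s *\<^sub>R axis k 1))) (at s)" for s
      unfolding G_def by (intro derivative_intros line f)
    from MVT2[OF h, of G, OF this] obtain s where s: "0 < s" "s < h"
      "G h - G 0 = (h - 0) * (partial k f ((x + h *\<^sub>R axis l 1) + s *\<^sub>R axis k 1) - partial k f (x + s *\<^sub>R axis k 1))"
      by blast
    have "((\<lambda>t. partial k f ((x + s *\<^sub>R axis k 1) + t *\<^sub>R axis l 1)) has_real_derivative
        partial l (partial k f) ((x + s *\<^sub>R axis k 1) + t *\<^sub>R axis l 1)) (at t)" for t
      by (intro line smooth_partial f)
    from MVT2[OF h, of "\<lambda>t. partial k f ((x + s *\<^sub>R axis k 1) + t *\<^sub>R axis l 1)", OF this]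
    obtain t where t: "0 < t" "t < h"
      "partial k f ((x + s *\<^sub>R axis k 1) + h *\<^sub>R axis l 1) - partial k f ((x + s *\<^sub>R axis k 1) + 0 *\<^sub>R axis l 1)
       = (h - 0) * partial l (partial k f) ((x + s *\<^sub>R axis k 1) + t *\<^sub>R axis l 1)"
      by blast
    show ?thesis using s t
      by (intro exI[of _ s] exI[of _ t]) (auto simp: G_def algebra_simps)
  qed
  have tends: "(\<lambda>m. P (x + s m *\<^sub>R axis k 1 + t m *\<^sub>R axis l 1)) \<longlonglongrightarrow> P x"
    if "smooth P" "s \<longlonglongrightarrow> 0" "t \<longlonglongrightarrow> 0" for P :: "real ^ 'n \<Rightarrow> real" and s t :: "nat \<Rightarrow> real" and k l
  proof -
    have "(\<lambda>m. x + s m *\<^sub>R axis k 1 + t m *\<^sub>R axis l 1) \<longlonglongrightarrow> x + 0 *\<^sub>R axis k 1 + 0 *\<^sub>R axis l 1"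
      by (intro tendsto_intros that)
    moreover have "isCont P x"
      using smooth_differentiable[OF that(1)] differentiable_imp_continuous_within by blast
    ultimately show ?thesis using isCont_tendsto_compose by fastforce
  qed
  define h where "h m = inverse (real (Suc m))" for m
  have h: "0 < h m" for m by (simp add: h_def)
  have h0: "h \<longlonglongrightarrow> 0" unfolding h_def by (rule LIMSEQ_inverse_real_of_nat)
  obtain s t where st: "\<And>m. 0 < s m \<and> s m < h m \<and> 0 < t m \<and> t m < h m \<and>
      f (x + h m *\<^sub>R axis i 1 + h m *\<^sub>R axis j 1) - f (x + h m *\<^sub>R axis i 1) - f (x + h m *\<^sub>R axis j 1) + f x
      = h m * (h m * partial j (partial i f) (x + s m *\<^sub>R axis i 1 + t m *\<^sub>R axis j 1))"
    using diff[OF h, of _ i j] by metis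
  obtain s' t' where st': "\<And>m. 0 < s' m \<and> s' m < h m \<and> 0 < t' m \<and> t' m < h m \<and>
      f (x + h m *\<^sub>R axis j 1 + h m *\<^sub>R axis i 1) - f (x + h m *\<^sub>R axis j 1) - f (x + h m *\<^sub>R axis i 1) + f x
      = h m * (h m * partial i (partial j f) (x + s' m *\<^sub>R axis j 1 + t' m *\<^sub>R axis i 1))"
    using diff[OF h, of _ j i] by metis
  have sq: "r \<longlonglongrightarrow> 0" if "\<And>m. 0 < r m \<and> r m < h m" for r :: "nat \<Rightarrow> real"
    by (rule tendsto_sandwich[OF _ _ tendsto_const h0]) (auto intro!: always_eventually less_imp_le that[THEN conjunct1] that[THEN conjunct2])
  have "h m * (h m * partial i (partial j f) (x + s' m *\<^sub>R axis j 1 + t' m *\<^sub>R axis i 1))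
      = h m * (h m * partial j (partial i f) (x + s m *\<^sub>R axis i 1 + t m *\<^sub>R axis j 1))" for m
  proof -
    have c: "x + h m *\<^sub>R axis j 1 + h m *\<^sub>R axis i 1 = x + h m *\<^sub>R axis i 1 + h m *\<^sub>R axis j 1"
      by (simp add: ac_simps)
    have swap: "r - p - q + t = e \<Longrightarrow> r - q - p + t = e' \<Longrightarrow> e' = e" for r p q t e e' :: real by simp
    show ?thesis
      by (rule swap[OF st[of m, THEN conjunct2, THEN conjunct2, THEN conjunct2, THEN conjunct2] st'[of m, THEN conjunct2, THEN conjunct2, THEN conjunct2, THEN conjunct2, unfolded c]])
  qed
  then have eq: "(\<lambda>m. partial i (partial j f) (x + s' m *\<^sub>R axis j 1 + t' m *\<^sub>R axis i 1))
      = (\<lambda>m. partial j (partial i f) (x + s m *\<^sub>R axis i 1 + t m *\<^sub>R axis j 1))"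
    using h[THEN less_imp_neq, THEN not_sym] by simp
  have "(\<lambda>m. partial i (partial j f) (x + s' m *\<^sub>R axis j 1 + t' m *\<^sub>R axis i 1)) \<longlonglongrightarrow> partial i (partial j f) x"
    by (intro tends smooth_partial f sq) (use st' in auto)
  moreover have "(\<lambda>m. partial j (partial i f) (x + s m *\<^sub>R axis i 1 + t m *\<^sub>R axis j 1)) \<longlonglongrightarrow> partial j (partial i f) x"
    by (intro tends smooth_partial f sq) (use st in auto)
  ultimately show ?thesis unfolding eq by (rule LIMSEQ_unique)
qed

section \<open>The divergence theorem on the cube\<close>

lemma mem_cube: "x \<in> cube R \<longleftrightarrow> (\<forall>i. - R < x $ i \<and> x $ i < R)"
  by (simp add: cube_def mem_box_cart)

lemma open_cube [simp]: "open (cube R)"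
  by (simp add: cube_def open_box)

lemma closure_cube:
  fixes R :: real assumes "0 < R"
  shows "closure (cube R :: (real ^ 'n::finite) set) = {x. \<forall>i. - R \<le> x $ i \<and> x $ i \<le> R}"
proof -
  have "box (vec (- R)) (vec R :: real ^ 'n) \<noteq> {}"
  proof -
    have "0 \<in> box (vec (- R)) (vec R :: real ^ 'n)" using assms by (simp add: mem_box_cart)
    then show ?thesis by blast
  qed
  then show ?thesis
    by (auto simp: cube_def closure_box mem_box_cart set_eq_iff)
qed

lemma frontier_cube:
  fixes R :: real assumes "0 < R"
  shows "frontier (cube R :: (real ^ 'n::finite) set)
    = {x. (\<forall>i. - R \<le> x $ i \<and> x $ i \<le> R) \<and> (\<exists>i. x $ i = R \<or> x $ i = - R)}"
proof -
  have "frontier (cube R :: (real ^ 'n) set) = closure (cube R) - cube R"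
    by (simp add: frontier_def interior_open)
  also have "\<dots> = {x. (\<forall>i. - R \<le> x $ i \<and> x $ i \<le> R) \<and> (\<exists>i. x $ i = R \<or> x $ i = - R)}"
    unfolding closure_cube[OF assms] by (auto simp: mem_cube less_le) (metis order.order_iff_strict)+
  finally show ?thesis .
qed

lemma compact_closure_cube: "compact (closure (cube R :: (real ^ 'n::finite) set))"
  by (simp add: cube_def compact_closure bounded_box)

lemma C1_closure_cube_bounded:
  fixes f :: "real ^ 'n::finite \<Rightarrow> real"
  assumes "C1 R f"
  obtains K where "0 < K" "\<And>x. x \<in> closure (cube R) \<Longrightarrow> \<bar>f x\<bar> \<le> K"
    "\<And>x i. x \<in> cube R \<Longrightarrow> \<bar>partial i f x\<bar> \<le> K"
proof -
  have bd: "\<exists>K. \<forall>x\<in>closure (cube R). \<bar>g x\<bar> \<le> K" if "continuous_on (closure (cube R)) g" for g :: "real ^ 'n \<Rightarrow> real"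
    using compact_continuous_image[OF that compact_closure_cube]
    by (auto simp: bounded_iff dest!: compact_imp_bounded)
  have "\<exists>K. \<forall>x\<in>cube R. \<bar>partial i f x\<bar> \<le> K" for i
  proof -
    obtain g where "continuous_on (closure (cube R)) g" "\<forall>x\<in>cube R. g x = partial i f x"
      using C1_closureD(3)[OF assms] by blast
    then show ?thesis using bd[of g] closure_subset by (metis subsetD)
  qed
  then obtain K where K: "\<And>i. \<forall>x\<in>cube R. \<bar>partial i f x\<bar> \<le> K i" by metis
  obtain L where L: "\<forall>x\<in>closure (cube R). \<bar>f x\<bar> \<le> L" using bd[OF C1_closureD(1)[OF assms]] by blast
  have K': "K i \<le> (\<Sum>i\<in>UNIV. \<bar>K i\<bar>)" for i
    by (rule order_trans[OF abs_ge_self]) (rule member_le_sum, auto)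
  have nn: "0 \<le> (\<Sum>i\<in>UNIV. \<bar>K i\<bar>)" by (rule sum_nonneg) auto
  show ?thesis
  proof (rule that)
    show "0 < 1 + \<bar>L\<bar> + (\<Sum>i\<in>UNIV. \<bar>K i\<bar>)" using nn by linarith
    show "\<bar>f x\<bar> \<le> 1 + \<bar>L\<bar> + (\<Sum>i\<in>UNIV. \<bar>K i\<bar>)" if "x \<in> closure (cube R)" for x
      using bspec[OF L that] nn by linarith
    show "\<bar>partial i f x\<bar> \<le> 1 + \<bar>L\<bar> + (\<Sum>i\<in>UNIV. \<bar>K i\<bar>)" if "x \<in> cube R" for x i
      using bspec[OF K that, of i] K'[of i] by linarith
  qed
qed

lemma finite_measure_lebesgue_on_cube [simp]: "finite_measure (lebesgue_on (cube R :: (real ^ 'n::finite) set))"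
  by (rule finite_measureI)
     (simp add: emeasure_restrict_space cube_def space_restrict_space emeasure_lborel_box_eq)

lemma C1_closure_measurable:
  assumes "C1 R f"
  shows "f \<in> borel_measurable (leb R)" "partial i f \<in> borel_measurable (leb R)"
proof -
  have [simp]: "cube R \<in> sets lebesgue" by (simp add: borel_open)
  show "f \<in> borel_measurable (leb R)"
    by (rule continuous_imp_measurable_on_sets_lebesgue)
       (auto intro: continuous_on_subset[OF C1_closureD(1)[OF assms] closure_subset])
  show "partial i f \<in> borel_measurable (leb R)"
    by (rule continuous_imp_measurable_on_sets_lebesgue)
       (auto intro: C1_closure_partial_continuous[OF assms])
qed

lemma C1_closure_integrable:
  assumes "C1 R f"
  shows "integrable (leb R) f" "integrable (leb R) (partial i f)"
proof -
  obtain K where K: "\<And>x. x \<in> closure (cube R) \<Longrightarrow> \<bar>f x\<bar> \<le> K" "\<And>x i. x \<in> cube R \<Longrightarrow> \<bar>partial i f x\<bar> \<le> K"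
    using C1_closure_cube_bounded[OF assms] by metis
  show "integrable (leb R) f"
    using K(1) closure_subset C1_closure_measurable[OF assms]
    by (intro finite_measure.integrable_const_bound[where B=K] finite_measure_lebesgue_on_cube AE_I2) auto
  show "integrable (leb R) (partial i f)"
    using K(2) C1_closure_measurable[OF assms]
    by (intro finite_measure.integrable_const_bound[where B=K] finite_measure_lebesgue_on_cube AE_I2) auto
qed

text \<open>Lebesgue measure on \<open>\<real>\<^sup>n\<close> as a product indexed by the coordinates rather than by the standard
  basis, so that one coordinate can be split off.\<close>

lemma lborel_vec:
  "(lborel :: (real ^ 'n::finite) measure) = distr (\<Pi>\<^sub>M j\<in>UNIV. lborel) borel (\<lambda>f. \<chi> j. f j)"
proof (rule lborel_eqI)
  interpret product_sigma_finite "\<lambda>_::'n. lborel :: real measure" by standard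
  have meas: "(\<lambda>f. \<chi> j. f j) \<in> borel_measurable (\<Pi>\<^sub>M j\<in>(UNIV :: 'n set). (lborel :: real measure))"
    by (subst borel_measurable_euclidean_space) (auto simp: Basis_vec_def inner_axis)
  fix l u :: "real ^ 'n"
  assume le: "\<And>b. b \<in> Basis \<Longrightarrow> l \<bullet> b \<le> u \<bullet> b"
  have le': "l $ j \<le> u $ j" for j
    using le[of "axis j 1"] axis_in_Basis_iff[of j "1::real"] by (simp add: inner_axis)
  have inj: "inj (\<lambda>j. axis j (1::real) :: real ^ 'n)"
    by (auto simp: inj_def axis_eq_axis)
  have B: "(Basis :: (real ^ 'n) set) = range (\<lambda>j. axis j 1)" by (auto simp: Basis_vec_def)
  have "emeasure (distr (\<Pi>\<^sub>M j\<in>(UNIV :: 'n set). lborel) borel (\<lambda>f. \<chi> j. f j)) (box l u)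
      = emeasure (\<Pi>\<^sub>M j\<in>(UNIV :: 'n set). lborel) (\<Pi>\<^sub>E j\<in>UNIV. {l $ j <..< u $ j})"
    by (subst emeasure_distr[OF meas])
       (auto simp: mem_box_cart space_PiM PiE_def Pi_def intro!: arg_cong2[where f=emeasure])
  also have "\<dots> = (\<Prod>j\<in>UNIV. ennreal (u $ j - l $ j))"
    by (subst emeasure_PiM) (auto simp: le')
  also have "\<dots> = (\<Prod>b\<in>Basis. (u - l) \<bullet> b)"
    unfolding B by (simp add: prod_ennreal le' prod.reindex[OF inj] inner_axis)
  finally show "emeasure (distr (\<Pi>\<^sub>M j\<in>(UNIV :: 'n set). lborel) borel (\<lambda>f. \<chi> j. f j)) (box l u)
    = (\<Prod>b\<in>Basis. (u - l) \<bullet> b)" .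
qed simp

lemma embed_hyperplane_nth: "embed_hyperplane j s y $ k = (if k = j then s else y k)"
  by (simp add: embed_hyperplane_def)

lemma has_derivative_embed_hyperplane:
  "((\<lambda>t. embed_hyperplane j t y) has_derivative (\<lambda>h. h *\<^sub>R axis j 1)) (at t)"
proof -
  have "(\<lambda>t. embed_hyperplane j t y) = (\<lambda>t. embed_hyperplane j 0 y + t *\<^sub>R axis j 1)"
    by (auto simp: fun_eq_iff vec_eq_iff embed_hyperplane_nth axis_def)
  then show ?thesis by (auto intro!: derivative_eq_intros)
qed

lemma continuous_on_embed_hyperplane: "continuous_on A (\<lambda>t. embed_hyperplane j t y)"
  by (intro continuous_at_imp_continuous_on ballI has_derivative_continuous[OF has_derivative_embed_hyperplane])

text \<open>On a line parallel to an axis this is the fundamental theorem of calculus. The derivative need not exist at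
  the end points, where only the continuity of \<open>F\<close> is available.\<close>

lemma line_integral_partial:
  fixes F :: "real ^ 'n::finite \<Rightarrow> real"
  assumes F: "C1 R F" and R: "0 < R" and y: "\<forall>i. i \<noteq> j \<longrightarrow> - R < y i \<and> y i < R"
  shows "(LINT t|lborel. indicator {-R<..<R} t *\<^sub>R partial j F (embed_hyperplane j t y))
     = F (embed_hyperplane j R y) - F (embed_hyperplane j (- R) y)"
proof -
  let ?e = "\<lambda>t. embed_hyperplane j t y"
  have cl: "?e t \<in> closure (cube R)" if "- R \<le> t" "t \<le> R" for t
    using that y R by (auto simp: closure_cube embed_hyperplane_nth less_imp_le)
  have op: "?e t \<in> cube R" if "- R < t" "t < R" for t
    using that y by (auto simp: mem_cube embed_hyperplane_nth)
  obtain K where K: "\<And>x i. x \<in> cube R \<Longrightarrow> \<bar>partial i F x\<bar> \<le> K"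
    using C1_closure_cube_bounded[OF F] by metis
  have cont: "continuous_on {-R<..<R} (\<lambda>t. partial j F (?e t))"
    by (rule continuous_on_compose2[OF C1_closure_partial_continuous[OF F] continuous_on_embed_hyperplane])
       (auto intro: op)
  have contF: "continuous_on {-R..R} (\<lambda>t. F (?e t))"
    by (rule continuous_on_compose2[OF C1_closureD(1)[OF F] continuous_on_embed_hyperplane]) (auto intro: cl)
  have meas: "(\<lambda>t. indicator {-R<..<R} t *\<^sub>R partial j F (?e t)) \<in> borel_measurable lborel"
    using borel_measurable_continuous_on_indicator[OF _ cont] by simp
  have int: "set_integrable lborel {-R<..<R} (\<lambda>t. partial j F (?e t))"
    unfolding set_integrable_def
  proof (rule Bochner_Integration.integrable_bound)
    show "integrable lborel (\<lambda>t. indicator {-R<..<R} t *\<^sub>R K)"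
      by (rule integrable_scaleR_left) (use R in \<open>simp add: integrable_indicator_iff\<close>)
    show "AE t in lborel. norm (indicator {-R<..<R} t *\<^sub>R partial j F (?e t)) \<le> norm (indicator {-R<..<R} t *\<^sub>R K)"
      using K op by (intro AE_I2) (auto simp: indicator_def intro: order_trans[OF _ abs_ge_self])
  qed (rule meas)
  have deriv: "((\<lambda>t. F (?e t)) has_vector_derivative partial j F (?e t)) (at t)" if "- R < t" "t < R" for t
  proof -
    have "((\<lambda>t. F (?e t)) has_derivative (\<lambda>h. \<Sum>i\<in>UNIV. partial i F (?e t) * (h *\<^sub>R axis j 1) $ i)) (at t)"
      by (rule has_derivative_compose[OF has_derivative_embed_hyperplane has_derivative_partials])
         (rule C1_closureD(2)[OF F op[OF that]])
    then show ?thesis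
      by (simp add: has_vector_derivative_def axis_def if_distrib mult.commute cong: if_cong)
  qed
  have lims: "((\<lambda>t. F (?e t)) \<longlongrightarrow> F (?e (- R))) (at_right (- R))" "((\<lambda>t. F (?e t)) \<longlongrightarrow> F (?e R)) (at_left R)"
    using continuous_on_Icc_at_rightD[OF contF] continuous_on_Icc_at_leftD[OF contF] R by simp_all
  have "(LBINT t=ereal (-R)..ereal R. partial j F (?e t)) = F (?e R) - F (?e (-R))"
  proof (rule interval_integral_FTC_integrable[where F="\<lambda>t. F (?e t)"])
    show "ereal (-R) < ereal R" using R by simp
    show "((\<lambda>t. F (?e t)) has_vector_derivative partial j F (?e t)) (at t)"
      if "ereal (-R) < ereal t" "ereal t < ereal R" for t using deriv that by simp
    show "isCont (\<lambda>t. partial j F (?e t)) t" if "ereal (-R) < ereal t" "ereal t < ereal R" for t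
      using cont that by (simp add: continuous_on_eq_continuous_at)
    show "set_integrable lborel (einterval (ereal (-R)) (ereal R)) (\<lambda>t. partial j F (?e t))"
      using int by (simp add: einterval_eq_Icc)
    show "(((\<lambda>t. F (?e t)) \<circ> real_of_ereal) \<longlongrightarrow> F (?e (- R))) (at_right (ereal (- R)))"
      using lims(1) by (simp only: ereal_tendsto_simps)
    show "(((\<lambda>t. F (?e t)) \<circ> real_of_ereal) \<longlongrightarrow> F (?e R)) (at_left (ereal R))"
      using lims(2) by (simp only: ereal_tendsto_simps)
  qed
  then show ?thesis using R
    by (simp add: interval_lebesgue_integral_le_eq set_lebesgue_integral_def einterval_eq_Icc)
qed

text \<open>The edges are left out, because the boundary conditions on the coefficients and on the normal derivative
  say something about the relative interior of a face only.\<close>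

definition open_face :: "real \<Rightarrow> 'n::finite \<Rightarrow> real \<Rightarrow> (real ^ 'n) set" where
  "open_face R j s = {x. x $ j = s \<and> (\<forall>i. i \<noteq> j \<longrightarrow> - R < x $ i \<and> x $ i < R)}"

lemma embed_hyperplane_in_open_face:
  "embed_hyperplane j s y \<in> open_face R j s \<longleftrightarrow> (\<forall>i. i \<noteq> j \<longrightarrow> - R < y i \<and> y i < R)"
  by (auto simp: open_face_def embed_hyperplane_nth)

lemma open_face_subset_frontier:
  assumes "0 < R" "s \<in> {R, - R}" shows "open_face R j s \<subseteq> frontier (cube R)"
  using assms by (auto simp: open_face_def frontier_cube) (metis less_le less_eq_real_def minus_less_iff neg_less_0_iff_less order.strict_trans order_refl)+

lemma open_face_subset_closure:
  assumes "0 < R" "s \<in> {R, - R}" shows "open_face R j s \<subseteq> closure (cube R)"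
  using open_face_subset_frontier[OF assms] by (auto simp: frontier_def)

lemma open_face_borel [measurable]: "open_face R j s \<in> sets borel"
proof -
  have "open_face R j s = {x. x $ j = s} \<inter> (\<Inter>i. {x. i \<noteq> j \<longrightarrow> - R < x $ i} \<inter> {x. i \<noteq> j \<longrightarrow> x $ i < R})"
    by (auto simp: open_face_def)
  moreover have "{x :: real ^ 'a. x $ j = s} \<in> sets borel"
    by (intro borel_closed closed_Collect_eq continuous_intros)
  moreover have "{x :: real ^ 'a. i \<noteq> j \<longrightarrow> - R < x $ i} \<in> sets borel" for i
    by (cases "i = j") (auto intro!: borel_open open_Collect_less continuous_intros)
  moreover have "{x :: real ^ 'a. i \<noteq> j \<longrightarrow> x $ i < R} \<in> sets borel" for i
    by (cases "i = j") (auto intro!: borel_open open_Collect_less continuous_intros)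
  ultimately show ?thesis by (auto intro!: sets.countable_INT')
qed

abbreviation face_measure :: "'n::finite \<Rightarrow> ('n \<Rightarrow> real) measure" where
  "face_measure j \<equiv> (\<Pi>\<^sub>M i\<in>UNIV - {j}. lborel)"

lemma integral_partial_cube:
  fixes F :: "real ^ 'n::finite \<Rightarrow> real"
  assumes F: "C1 R F" and R: "0 < R"
  shows "(LINT x|leb R. partial j F x)
    = (LINT y|face_measure j. indicator (open_face R j R) (embed_hyperplane j R y)
         * (F (embed_hyperplane j R y) - F (embed_hyperplane j (- R) y)))"
proof -
  interpret product_sigma_finite "\<lambda>_::'n. lborel :: real measure" by standard
  let ?f = "\<lambda>x. indicator (cube R) x *\<^sub>R partial j F x"
  have cube: "cube R \<inter> space lebesgue \<in> sets (lebesgue :: (real ^ 'n) measure)" by (simp add: borel_open)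
  have fm: "?f \<in> borel_measurable borel"
    by (rule borel_measurable_continuous_on_indicator[OF _ C1_closure_partial_continuous[OF F]]) simp
  have "integrable lebesgue ?f"
    by (rule integrable_restrict_space[OF cube, THEN iffD1, OF C1_closure_integrable(2)[OF F]])
  then have fi: "integrable lborel ?f"
    by (subst (asm) integrable_completion) (simp_all add: fm[simplified])
  have meas: "(\<lambda>f. \<chi> j. f j) \<in> borel_measurable (\<Pi>\<^sub>M j\<in>(UNIV :: 'n set). (lborel :: real measure))"
    by (subst borel_measurable_euclidean_space) (auto simp: Basis_vec_def inner_axis)
  have ins: "insert j (UNIV - {j}) = UNIV" by auto
  have fi': "integrable (\<Pi>\<^sub>M j\<in>(UNIV :: 'n set). lborel) (\<lambda>g. ?f (\<chi> j. g j))"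
    using fi integrable_distr_eq[OF meas fm] by (simp only: lborel_vec)
  have upd: "(\<chi> k. (y(j := t)) k) = embed_hyperplane j t y" for y :: "'n \<Rightarrow> real" and t
    by (auto simp: vec_eq_iff embed_hyperplane_nth)
  have "(LINT x|leb R. partial j F x) = (LINT x|lebesgue. ?f x)"
    by (rule integral_restrict_space[OF cube])
  also have "\<dots> = (LINT x|lborel. ?f x)" using fm by (intro integral_completion) simp
  also have "\<dots> = (LINT g|(\<Pi>\<^sub>M j\<in>UNIV. lborel). ?f (\<chi> j. g j))"
    by (subst lborel_vec) (rule integral_distr[OF meas fm])
  also have "\<dots> = (LINT y|face_measure j. (LINT t|lborel. ?f (embed_hyperplane j t y)))"
    using product_integral_insert[of "UNIV - {j}" j "\<lambda>g. ?f (\<chi> j. g j)", unfolded ins upd, OF _ _ fi'] by simp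
  also have "\<dots> = (LINT y|face_measure j. indicator (open_face R j R) (embed_hyperplane j R y)
         * (F (embed_hyperplane j R y) - F (embed_hyperplane j (- R) y)))"
  proof (intro Bochner_Integration.integral_cong refl)
    fix y :: "'n \<Rightarrow> real"
    show "(LINT t|lborel. ?f (embed_hyperplane j t y)) = indicator (open_face R j R) (embed_hyperplane j R y)
         * (F (embed_hyperplane j R y) - F (embed_hyperplane j (- R) y))"
    proof (cases "\<forall>i. i \<noteq> j \<longrightarrow> - R < y i \<and> y i < R")
      case True
      then have "embed_hyperplane j t y \<in> cube R \<longleftrightarrow> t \<in> {-R<..<R}" for t
        by (auto simp: mem_cube embed_hyperplane_nth)
      then have ind: "(\<lambda>t. ?f (embed_hyperplane j t y)) = (\<lambda>t. indicator {-R<..<R} t *\<^sub>R partial j F (embed_hyperplane j t y))"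
        by (simp add: indicator_def)
      show ?thesis unfolding ind line_integral_partial[OF F R True] using True
        by (simp add: embed_hyperplane_in_open_face)
    next
      case False
      then have "embed_hyperplane j t y \<notin> cube R" for t
        by (auto simp: mem_cube embed_hyperplane_nth)
      then show ?thesis using False by (simp add: embed_hyperplane_in_open_face[of _ _ _ R])
    qed
  qed
  finally show ?thesis .
qed

text \<open>Comparing two functions on the two faces compares the integrals of their derivatives. In this form the
  divergence theorem is used below without writing any integral over a face.\<close>

lemma integral_partial_cube_nonneg:
  fixes F :: "real ^ 'n::finite \<Rightarrow> real"
  assumes F: "C1 R F" and R: "0 < R"
    and "\<And>x. x \<in> open_face R j R \<Longrightarrow> 0 \<le> F x" "\<And>x. x \<in> open_face R j (- R) \<Longrightarrow> F x \<le> 0"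
  shows "0 \<le> (LINT x|leb R. partial j F x)"
  unfolding integral_partial_cube[OF F R]
proof (rule Bochner_Integration.integral_nonneg)
  fix y
  show "0 \<le> indicator (open_face R j R) (embed_hyperplane j R y)
         * (F (embed_hyperplane j R y) - F (embed_hyperplane j (- R) y))"
  proof (cases "embed_hyperplane j R y \<in> open_face R j R")
    case True
    then have "embed_hyperplane j (- R) y \<in> open_face R j (- R)"
      unfolding embed_hyperplane_in_open_face .
    then show ?thesis using assms(3)[OF True] assms(4) by (simp add: order_trans[of _ 0])
  qed simp
qed

lemma integral_partial_cube_mono:
  fixes F :: "real ^ 'n::finite \<Rightarrow> real"
  assumes F: "C1 R F" and G: "C1 R G" and R: "0 < R"
    and le: "\<And>x. x \<in> open_face R j R \<Longrightarrow> F x \<le> G x" "\<And>x. x \<in> open_face R j (- R) \<Longrightarrow> G x \<le> F x"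
  shows "(LINT x|leb R. partial j F x) \<le> (LINT x|leb R. partial j G x)"
proof -
  have "0 \<le> (LINT x|leb R. partial j (\<lambda>x. G x - F x) x)"
    by (intro integral_partial_cube_nonneg C1_closure_diff F G R) (auto simp: le)
  also have "\<dots> = (LINT x|leb R. partial j G x - partial j F x)"
    by (intro Bochner_Integration.integral_cong) (auto simp: partial_diff C1_closureD(2)[OF F] C1_closureD(2)[OF G])
  also have "\<dots> = (LINT x|leb R. partial j G x) - (LINT x|leb R. partial j F x)"
    by (intro Bochner_Integration.integral_diff C1_closure_integrable F G)
  finally show ?thesis by simp
qed

subsection \<open>Comparison with the surface measure\<close>

text \<open>On Borel sets inside the frontier, the surface measure is a sum of which the measure of one hyperplane is a
  summand. An inequality is enough, as the surface integrals only serve to show that something tends to zero.\<close>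

lemma face_nn_integral_le:
  fixes f :: "real ^ 'n::finite \<Rightarrow> ennreal"
  assumes f [measurable]: "f \<in> borel_measurable borel" and R: "0 < R" and s: "s \<in> {R, - R}"
  shows "(\<integral>\<^sup>+y. f (embed_hyperplane j s y) * indicator (open_face R j s) (embed_hyperplane j s y) \<partial>face_measure j)
    \<le> (\<integral>\<^sup>+x\<in>open_face R j s. f x \<partial>surface_measure R)"
proof -
  let ?N = "density (hyperplane_measure j s) (indicator (frontier (cube R)))"
  have [measurable_cong]: "sets (hyperplane_measure j s) = sets borel" by (simp add: hyperplane_measure_def)
  have [measurable]: "frontier (cube R) \<in> sets (borel :: (real ^ 'n) measure)" by (simp add: borel_closed)
  have le: "?N \<le> surface_measure R"
  proof (subst le_measure)
    show "sets ?N = sets (surface_measure R)" by (simp add: hyperplane_measure_def)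
    show "\<forall>A\<in>sets ?N. emeasure ?N A \<le> emeasure (surface_measure R) A"
    proof
      fix A assume "A \<in> sets ?N"
      then have A[measurable]: "A \<in> sets borel" by (simp add: hyperplane_measure_def)
      have "emeasure ?N A = emeasure (hyperplane_measure j s) (A \<inter> frontier (cube R))"
        by (subst emeasure_density)
           (auto simp: hyperplane_measure_def indicator_inter_arith[symmetric] nn_integral_indicator mult.commute Int_commute)
      also have "\<dots> \<le> (\<Sum>s\<in>{R, - R}. emeasure (hyperplane_measure j s) (A \<inter> frontier (cube R)))"
        by (rule member_le_sum) (use s in auto)
      also have "\<dots> \<le> (\<Sum>i\<in>UNIV. \<Sum>s\<in>{R, - R}. emeasure (hyperplane_measure i s) (A \<inter> frontier (cube R)))"
        by (rule member_le_sum) auto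
      finally show "emeasure ?N A \<le> emeasure (surface_measure R) A"
        by (simp add: emeasure_surface_measure A)
    qed
  qed
  have fr: "indicator (frontier (cube R)) x * (f x * indicator (open_face R j s) x) = f x * indicator (open_face R j s) x" for x
    using open_face_subset_frontier[OF R s, of j] by (auto simp: indicator_def)
  have "(\<integral>\<^sup>+y. f (embed_hyperplane j s y) * indicator (open_face R j s) (embed_hyperplane j s y) \<partial>face_measure j)
    = (\<integral>\<^sup>+x. f x * indicator (open_face R j s) x \<partial>hyperplane_measure j s)"
    unfolding hyperplane_measure_def
    by (subst nn_integral_distr[OF embed_hyperplane_measurable]) simp_all
  also have "\<dots> = (\<integral>\<^sup>+x. f x * indicator (open_face R j s) x \<partial>?N)"
    by (subst nn_integral_density) (simp_all add: fr)
  also have "\<dots> \<le> (\<integral>\<^sup>+x\<in>open_face R j s. f x \<partial>surface_measure R)"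
    by (rule nn_integral_mono_measure[OF _ le]) (simp add: hyperplane_measure_def)
  finally show ?thesis .
qed

section \<open>Square integrable functions and limits of \<open>C\<^sup>1\<close> functions\<close>

lemma L2_measurable: "f \<in> L2 \<Omega> \<Longrightarrow> f \<in> borel_measurable (lebesgue_on \<Omega>)"
  by (simp add: L2_def)

lemma L2_integrable_square: "f \<in> L2 \<Omega> \<Longrightarrow> integrable (lebesgue_on \<Omega>) (\<lambda>x. (f x)\<^sup>2)"
  by (simp add: L2_def)

lemma L2_integrable_mult:
  assumes "f \<in> L2 \<Omega>" "g \<in> L2 \<Omega>"
  shows "integrable (lebesgue_on \<Omega>) (\<lambda>x. f x * g x)"
proof (rule Bochner_Integration.integrable_bound)
  show "integrable (lebesgue_on \<Omega>) (\<lambda>x. (f x)\<^sup>2 + (g x)\<^sup>2)"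
    using assms by (intro Bochner_Integration.integrable_add L2_integrable_square)
  show "(\<lambda>x. f x * g x) \<in> borel_measurable (lebesgue_on \<Omega>)"
    using assms by (intro borel_measurable_times L2_measurable)
  show "AE x in lebesgue_on \<Omega>. norm (f x * g x) \<le> norm ((f x)\<^sup>2 + (g x)\<^sup>2)"
  proof (rule AE_I2)
    fix x
    have "2 * \<bar>f x\<bar> * \<bar>g x\<bar> \<le> \<bar>f x\<bar>\<^sup>2 + \<bar>g x\<bar>\<^sup>2" by (rule sum_squares_bound)
    moreover have "0 \<le> \<bar>f x\<bar> * \<bar>g x\<bar>" by simp
    moreover have "2 * \<bar>f x\<bar> * \<bar>g x\<bar> = 2 * (\<bar>f x\<bar> * \<bar>g x\<bar>)" by simp
    ultimately have "\<bar>f x\<bar> * \<bar>g x\<bar> \<le> (f x)\<^sup>2 + (g x)\<^sup>2" unfolding power2_abs by linarith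
    then show "norm (f x * g x) \<le> norm ((f x)\<^sup>2 + (g x)\<^sup>2)" by (simp add: abs_mult)
  qed
qed

lemma L2_add: 
  assumes "f \<in> L2 \<Omega>" "g \<in> L2 \<Omega>" shows "(\<lambda>x. f x + g x) \<in> L2 \<Omega>"
proof -
  have "integrable (lebesgue_on \<Omega>) (\<lambda>x. (f x)\<^sup>2 + (g x)\<^sup>2 + 2 * (f x * g x))"
    using assms by (intro Bochner_Integration.integrable_add integrable_mult_right L2_integrable_square L2_integrable_mult)
  then show ?thesis using assms by (auto simp: L2_def power2_sum mult.assoc)
qed

lemma L2_bounded_mult:
  assumes f: "f \<in> L2 \<Omega>" and c: "c \<in> borel_measurable (lebesgue_on \<Omega>)" and K: "\<And>x. x \<in> \<Omega> \<Longrightarrow> \<bar>c x\<bar> \<le> K"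
  shows "(\<lambda>x. c x * f x) \<in> L2 \<Omega>"
proof -
  have "integrable (lebesgue_on \<Omega>) (\<lambda>x. (c x * f x)\<^sup>2)"
  proof (rule Bochner_Integration.integrable_bound)
    show "integrable (lebesgue_on \<Omega>) (\<lambda>x. K\<^sup>2 * (f x)\<^sup>2)"
      by (intro integrable_mult_right L2_integrable_square f)
    show "(\<lambda>x. (c x * f x)\<^sup>2) \<in> borel_measurable (lebesgue_on \<Omega>)"
      using c L2_measurable[OF f] by simp
    have "(c x)\<^sup>2 \<le> K\<^sup>2" if "x \<in> \<Omega>" for x
      using power_mono[OF K[OF that], of 2] by simp
    then show "AE x in lebesgue_on \<Omega>. norm ((c x * f x)\<^sup>2) \<le> norm (K\<^sup>2 * (f x)\<^sup>2)"
      by (intro AE_I2) (simp add: power_mult_distrib mult_right_mono abs_mult)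
  qed
  then show ?thesis using c L2_measurable[OF f] by (simp add: L2_def)
qed

lemma L2_cmult: "f \<in> L2 \<Omega> \<Longrightarrow> (\<lambda>x. c * f x) \<in> L2 \<Omega>"
  by (rule L2_bounded_mult[where K="\<bar>c\<bar>"]) auto

lemma L2_diff: "f \<in> L2 \<Omega> \<Longrightarrow> g \<in> L2 \<Omega> \<Longrightarrow> (\<lambda>x. f x - g x) \<in> L2 \<Omega>"
  using L2_add[of f \<Omega> "\<lambda>x. (-1) * g x"] L2_cmult[of g \<Omega> "-1"] by simp

lemma L2_zero: "(\<lambda>x. 0) \<in> L2 \<Omega>"
  by (simp add: L2_def)

lemma L2_sum: "(\<And>i. i \<in> I \<Longrightarrow> f i \<in> L2 \<Omega>) \<Longrightarrow> (\<lambda>x. \<Sum>i\<in>I. f i x) \<in> L2 \<Omega>"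
  by (induction I rule: infinite_finite_induct) (auto intro: L2_add L2_zero)

lemma L2_cong:
  assumes "\<And>x. x \<in> \<Omega> \<Longrightarrow> f x = g x" shows "f \<in> L2 \<Omega> \<longleftrightarrow> g \<in> L2 \<Omega>"
proof -
  have "f \<in> borel_measurable (lebesgue_on \<Omega>) \<longleftrightarrow> g \<in> borel_measurable (lebesgue_on \<Omega>)"
    by (rule measurable_cong) (simp add: assms)
  moreover have "integrable (lebesgue_on \<Omega>) (\<lambda>x. (f x)\<^sup>2) \<longleftrightarrow> integrable (lebesgue_on \<Omega>) (\<lambda>x. (g x)\<^sup>2)"
    by (rule Bochner_Integration.integrable_cong) (simp_all add: assms)
  ultimately show ?thesis by (simp add: L2_def)
qed

text \<open>The quadratic polynomial \<open>t \<mapsto> \<integral> (f + t g)\<^sup>2\<close> is nonnegative.\<close>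

lemma L2_Cauchy_Schwarz:
  assumes "f \<in> L2 \<Omega>" "g \<in> L2 \<Omega>"
  shows "\<bar>LINT x|lebesgue_on \<Omega>. f x * g x\<bar>
    \<le> sqrt (LINT x|lebesgue_on \<Omega>. (f x)\<^sup>2) * sqrt (LINT x|lebesgue_on \<Omega>. (g x)\<^sup>2)"
proof -
  define a b c where "a = (LINT x|lebesgue_on \<Omega>. (f x)\<^sup>2)" and "b = (LINT x|lebesgue_on \<Omega>. f x * g x)"
    and "c = (LINT x|lebesgue_on \<Omega>. (g x)\<^sup>2)"
  have q: "0 \<le> a + 2 * b * t + c * t\<^sup>2" for t
  proof -
    have "0 \<le> (LINT x|lebesgue_on \<Omega>. (f x + t * g x)\<^sup>2)" by simp
    also have "\<dots> = (LINT x|lebesgue_on \<Omega>. (f x)\<^sup>2 + (2 * t) * (f x * g x) + t\<^sup>2 * (g x)\<^sup>2)"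
      by (intro Bochner_Integration.integral_cong) (auto simp: power2_eq_square algebra_simps)
    also have "\<dots> = a + (2 * t) * b + t\<^sup>2 * c"
      unfolding a_def b_def c_def using assms
      by (simp add: L2_integrable_mult L2_integrable_square)
    finally show ?thesis by (simp add: mult.commute mult.left_commute)
  qed
  have nn: "0 \<le> a" "0 \<le> c" by (simp_all add: a_def c_def)
  have "b\<^sup>2 \<le> a * c"
  proof (cases "c = 0")
    case True
    have "b = 0"
    proof (rule ccontr)
      assume "b \<noteq> 0"
      then show False using q[of "- (a + 1) / (2 * b)"] True nn by (simp add: field_simps)
    qed
    then show ?thesis using nn by simp
  next
    case False
    then have "0 < c" using nn by simp
    then show ?thesis using q[of "- b / c"] by (simp add: field_simps power2_eq_square)
  qed
  then have "sqrt (b\<^sup>2) \<le> sqrt (a * c)" by (rule real_sqrt_le_mono)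
  then show ?thesis by (simp add: a_def b_def c_def real_sqrt_mult)
qed

lemma square_sum_le: "(r + s)\<^sup>2 \<le> 2 * r\<^sup>2 + 2 * s\<^sup>2" for r s :: real
  using zero_le_power2[of "r - s"] by (simp add: power2_eq_square algebra_simps)

definition tends_L2 ::
  "(real ^ 'n::finite) set \<Rightarrow> (nat \<Rightarrow> real ^ 'n \<Rightarrow> real) \<Rightarrow> (real ^ 'n \<Rightarrow> real) \<Rightarrow> bool" where
  "tends_L2 \<Omega> F f \<longleftrightarrow> (\<forall>m. F m \<in> L2 \<Omega>) \<and> f \<in> L2 \<Omega> \<and>
     (\<lambda>m. LINT x|lebesgue_on \<Omega>. (F m x - f x)\<^sup>2) \<longlonglongrightarrow> 0"

lemma tends_L2_D:
  assumes "tends_L2 \<Omega> F f"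
  shows "F m \<in> L2 \<Omega>" "f \<in> L2 \<Omega>" "(\<lambda>m. LINT x|lebesgue_on \<Omega>. (F m x - f x)\<^sup>2) \<longlonglongrightarrow> 0"
  using assms by (auto simp: tends_L2_def)

lemma tends_L2_const: "f \<in> L2 \<Omega> \<Longrightarrow> tends_L2 \<Omega> (\<lambda>m. f) f"
  by (simp add: tends_L2_def)

lemma tends_L2_cong:
  assumes "\<And>m x. x \<in> \<Omega> \<Longrightarrow> F m x = G m x" "\<And>x. x \<in> \<Omega> \<Longrightarrow> f x = g x"
  shows "tends_L2 \<Omega> F f \<longleftrightarrow> tends_L2 \<Omega> G g"
proof -
  have "(LINT x|lebesgue_on \<Omega>. (F m x - f x)\<^sup>2) = (LINT x|lebesgue_on \<Omega>. (G m x - g x)\<^sup>2)" for m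
    by (rule Bochner_Integration.integral_cong) (simp_all add: assms)
  moreover have "F m \<in> L2 \<Omega> \<longleftrightarrow> G m \<in> L2 \<Omega>" for m by (rule L2_cong) (rule assms)
  moreover have "f \<in> L2 \<Omega> \<longleftrightarrow> g \<in> L2 \<Omega>" by (rule L2_cong) (rule assms)
  ultimately show ?thesis by (simp add: tends_L2_def)
qed

lemma tends_L2_add:
  assumes F: "tends_L2 \<Omega> F f" and G: "tends_L2 \<Omega> G g"
  shows "tends_L2 \<Omega> (\<lambda>m x. F m x + G m x) (\<lambda>x. f x + g x)"
  unfolding tends_L2_def
proof (intro conjI allI)
  show "(\<lambda>x. F m x + G m x) \<in> L2 \<Omega>" for m using F G by (intro L2_add tends_L2_D)
  show "(\<lambda>x. f x + g x) \<in> L2 \<Omega>" using F G by (intro L2_add tends_L2_D)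
  let ?a = "\<lambda>m. LINT x|lebesgue_on \<Omega>. (F m x - f x)\<^sup>2"
  let ?b = "\<lambda>m. LINT x|lebesgue_on \<Omega>. (G m x - g x)\<^sup>2"
  have le: "(LINT x|lebesgue_on \<Omega>. (F m x + G m x - (f x + g x))\<^sup>2) \<le> 2 * ?a m + 2 * ?b m" for m
  proof -
    note L = L2_diff[OF tends_L2_D(1,2)[OF F], of m] L2_diff[OF tends_L2_D(1,2)[OF G], of m]
    have "(LINT x|lebesgue_on \<Omega>. (F m x + G m x - (f x + g x))\<^sup>2)
      = (LINT x|lebesgue_on \<Omega>. ((F m x - f x) + (G m x - g x))\<^sup>2)" by (simp add: algebra_simps)
    also have "\<dots> \<le> (LINT x|lebesgue_on \<Omega>. 2 * (F m x - f x)\<^sup>2 + 2 * (G m x - g x)\<^sup>2)"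
      using L L2_integrable_square[OF L2_add[OF L]]
      by (intro integral_mono) (auto simp: L2_integrable_square intro!: square_sum_le)
    also have "\<dots> = 2 * ?a m + 2 * ?b m" using L by (simp add: L2_integrable_square)
    finally show ?thesis .
  qed
  have "(\<lambda>m. 2 * ?a m + 2 * ?b m) \<longlonglongrightarrow> 2 * 0 + 2 * 0"
    by (intro tendsto_intros tends_L2_D F G)
  then have lim: "(\<lambda>m. 2 * ?a m + 2 * ?b m) \<longlonglongrightarrow> 0" by simp
  show "(\<lambda>m. LINT x|lebesgue_on \<Omega>. (F m x + G m x - (f x + g x))\<^sup>2) \<longlonglongrightarrow> 0"
    by (rule tendsto_sandwich[OF _ _ tendsto_const lim]) (auto intro!: always_eventually le)
qed

lemma tends_L2_bounded_mult:
  assumes F: "tends_L2 \<Omega> F f" and c: "c \<in> borel_measurable (lebesgue_on \<Omega>)"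
    and K: "\<And>x. x \<in> \<Omega> \<Longrightarrow> \<bar>c x\<bar> \<le> K"
  shows "tends_L2 \<Omega> (\<lambda>m x. c x * F m x) (\<lambda>x. c x * f x)"
  unfolding tends_L2_def
proof (intro conjI allI)
  show "(\<lambda>x. c x * F m x) \<in> L2 \<Omega>" for m using F by (intro L2_bounded_mult[OF _ c K] tends_L2_D)
  show "(\<lambda>x. c x * f x) \<in> L2 \<Omega>" using F by (intro L2_bounded_mult[OF _ c K] tends_L2_D)
  let ?a = "\<lambda>m. LINT x|lebesgue_on \<Omega>. (F m x - f x)\<^sup>2"
  have sq: "(c x)\<^sup>2 \<le> K\<^sup>2" if "x \<in> \<Omega>" for x
    using power_mono[OF K[OF that], of 2] by simp
  have le: "(LINT x|lebesgue_on \<Omega>. (c x * F m x - c x * f x)\<^sup>2) \<le> K\<^sup>2 * ?a m" for m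
  proof -
    note L = L2_diff[OF tends_L2_D(1,2)[OF F], of m]
    have "(LINT x|lebesgue_on \<Omega>. (c x * F m x - c x * f x)\<^sup>2)
      = (LINT x|lebesgue_on \<Omega>. (c x * (F m x - f x))\<^sup>2)" by (simp add: algebra_simps)
    also have "\<dots> \<le> (LINT x|lebesgue_on \<Omega>. K\<^sup>2 * (F m x - f x)\<^sup>2)"
      using L2_integrable_square[OF L2_bounded_mult[OF L c K]] L sq
      by (intro integral_mono) (auto simp: L2_integrable_square power_mult_distrib intro!: mult_right_mono)
    also have "\<dots> = K\<^sup>2 * ?a m" by simp
    finally show ?thesis .
  qed
  have "(\<lambda>m. K\<^sup>2 * ?a m) \<longlonglongrightarrow> K\<^sup>2 * 0"
    by (intro tendsto_intros tends_L2_D F)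
  then have lim: "(\<lambda>m. K\<^sup>2 * ?a m) \<longlonglongrightarrow> 0" by simp
  show "(\<lambda>m. LINT x|lebesgue_on \<Omega>. (c x * F m x - c x * f x)\<^sup>2) \<longlonglongrightarrow> 0"
    by (rule tendsto_sandwich[OF _ _ tendsto_const lim]) (auto intro!: always_eventually le)
qed

lemma tends_L2_integral_mult:
  assumes F: "tends_L2 \<Omega> F f" and G: "tends_L2 \<Omega> G g"
  shows "(\<lambda>m. LINT x|lebesgue_on \<Omega>. F m x * G m x) \<longlonglongrightarrow> (LINT x|lebesgue_on \<Omega>. f x * g x)"
proof -
  have lim0: "(\<lambda>m. LINT x|lebesgue_on \<Omega>. P m x * Q m x) \<longlonglongrightarrow> 0"
    if P: "\<And>m. P m \<in> L2 \<Omega>" "(\<lambda>m. LINT x|lebesgue_on \<Omega>. (P m x)\<^sup>2) \<longlonglongrightarrow> 0"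
    and Q: "\<And>m. Q m \<in> L2 \<Omega>" "(\<lambda>m. LINT x|lebesgue_on \<Omega>. (Q m x)\<^sup>2) \<longlonglongrightarrow> q" for P Q q
  proof -
    have "(\<lambda>m. sqrt (LINT x|lebesgue_on \<Omega>. (P m x)\<^sup>2) * sqrt (LINT x|lebesgue_on \<Omega>. (Q m x)\<^sup>2)) \<longlonglongrightarrow> sqrt 0 * sqrt q"
      by (intro tendsto_intros P Q)
    then have l: "(\<lambda>m. sqrt (LINT x|lebesgue_on \<Omega>. (P m x)\<^sup>2) * sqrt (LINT x|lebesgue_on \<Omega>. (Q m x)\<^sup>2)) \<longlonglongrightarrow> 0" by simp
    show ?thesis
      by (rule Lim_null_comparison[OF _ l]) (auto intro!: always_eventually L2_Cauchy_Schwarz P Q)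
  qed
  note f = tends_L2_D[OF F] and g = tends_L2_D[OF G]
  have df: "(\<lambda>x. F m x - f x) \<in> L2 \<Omega>" and dg: "(\<lambda>x. G m x - g x) \<in> L2 \<Omega>" for m
    by (intro L2_diff f g)+
  have "(\<lambda>m. (LINT x|lebesgue_on \<Omega>. (F m x - f x) * (G m x - g x)) + (LINT x|lebesgue_on \<Omega>. (F m x - f x) * g x)
      + (LINT x|lebesgue_on \<Omega>. (G m x - g x) * f x) + (LINT x|lebesgue_on \<Omega>. f x * g x))
    \<longlonglongrightarrow> 0 + 0 + 0 + (LINT x|lebesgue_on \<Omega>. f x * g x)"
    by (intro tendsto_add tendsto_const lim0) (rule df dg f g tendsto_const)+
  moreover have "(LINT x|lebesgue_on \<Omega>. (F m x - f x) * (G m x - g x)) + (LINT x|lebesgue_on \<Omega>. (F m x - f x) * g x)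
      + (LINT x|lebesgue_on \<Omega>. (G m x - g x) * f x) + (LINT x|lebesgue_on \<Omega>. f x * g x)
      = (LINT x|lebesgue_on \<Omega>. F m x * G m x)" for m
  proof -
    have "(LINT x|lebesgue_on \<Omega>. F m x * G m x) = (LINT x|lebesgue_on \<Omega>. (F m x - f x) * (G m x - g x)
       + (F m x - f x) * g x + (G m x - g x) * f x + f x * g x)"
      by (intro Bochner_Integration.integral_cong) (auto simp: algebra_simps)
    then show ?thesis by (simp add: L2_integrable_mult df dg f g)
  qed
  ultimately show ?thesis by simp
qed

lemma C1_closure_L2:
  assumes "C1 R f"
  shows "f \<in> L2 (cube R)" "partial i f \<in> L2 (cube R)"
proof -
  have one: "(\<lambda>x. 1) \<in> L2 (cube R)"
    using finite_measure.integrable_const[OF finite_measure_lebesgue_on_cube] by (simp add: L2_def)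
  obtain K where K: "\<And>x. x \<in> closure (cube R) \<Longrightarrow> \<bar>f x\<bar> \<le> K" "\<And>x i. x \<in> cube R \<Longrightarrow> \<bar>partial i f x\<bar> \<le> K"
    using C1_closure_cube_bounded[OF assms] by metis
  show "f \<in> L2 (cube R)"
    using L2_bounded_mult[OF one C1_closure_measurable(1)[OF assms], where K=K] K(1) closure_subset by auto
  show "partial i f \<in> L2 (cube R)"
    using L2_bounded_mult[OF one C1_closure_measurable(2)[OF assms], where K=K] K(2) by auto
qed

lemma C1_closure_mult_L2:
  assumes "C1 R c" "f \<in> L2 (cube R)"
  shows "(\<lambda>x. c x * f x) \<in> L2 (cube R)" "(\<lambda>x. partial i c x * f x) \<in> L2 (cube R)"
proof -
  obtain K where K: "\<And>x. x \<in> closure (cube R) \<Longrightarrow> \<bar>c x\<bar> \<le> K" "\<And>x i. x \<in> cube R \<Longrightarrow> \<bar>partial i c x\<bar> \<le> K"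
    using C1_closure_cube_bounded[OF assms(1)] by metis
  show "(\<lambda>x. c x * f x) \<in> L2 (cube R)"
    using L2_bounded_mult[OF assms(2) C1_closure_measurable(1)[OF assms(1)], where K=K] K(1) closure_subset by auto
  show "(\<lambda>x. partial i c x * f x) \<in> L2 (cube R)"
    using L2_bounded_mult[OF assms(2) C1_closure_measurable(2)[OF assms(1)], where K=K] K(2) by auto
qed

lemma C1_closure_mult_tends_L2:
  assumes "C1 R c" "tends_L2 (cube R) F f"
  shows "tends_L2 (cube R) (\<lambda>m x. c x * F m x) (\<lambda>x. c x * f x)"
    "tends_L2 (cube R) (\<lambda>m x. partial i c x * F m x) (\<lambda>x. partial i c x * f x)"
proof -
  obtain K where K: "\<And>x. x \<in> closure (cube R) \<Longrightarrow> \<bar>c x\<bar> \<le> K" "\<And>x i. x \<in> cube R \<Longrightarrow> \<bar>partial i c x\<bar> \<le> K"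
    using C1_closure_cube_bounded[OF assms(1)] by metis
  show "tends_L2 (cube R) (\<lambda>m x. c x * F m x) (\<lambda>x. c x * f x)"
    using tends_L2_bounded_mult[OF assms(2) C1_closure_measurable(1)[OF assms(1)], where K=K] K(1) closure_subset by blast
  show "tends_L2 (cube R) (\<lambda>m x. partial i c x * F m x) (\<lambda>x. partial i c x * f x)"
    using tends_L2_bounded_mult[OF assms(2) C1_closure_measurable(2)[OF assms(1)], where K=K] K(2) by blast
qed

section \<open>Weak boundary conditions\<close>

text \<open>The derivatives \<open>D\<close> are those that the approximating functions single out. As these functions are regular up to the
  boundary, the boundary values of \<open>v\<close> can be read off from them.\<close>

definition H1_approx ::
  "real \<Rightarrow> (nat \<Rightarrow> real ^ 'n::finite \<Rightarrow> real) \<Rightarrow> (real ^ 'n \<Rightarrow> real) \<Rightarrow> ('n \<Rightarrow> real ^ 'n \<Rightarrow> real) \<Rightarrow> bool" where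
  "H1_approx R V v D \<longleftrightarrow> (\<forall>m. C1 R (V m)) \<and> tends_L2 (cube R) V v \<and>
     (\<forall>i. tends_L2 (cube R) (\<lambda>m. partial i (V m)) (D i))"

lemma H1_approxD:
  assumes "H1_approx R V v D"
  shows "C1 R (V m)" "tends_L2 (cube R) V v" "tends_L2 (cube R) (\<lambda>m. partial i (V m)) (D i)"
    "v \<in> L2 (cube R)" "D i \<in> L2 (cube R)"
  using assms by (auto simp: H1_approx_def dest: tends_L2_D)

lemma H1_approx_const:
  "C1 R f \<Longrightarrow> H1_approx R (\<lambda>m. f) f (\<lambda>i. partial i f)"
  by (auto simp: H1_approx_def intro!: tends_L2_const C1_closure_L2)

lemma H1_approx_cong:
  assumes "H1_approx R V v D" "\<And>x. x \<in> cube R \<Longrightarrow> v x = w x" "\<And>x i. x \<in> cube R \<Longrightarrow> D i x = E i x"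
  shows "H1_approx R V w E"
proof -
  have "tends_L2 (cube R) V w \<longleftrightarrow> tends_L2 (cube R) V v" by (rule tends_L2_cong) (simp_all add: assms)
  moreover have "tends_L2 (cube R) (\<lambda>m. partial i (V m)) (E i) \<longleftrightarrow> tends_L2 (cube R) (\<lambda>m. partial i (V m)) (D i)" for i
    by (rule tends_L2_cong) (simp_all add: assms)
  ultimately show ?thesis using assms(1) by (simp add: H1_approx_def)
qed

lemma H1_approx_add:
  assumes F: "H1_approx R F f D" and G: "H1_approx R G g E"
  shows "H1_approx R (\<lambda>m x. F m x + G m x) (\<lambda>x. f x + g x) (\<lambda>i x. D i x + E i x)"
  unfolding H1_approx_def
proof (intro conjI allI)
  show "C1 R (\<lambda>x. F m x + G m x)" for m by (intro C1_closure_add H1_approxD[OF F] H1_approxD[OF G])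
  show "tends_L2 (cube R) (\<lambda>m x. F m x + G m x) (\<lambda>x. f x + g x)"
    by (intro tends_L2_add H1_approxD[OF F] H1_approxD[OF G])
  fix i
  have "tends_L2 (cube R) (\<lambda>m x. partial i (F m) x + partial i (G m) x) (\<lambda>x. D i x + E i x)"
    by (intro tends_L2_add H1_approxD[OF F] H1_approxD[OF G])
  then show "tends_L2 (cube R) (\<lambda>m. partial i (\<lambda>x. F m x + G m x)) (\<lambda>x. D i x + E i x)"
    by (rule tends_L2_cong[THEN iffD1, rotated -1])
       (simp_all add: partial_add C1_closureD(2)[OF H1_approxD(1)[OF F]] C1_closureD(2)[OF H1_approxD(1)[OF G]])
qed

lemma H1_approx_mult:
  assumes c: "C1 R c" and F: "H1_approx R F f D"
  shows "H1_approx R (\<lambda>m x. c x * F m x) (\<lambda>x. c x * f x) (\<lambda>i x. partial i c x * f x + c x * D i x)"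
  unfolding H1_approx_def
proof (intro conjI allI)
  show "C1 R (\<lambda>x. c x * F m x)" for m by (intro C1_closure_mult c H1_approxD[OF F])
  show "tends_L2 (cube R) (\<lambda>m x. c x * F m x) (\<lambda>x. c x * f x)"
    by (intro C1_closure_mult_tends_L2 c H1_approxD[OF F])
  fix i
  have "tends_L2 (cube R) (\<lambda>m x. partial i c x * F m x + c x * partial i (F m) x) (\<lambda>x. partial i c x * f x + c x * D i x)"
    by (intro tends_L2_add C1_closure_mult_tends_L2 c H1_approxD[OF F])
  then show "tends_L2 (cube R) (\<lambda>m. partial i (\<lambda>x. c x * F m x)) (\<lambda>x. partial i c x * f x + c x * D i x)"
    by (rule tends_L2_cong[THEN iffD1, rotated -1])
       (simp_all add: partial_mult C1_closureD(2)[OF H1_approxD(1)[OF F]] C1_closureD(2)[OF c])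
qed

text \<open>The boundary integral of a product, written as a volume integral, is continuous with respect to convergence in
  \<open>H\<^sup>1\<close>. Boundary terms for \<open>H\<^sup>1\<close> functions are therefore treated through approximations.\<close>

lemma H1_approx_flux:
  assumes F: "H1_approx R F f D" and G: "H1_approx R G g E"
  shows "(\<lambda>m. LINT x|leb R. partial j (\<lambda>x. F m x * G m x) x)
    \<longlonglongrightarrow> (LINT x|leb R. D j x * g x + f x * E j x)"
proof -
  have "(\<lambda>m. (LINT x|leb R. partial j (F m) x * G m x) + (LINT x|leb R. F m x * partial j (G m) x))
    \<longlonglongrightarrow> (LINT x|leb R. D j x * g x) + (LINT x|leb R. f x * E j x)"
    by (intro tendsto_add tends_L2_integral_mult H1_approxD[OF F] H1_approxD[OF G])
  moreover have "(LINT x|leb R. partial j (F m) x * G m x) + (LINT x|leb R. F m x * partial j (G m) x)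
    = (LINT x|leb R. partial j (\<lambda>x. F m x * G m x) x)" for m
  proof -
    have "(LINT x|leb R. partial j (\<lambda>x. F m x * G m x) x)
      = (LINT x|leb R. partial j (F m) x * G m x + F m x * partial j (G m) x)"
      by (intro Bochner_Integration.integral_cong)
         (auto simp: partial_mult C1_closureD(2)[OF H1_approxD(1)[OF F]] C1_closureD(2)[OF H1_approxD(1)[OF G]])
    then show ?thesis
      by (simp add: L2_integrable_mult C1_closure_L2 H1_approxD(1)[OF F] H1_approxD(1)[OF G])
  qed
  ultimately show ?thesis
    by (simp add: L2_integrable_mult H1_approxD[OF F] H1_approxD[OF G])
qed

text \<open>By the divergence theorem this is \<open>R + \<kappa>\<close> times the square of the \<open>L\<^sup>2\<close> norm on the face \<open>x\<^sub>j = R\<close> plus \<open>R - \<kappa>\<close>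
  times the one on the opposite face. Two values are of interest: \<open>\<kappa> = 0\<close> sees both faces, \<open>\<kappa> = R\<close> only the face
  \<open>x\<^sub>j = R\<close>.\<close>

definition face_energy :: "real \<Rightarrow> real \<Rightarrow> 'n::finite \<Rightarrow> (real ^ 'n \<Rightarrow> real) \<Rightarrow> real" where
  "face_energy R \<kappa> j f = (LINT x|leb R. partial j (\<lambda>x. (x $ j + \<kappa>) * (f x)\<^sup>2) x)"

lemma face_energy_C1:
  "C1 R f \<Longrightarrow> C1 R (\<lambda>x. (x $ j + \<kappa>) * (f x)\<^sup>2)"
  by (intro C1_closure_mult C1_closure_power C1_closure_add C1_closure_const C1_closure_coordinate)

lemma face_energy_nonneg:
  "C1 R f \<Longrightarrow> 0 < R \<Longrightarrow> 0 \<le> \<kappa> \<Longrightarrow> \<kappa> \<le> R \<Longrightarrow> 0 \<le> face_energy R \<kappa> j f"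
  unfolding face_energy_def
  by (intro integral_partial_cube_nonneg face_energy_C1) (auto simp: open_face_def mult_nonpos_nonneg)

lemma integral_partial_cmult:
  assumes "C1 R f"
  shows "(LINT x|leb R. partial j (\<lambda>x. c * f x) x) = c * (LINT x|leb R. partial j f x)"
proof -
  have "(LINT x|leb R. partial j (\<lambda>x. c * f x) x) = (LINT x|leb R. c * partial j f x)"
    by (intro Bochner_Integration.integral_cong) (auto simp: partial_mult C1_closureD(2)[OF assms])
  then show ?thesis by simp
qed

lemma integral_partial_add:
  assumes "C1 R f" "C1 R g"
  shows "(LINT x|leb R. partial j (\<lambda>x. f x + g x) x)
    = (LINT x|leb R. partial j f x) + (LINT x|leb R. partial j g x)"
proof -
  have "(LINT x|leb R. partial j (\<lambda>x. f x + g x) x) = (LINT x|leb R. partial j f x + partial j g x)"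
    by (intro Bochner_Integration.integral_cong) (auto simp: partial_add C1_closureD(2)[OF assms(1)] C1_closureD(2)[OF assms(2)])
  then show ?thesis using C1_closure_integrable(2)[OF assms(1)] C1_closure_integrable(2)[OF assms(2)] by simp
qed

text \<open>The Cauchy--Schwarz inequality on the two faces, in the form of the weighted arithmetic-geometric mean
  inequality, which can be read off pointwise on each face.\<close>

lemma flux_bound:
  assumes f: "C1 R f" and g: "C1 R g" and R: "0 < R" and e: "0 < e"
  shows "\<bar>LINT x|leb R. partial j (\<lambda>x. f x * g x) x\<bar> \<le> (face_energy R 0 j f / e + e * face_energy R 0 j g) / (2 * R)"
proof -
  have amgm: "s * (a * b) \<le> (a\<^sup>2 / e + e * b\<^sup>2) / 2" if "\<bar>s\<bar> = 1" for a b s :: real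
  proof -
    have "s\<^sup>2 = 1" using that by (simp add: abs_square_eq_1)
    have "0 \<le> (a - s * (e * b))\<^sup>2 / e" using e by simp
    also have "\<dots> = a\<^sup>2 / e + s\<^sup>2 * (e * b\<^sup>2) - 2 * (s * (a * b))"
      using e by (simp add: power2_eq_square field_simps)
    finally show ?thesis using \<open>s\<^sup>2 = 1\<close> by simp
  qed
  let ?h = "\<lambda>x. 1 / (2 * R * e) * (x $ j * (f x)\<^sup>2) + e / (2 * R) * (x $ j * (g x)\<^sup>2)"
  note hC = face_energy_C1[OF f, of j 0, simplified] face_energy_C1[OF g, of j 0, simplified]
  have h: "(LINT x|leb R. partial j ?h x) = (face_energy R 0 j f / e + e * face_energy R 0 j g) / (2 * R)"
    unfolding integral_partial_add[OF C1_closure_mult[OF C1_closure_const hC(1)] C1_closure_mult[OF C1_closure_const hC(2)]]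
      integral_partial_cmult[OF hC(1)] integral_partial_cmult[OF hC(2)] face_energy_def add_0_right
    using R e by (simp add: field_simps)
  have "s * (LINT x|leb R. partial j (\<lambda>x. f x * g x) x) \<le> (face_energy R 0 j f / e + e * face_energy R 0 j g) / (2 * R)"
    if s: "\<bar>s\<bar> = 1" for s :: real
  proof -
    have "s * (LINT x|leb R. partial j (\<lambda>x. f x * g x) x)
        = (LINT x|leb R. partial j (\<lambda>x. s * (f x * g x)) x)"
      by (rule integral_partial_cmult[symmetric]) (intro C1_closure_mult f g)
    also have "\<dots> \<le> (LINT x|leb R. partial j ?h x)"
    proof (rule integral_partial_cube_mono[OF _ _ R])
      show "C1 R (\<lambda>x. s * (f x * g x))" by (intro C1_closure_mult C1_closure_const f g)
      show "C1 R ?h" by (intro C1_closure_add C1_closure_mult[OF C1_closure_const] hC)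
      have eq: "1 / (2 * R * e) * (R * A) + e / (2 * R) * (R * B) = (A / e + e * B) / 2" for A B
        using R e by (simp add: field_simps)
      show "s * (f x * g x) \<le> ?h x" if "x \<in> open_face R j R" for x
        using that amgm[OF s, of "f x" "g x"] unfolding open_face_def by (simp only: mem_Collect_eq eq)
      show "?h x \<le> s * (f x * g x)" if "x \<in> open_face R j (- R)" for x
        using that amgm[of "- s" "f x" "g x"] s eq[of "(f x)\<^sup>2" "(g x)\<^sup>2"] unfolding open_face_def by simp
    qed
    finally show ?thesis unfolding h .
  qed
  from this[of 1] this[of "-1"] show ?thesis by linarith
qed

text \<open>In \<open>flux_bound\<close> the parameter is taken to be the square root of the first energy. The added null sequence keeps it
  positive when that energy vanishes.\<close>

lemma flux_tendsto_0:
  assumes F: "\<And>m. C1 R (F m)" and G: "\<And>m. C1 R (G m)" and R: "0 < R"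
    and lim: "(\<lambda>m. face_energy R 0 j (F m)) \<longlonglongrightarrow> 0" and bd: "(\<lambda>m. face_energy R 0 j (G m)) \<longlonglongrightarrow> K"
  shows "(\<lambda>m. LINT x|leb R. partial j (\<lambda>x. F m x * G m x) x) \<longlonglongrightarrow> 0"
proof -
  define e where "e m = sqrt (face_energy R 0 j (F m)) + inverse (real (Suc m))" for m
  have nn: "0 \<le> face_energy R 0 j (F m)" for m using R by (intro face_energy_nonneg F) auto
  have e0: "0 < e m" for m using nn by (simp add: e_def add_nonneg_pos)
  have e: "face_energy R 0 j (F m) / e m \<le> sqrt (face_energy R 0 j (F m))" for m
  proof -
    have "face_energy R 0 j (F m) = sqrt (face_energy R 0 j (F m)) * sqrt (face_energy R 0 j (F m))" using nn by simp
    also have "\<dots> \<le> sqrt (face_energy R 0 j (F m)) * e m" using nn by (intro mult_left_mono) (simp_all add: e_def)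
    finally show ?thesis using e0 by (simp add: pos_divide_le_eq)
  qed
  have "e \<longlonglongrightarrow> sqrt 0 + 0" unfolding e_def by (intro tendsto_intros lim LIMSEQ_inverse_real_of_nat)
  then have "(\<lambda>m. (sqrt (face_energy R 0 j (F m)) + e m * face_energy R 0 j (G m)) / (2 * R)) \<longlonglongrightarrow> (sqrt 0 + (sqrt 0 + 0) * K) / (2 * R)"
    by (intro tendsto_intros lim bd) (use R in auto)
  then have l: "(\<lambda>m. (sqrt (face_energy R 0 j (F m)) + e m * face_energy R 0 j (G m)) / (2 * R)) \<longlonglongrightarrow> 0" by simp
  have b: "norm (LINT x|leb R. partial j (\<lambda>x. F m x * G m x) x) \<le> (sqrt (face_energy R 0 j (F m)) + e m * face_energy R 0 j (G m)) / (2 * R)" for m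
  proof -
    have "norm (LINT x|leb R. partial j (\<lambda>x. F m x * G m x) x) \<le> (face_energy R 0 j (F m) / e m + e m * face_energy R 0 j (G m)) / (2 * R)"
      using flux_bound[OF F G R e0] by simp
    also have "\<dots> \<le> (sqrt (face_energy R 0 j (F m)) + e m * face_energy R 0 j (G m)) / (2 * R)"
      using e R by (intro divide_right_mono add_mono) auto
    finally show ?thesis .
  qed
  show ?thesis by (rule Lim_null_comparison[OF _ l]) (intro always_eventually allI b)
qed

lemma H1_approx_face_energy:
  assumes F: "H1_approx R F f D"
  shows "(\<lambda>m. face_energy R 0 j (F m)) \<longlonglongrightarrow> (LINT x|leb R. (f x + x $ j * D j x) * f x + (x $ j * f x) * D j x)"
proof -
  have "H1_approx R (\<lambda>m x. x $ j * F m x) (\<lambda>x. x $ j * f x) (\<lambda>i x. (if i = j then 1 else 0) * f x + x $ j * D i x)"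
    using H1_approx_mult[OF C1_closure_coordinate F] by simp
  from H1_approx_flux[OF this F, of j] show ?thesis
    by (simp add: face_energy_def power2_eq_square mult.assoc)
qed

text \<open>With \<open>\<kappa> = 0\<close>: \<open>v\<close> vanishes on both faces orthogonal to the direction \<open>j\<close>. With \<open>\<kappa> = R\<close>: on the face \<open>x\<^sub>j = R\<close>.\<close>

definition zero_trace :: "real \<Rightarrow> real \<Rightarrow> 'n::finite \<Rightarrow> (real ^ 'n \<Rightarrow> real) \<Rightarrow> ('n \<Rightarrow> real ^ 'n \<Rightarrow> real) \<Rightarrow> bool" where
  "zero_trace R \<kappa> j v D \<longleftrightarrow> (\<exists>V. H1_approx R V v D \<and> (\<lambda>m. face_energy R \<kappa> j (V m)) \<longlonglongrightarrow> 0)"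

definition in_H1 :: "real \<Rightarrow> (real ^ 'n::finite \<Rightarrow> real) \<Rightarrow> ('n \<Rightarrow> real ^ 'n \<Rightarrow> real) \<Rightarrow> bool" where
  "in_H1 R v D \<longleftrightarrow> (\<exists>V. H1_approx R V v D)"

lemma zero_trace_by_parts:
  assumes v: "zero_trace R 0 j v D" and w: "in_H1 R w E" and R: "0 < R"
  shows "(LINT x|leb R. D j x * w x + v x * E j x) = 0"
proof -
  obtain V W where V: "H1_approx R V v D" "(\<lambda>m. face_energy R 0 j (V m)) \<longlonglongrightarrow> 0" and W: "H1_approx R W w E"
    using v w by (auto simp: zero_trace_def in_H1_def)
  show ?thesis
    using LIMSEQ_unique[OF H1_approx_flux[OF V(1) W, of j]
      flux_tendsto_0[OF H1_approxD(1)[OF V(1)] H1_approxD(1)[OF W] R V(2) H1_approx_face_energy[OF W]]] .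
qed

lemma vanishing_coefficient_by_parts:
  assumes c: "C1 R c" and c0: "\<And>x s. s \<in> {R, - R} \<Longrightarrow> x \<in> open_face R j s \<Longrightarrow> c x = 0"
    and v: "in_H1 R v D" and w: "in_H1 R w E" and R: "0 < R"
  shows "(LINT x|leb R. (partial j c x * v x + c x * D j x) * w x + (c x * v x) * E j x) = 0"
proof -
  obtain V W where V: "H1_approx R V v D" and W: "H1_approx R W w E"
    using v w by (auto simp: in_H1_def)
  have C: "C1 R (\<lambda>x. c x * V m x * W m x)" for m
    by (intro C1_closure_mult c H1_approxD(1)[OF V] H1_approxD(1)[OF W])
  have zero: "(LINT x|leb R. partial j (\<lambda>x. c x * V m x * W m x) x) = 0" for m
  proof (rule antisym)
    have on_face: "c x * V m x * W m x = 0" if "x \<in> open_face R j s" "s \<in> {R, - R}" for x s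
      using c0[OF that(2,1)] by simp
    have "(LINT x|leb R. partial j (\<lambda>x. c x * V m x * W m x) x) \<le> (LINT x|leb R. partial j (\<lambda>x. 0) x)"
      by (rule integral_partial_cube_mono[OF C C1_closure_const R]) (simp_all only: on_face insert_iff simp_thms order_refl)
    then show "(LINT x|leb R. partial j (\<lambda>x. c x * V m x * W m x) x) \<le> 0" by simp
    have "(LINT x|leb R. partial j (\<lambda>x. 0) x) \<le> (LINT x|leb R. partial j (\<lambda>x. c x * V m x * W m x) x)"
      by (rule integral_partial_cube_mono[OF C1_closure_const C R]) (simp_all only: on_face insert_iff simp_thms order_refl)
    then show "0 \<le> (LINT x|leb R. partial j (\<lambda>x. c x * V m x * W m x) x)" by simp
  qed
  have "(\<lambda>m. LINT x|leb R. partial j (\<lambda>x. c x * V m x * W m x) x)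
    \<longlonglongrightarrow> (LINT x|leb R. (partial j c x * v x + c x * D j x) * w x + (c x * v x) * E j x)"
    by (rule H1_approx_flux[OF H1_approx_mult[OF c V] W])
  then show ?thesis unfolding zero LIMSEQ_const_iff by (rule sym)
qed

text \<open>The left-hand side is the boundary integral of \<open>c v\<^sup>2\<close> in direction \<open>n\<close>. The top face contributes nothing, and
  the bottom face, whose outward normal is negative, contributes with a favourable sign.\<close>

lemma one_face_by_parts:
  assumes v: "zero_trace R R n v D" and c: "C1 R c" "\<And>x. x \<in> closure (cube R) \<Longrightarrow> 0 \<le> c x" and R: "0 < R"
  shows "(LINT x|leb R. (partial n c x * v x + c x * D n x) * v x + (c x * v x) * D n x) \<le> 0"
proof -
  obtain V where V: "H1_approx R V v D" "(\<lambda>m. face_energy R R n (V m)) \<longlonglongrightarrow> 0"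
    using v by (auto simp: zero_trace_def)
  obtain K where K: "0 < K" "\<And>x. x \<in> closure (cube R) \<Longrightarrow> \<bar>c x\<bar> \<le> K"
    using C1_closure_cube_bounded[OF c(1)] by metis
  have le: "(LINT x|leb R. partial n (\<lambda>x. c x * V m x * V m x) x) \<le> K / (2 * R) * face_energy R R n (V m)" for m
  proof -
    note Vm = H1_approxD(1)[OF V(1), of m]
    note C = face_energy_C1[OF Vm, of n R]
    have "(LINT x|leb R. partial n (\<lambda>x. c x * V m x * V m x) x)
        \<le> (LINT x|leb R. partial n (\<lambda>x. K / (2 * R) * ((x $ n + R) * (V m x)\<^sup>2)) x)"
    proof (rule integral_partial_cube_mono[OF _ _ R])
      show "C1 R (\<lambda>x. c x * V m x * V m x)" by (intro C1_closure_mult c Vm)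
      show "C1 R (\<lambda>x. K / (2 * R) * ((x $ n + R) * (V m x)\<^sup>2))" by (rule C1_closure_mult[OF C1_closure_const C])
      show "c x * V m x * V m x \<le> K / (2 * R) * ((x $ n + R) * (V m x)\<^sup>2)" if x: "x \<in> open_face R n R" for x
      proof -
        have "x \<in> closure (cube R)" using x open_face_subset_closure[OF R, of R n] by auto
        then have "c x \<le> K" using K(2)[of x] by simp
        then have "c x * (V m x)\<^sup>2 \<le> K * (V m x)\<^sup>2" by (rule mult_right_mono) simp
        moreover have "x $ n = R" using x by (simp add: open_face_def)
        ultimately show ?thesis using R by (simp add: power2_eq_square field_simps)
      qed
      show "K / (2 * R) * ((x $ n + R) * (V m x)\<^sup>2) \<le> c x * V m x * V m x" if x: "x \<in> open_face R n (- R)" for x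
      proof -
        have "x \<in> closure (cube R)" using x open_face_subset_closure[OF R, of "- R" n] by auto
        then have "0 \<le> c x * (V m x * V m x)" using c(2) by simp
        moreover have "x $ n = - R" using x by (simp add: open_face_def)
        ultimately show ?thesis by (simp add: mult.assoc)
      qed
    qed
    also have "\<dots> = K / (2 * R) * face_energy R R n (V m)"
      unfolding face_energy_def by (rule integral_partial_cmult[OF C])
    finally show ?thesis .
  qed
  have "(\<lambda>m. K / (2 * R) * face_energy R R n (V m)) \<longlonglongrightarrow> K / (2 * R) * 0"
    by (intro tendsto_intros V)
  from LIMSEQ_le[OF H1_approx_flux[OF H1_approx_mult[OF c(1) V(1)] V(1), of n] this] le show ?thesis by auto
qed

subsection \<open>Closure properties\<close>

text \<open>The weight \<open>x\<^sub>j + \<kappa>\<close> is nonnegative on one face and nonpositive on the other one, so a pointwise bound for the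
  squares is passed on to the energies.\<close>

lemma face_energy_mono:
  assumes F: "C1 R F" and G: "C1 R G" and R: "0 < R" and k: "0 \<le> \<kappa>" "\<kappa> \<le> R" "0 \<le> K" "0 \<le> L"
    and le: "\<And>x. x \<in> closure (cube R) \<Longrightarrow> (f x)\<^sup>2 \<le> K * (F x)\<^sup>2 + L * (G x)\<^sup>2" and f: "C1 R f"
  shows "face_energy R \<kappa> j f \<le> K * face_energy R \<kappa> j F + L * face_energy R \<kappa> j G"
proof -
  note C = C1_closure_mult[OF C1_closure_const face_energy_C1[OF F, of j \<kappa>], of K]
    C1_closure_mult[OF C1_closure_const face_energy_C1[OF G, of j \<kappa>], of L]
  show ?thesis
    unfolding face_energy_def integral_partial_cmult[OF face_energy_C1[OF F], symmetric]
      integral_partial_cmult[OF face_energy_C1[OF G], symmetric] integral_partial_add[OF C, symmetric]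
  proof (rule integral_partial_cube_mono[OF face_energy_C1[OF f] C1_closure_add[OF C] R])
    have distrib: "K * (s * p) + L * (s * q) = s * (K * p + L * q)" for s p q :: real by (simp add: algebra_simps)
    show "(x $ j + \<kappa>) * (f x)\<^sup>2 \<le> K * ((x $ j + \<kappa>) * (F x)\<^sup>2) + L * ((x $ j + \<kappa>) * (G x)\<^sup>2)"
      if x: "x \<in> open_face R j R" for x
      using x le[of x] open_face_subset_closure[OF R, of R j] R k
      unfolding distrib by (intro mult_left_mono) (auto simp: open_face_def)
    show "K * ((x $ j + \<kappa>) * (F x)\<^sup>2) + L * ((x $ j + \<kappa>) * (G x)\<^sup>2) \<le> (x $ j + \<kappa>) * (f x)\<^sup>2"
      if x: "x \<in> open_face R j (- R)" for x
      using x le[of x] open_face_subset_closure[OF R, of "- R" j] R k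
      unfolding distrib by (intro mult_left_mono_neg) (auto simp: open_face_def)
  qed
qed

lemma tendsto_0_le:
  fixes f g :: "nat \<Rightarrow> real"
  assumes "g \<longlonglongrightarrow> 0" "\<And>m. 0 \<le> f m" "\<And>m. f m \<le> g m"
  shows "f \<longlonglongrightarrow> 0"
  by (rule tendsto_sandwich[OF _ _ tendsto_const assms(1)]) (auto intro!: always_eventually assms)

lemma in_H1_mult:
  "C1 R c \<Longrightarrow> in_H1 R v D \<Longrightarrow> in_H1 R (\<lambda>x. c x * v x) (\<lambda>i x. partial i c x * v x + c x * D i x)"
  unfolding in_H1_def using H1_approx_mult by blast

lemma in_H1_add:
  "in_H1 R v D \<Longrightarrow> in_H1 R w E \<Longrightarrow> in_H1 R (\<lambda>x. v x + w x) (\<lambda>i x. D i x + E i x)"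
  unfolding in_H1_def using H1_approx_add by blast

lemma in_H1_cong:
  assumes "in_H1 R v D" "\<And>x. x \<in> cube R \<Longrightarrow> v x = w x" "\<And>x i. x \<in> cube R \<Longrightarrow> D i x = E i x"
  shows "in_H1 R w E"
  using assms H1_approx_cong unfolding in_H1_def by metis

lemma in_H1_C1: "C1 R f \<Longrightarrow> in_H1 R f (\<lambda>i. partial i f)"
  unfolding in_H1_def using H1_approx_const by blast

lemma in_H1_L2: "in_H1 R v D \<Longrightarrow> v \<in> L2 (cube R)" "in_H1 R v D \<Longrightarrow> D i \<in> L2 (cube R)"
  unfolding in_H1_def using H1_approxD(4,5) by blast+

lemma zero_trace_mult:
  assumes c: "C1 R c" and v: "zero_trace R \<kappa> j v D" and R: "0 < R" and k: "0 \<le> \<kappa>" "\<kappa> \<le> R"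
  shows "zero_trace R \<kappa> j (\<lambda>x. c x * v x) (\<lambda>i x. partial i c x * v x + c x * D i x)"
proof -
  obtain V where V: "H1_approx R V v D" "(\<lambda>m. face_energy R \<kappa> j (V m)) \<longlonglongrightarrow> 0" using v by (auto simp: zero_trace_def)
  obtain K where K: "\<And>x. x \<in> closure (cube R) \<Longrightarrow> \<bar>c x\<bar> \<le> K" using C1_closure_cube_bounded[OF c] by metis
  have cV: "C1 R (\<lambda>x. c x * V m x)" for m by (intro C1_closure_mult c H1_approxD(1)[OF V(1)])
  have sq: "(c x * V m x)\<^sup>2 \<le> K\<^sup>2 * (V m x)\<^sup>2 + 0 * (V m x)\<^sup>2" if "x \<in> closure (cube R)" for x m
    using power_mono[OF K[OF that], of 2] by (simp add: power_mult_distrib mult_right_mono)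
  have l: "(\<lambda>m. K\<^sup>2 * face_energy R \<kappa> j (V m) + 0 * face_energy R \<kappa> j (V m)) \<longlonglongrightarrow> 0"
    using tendsto_mult_right_zero[OF V(2)] by simp
  have "(\<lambda>m. face_energy R \<kappa> j (\<lambda>x. c x * V m x)) \<longlonglongrightarrow> 0"
    by (rule tendsto_0_le[OF l face_energy_nonneg[OF cV R k] face_energy_mono[OF _ _ R k _ _ sq cV]]) (simp_all add: H1_approxD(1)[OF V(1)])
  then show ?thesis unfolding zero_trace_def using H1_approx_mult[OF c V(1)] by blast
qed

lemma zero_trace_add:
  assumes v: "zero_trace R \<kappa> j v D" and w: "zero_trace R \<kappa> j w E" and R: "0 < R" and k: "0 \<le> \<kappa>" "\<kappa> \<le> R"
  shows "zero_trace R \<kappa> j (\<lambda>x. v x + w x) (\<lambda>i x. D i x + E i x)"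
proof -
  obtain V where V: "H1_approx R V v D" "(\<lambda>m. face_energy R \<kappa> j (V m)) \<longlonglongrightarrow> 0" using v by (auto simp: zero_trace_def)
  obtain W where W: "H1_approx R W w E" "(\<lambda>m. face_energy R \<kappa> j (W m)) \<longlonglongrightarrow> 0" using w by (auto simp: zero_trace_def)
  note VW = H1_approxD(1)[OF V(1)] H1_approxD(1)[OF W(1)]
  have VWm: "C1 R (\<lambda>x. V m x + W m x)" for m by (intro C1_closure_add VW)
  have sq: "(V m x + W m x)\<^sup>2 \<le> 2 * (V m x)\<^sup>2 + 2 * (W m x)\<^sup>2" for m x by (rule square_sum_le)
  have l: "(\<lambda>m. 2 * face_energy R \<kappa> j (V m) + 2 * face_energy R \<kappa> j (W m)) \<longlonglongrightarrow> 0"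
    by (intro tendsto_add_zero tendsto_mult_right_zero V W)
  have "(\<lambda>m. face_energy R \<kappa> j (\<lambda>x. V m x + W m x)) \<longlonglongrightarrow> 0"
    by (rule tendsto_0_le[OF l face_energy_nonneg[OF VWm R k] face_energy_mono[OF VW R k _ _ sq VWm]]) simp_all
  then show ?thesis unfolding zero_trace_def using H1_approx_add[OF V(1) W(1)] by blast
qed

lemma zero_trace_cong:
  assumes "zero_trace R \<kappa> j v D" "\<And>x. x \<in> cube R \<Longrightarrow> v x = w x" "\<And>x i. x \<in> cube R \<Longrightarrow> D i x = E i x"
  shows "zero_trace R \<kappa> j w E"
  using assms H1_approx_cong unfolding zero_trace_def by metis

lemma zero_trace_one_face:
  assumes v: "zero_trace R 0 j v D" and R: "0 < R"
  shows "zero_trace R R j v D"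
proof -
  obtain V where V: "H1_approx R V v D" "(\<lambda>m. face_energy R 0 j (V m)) \<longlonglongrightarrow> 0" using v by (auto simp: zero_trace_def)
  note Vm = H1_approxD(1)[OF V(1)]
  have le: "face_energy R R j (V m) \<le> 2 * face_energy R 0 j (V m)" for m
    unfolding face_energy_def integral_partial_cmult[OF face_energy_C1[OF Vm], symmetric]
    by (rule integral_partial_cube_mono[OF face_energy_C1[OF Vm] C1_closure_mult[OF C1_closure_const face_energy_C1[OF Vm]] R])
       (auto simp: open_face_def R less_imp_le mult_nonneg_nonneg)
  have l: "(\<lambda>m. 2 * face_energy R 0 j (V m)) \<longlonglongrightarrow> 0" by (intro tendsto_mult_right_zero V)
  have "(\<lambda>m. face_energy R R j (V m)) \<longlonglongrightarrow> 0"
    using R by (intro tendsto_0_le[OF l] face_energy_nonneg le Vm) auto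
  then show ?thesis unfolding zero_trace_def using V(1) by blast
qed

lemma zero_trace_in_H1: "zero_trace R \<kappa> j v D \<Longrightarrow> in_H1 R v D"
  by (auto simp: zero_trace_def in_H1_def)

section \<open>Weak derivatives of functions in \<open>H\<^sup>2\<close> with zero boundary values\<close>

lemma test_function_partial:
  assumes "test_function \<Omega> \<phi>" shows "test_function \<Omega> (partial i \<phi>)"
proof -
  have smooth: "smooth \<phi>" and cpt: "compact (closure {x. \<phi> x \<noteq> 0})" and sub: "closure {x. \<phi> x \<noteq> 0} \<subseteq> \<Omega>"
    using assms by (auto simp: test_function_def)
  have "partial i \<phi> x = 0" if "x \<notin> closure {x. \<phi> x \<noteq> 0}" for x
  proof -
    have "partial i \<phi> x = partial i (\<lambda>x. 0) x"
    proof (rule partial_cong)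
      show "open (- closure {x. \<phi> x \<noteq> 0})" by (simp add: open_Compl)
      show "x \<in> - closure {x. \<phi> x \<noteq> 0}" using that by simp
      show "\<phi> y = 0" if "y \<in> - closure {x. \<phi> x \<noteq> 0}" for y
        using that closure_subset[of "{x. \<phi> x \<noteq> 0}"] by auto
    qed
    then show ?thesis by simp
  qed
  then have le: "closure {x. partial i \<phi> x \<noteq> 0} \<subseteq> closure {x. \<phi> x \<noteq> 0}"
    by (intro closure_minimal) auto
  then have "compact (closure {x. partial i \<phi> x \<noteq> 0})"
    using compact_Int_closed[OF cpt, of "closure {x. partial i \<phi> x \<noteq> 0}"] by (simp add: Int_absorb1)
  then show ?thesis using le sub smooth_partial[OF smooth] by (auto simp: test_function_def)
qed

lemma weak_partial_witness:
  assumes "g \<in> L2 \<Omega>" "is_weak_partial \<Omega> i u g"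
  shows "weak_partial \<Omega> i u \<in> L2 \<Omega>" "is_weak_partial \<Omega> i u (weak_partial \<Omega> i u)"
  using someI[of "\<lambda>g. g \<in> L2 \<Omega> \<and> is_weak_partial \<Omega> i u g" g] assms by (auto simp: weak_partial_def)

text \<open>The chosen representative of a first derivative need not be the function of which the definition of \<open>H\<^sup>2\<close>
  provides derivatives. The two have the same integrals against derivatives of test functions, since
  these are test functions again, and hence the same weak derivatives.\<close>

lemma H2_weak_partials_L2:
  assumes "u \<in> Hk \<Omega> 2"
  shows "u \<in> L2 \<Omega>" "weak_partial \<Omega> i u \<in> L2 \<Omega>" "weak_partial \<Omega> j (weak_partial \<Omega> i u) \<in> L2 \<Omega>"
proof -
  show "u \<in> L2 \<Omega>" using assms by (simp add: numeral_2_eq_2)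
  obtain h where h: "h \<in> Hk \<Omega> 1" "is_weak_partial \<Omega> i u h"
    using assms unfolding numeral_2_eq_2 Hk.simps(2)[of _ "Suc 0"] One_nat_def by blast
  have hL: "h \<in> L2 \<Omega>" using h(1) by simp
  note wp = weak_partial_witness[OF hL h(2)]
  show "weak_partial \<Omega> i u \<in> L2 \<Omega>" by (rule wp)
  obtain g where g: "g \<in> L2 \<Omega>" "is_weak_partial \<Omega> j h g" using h(1) by auto
  have "is_weak_partial \<Omega> j (weak_partial \<Omega> i u) g"
    unfolding is_weak_partial_def
  proof (intro allI impI)
    fix \<phi> assume \<phi>: "test_function \<Omega> \<phi>"
    note t = test_function_partial[OF \<phi>, of j]
    have "(LINT x|lebesgue_on \<Omega>. weak_partial \<Omega> i u x * partial j \<phi> x) = (LINT x|lebesgue_on \<Omega>. h x * partial j \<phi> x)"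
      using wp(2)[unfolded is_weak_partial_def, rule_format, OF t] h(2)[unfolded is_weak_partial_def, rule_format, OF t] by simp
    then show "(LINT x|lebesgue_on \<Omega>. weak_partial \<Omega> i u x * partial j \<phi> x) = - (LINT x|lebesgue_on \<Omega>. g x * \<phi> x)"
      using g(2)[unfolded is_weak_partial_def, rule_format, OF \<phi>] by simp
  qed
  then show "weak_partial \<Omega> j (weak_partial \<Omega> i u) \<in> L2 \<Omega>" by (rule weak_partial_witness(1)[OF g(1)])
qed

subsection \<open>The face energies are bounded by surface integrals\<close>

lemma ennreal_integral_le_nn_integral:
  fixes f :: "'a \<Rightarrow> real"
  assumes "\<And>x. 0 \<le> f x"
  shows "ennreal (LINT x|M. f x) \<le> (\<integral>\<^sup>+x. ennreal (f x) \<partial>M)"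
proof (cases "integrable M f")
  case True then show ?thesis using nn_integral_eq_integral[OF True] assms by simp
qed (simp add: not_integrable_integral_eq)

lemma smooth_borel_measurable: "smooth \<phi> \<Longrightarrow> \<phi> \<in> borel_measurable borel"
  by (intro borel_measurable_continuous_onI smooth_continuous)

text \<open>The divergence theorem turns the energy into integrals over two open faces, and these are dominated by the surface
  measure.\<close>

lemma face_energy_le_surface:
  fixes \<phi> :: "real ^ 'n::finite \<Rightarrow> real"
  assumes \<phi>: "smooth \<phi>" and R: "0 < R" and k: "0 \<le> \<kappa>" "\<kappa> \<le> R"
  shows "ennreal (face_energy R \<kappa> j \<phi>)
    \<le> ennreal (R + \<kappa>) * (\<integral>\<^sup>+x\<in>open_face R j R. ennreal ((\<phi> x)\<^sup>2) \<partial>surface_measure R)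
     + ennreal (R - \<kappa>) * (\<integral>\<^sup>+x\<in>open_face R j (- R). ennreal ((\<phi> x)\<^sup>2) \<partial>surface_measure R)"
proof -
  let ?F = "\<lambda>x. (x $ j + \<kappa>) * (\<phi> x)\<^sup>2" and ?e = "embed_hyperplane j"
  note F = face_energy_C1[OF smooth_imp_C1_closure[OF \<phi>], of R j \<kappa>]
  note [measurable] = smooth_borel_measurable[OF \<phi>]
  have m: "(\<lambda>x. ennreal ((\<phi> x)\<^sup>2)) \<in> borel_measurable borel" by measurable
  let ?g = "\<lambda>s y. ennreal ((\<phi> (?e s y))\<^sup>2) * indicator (open_face R j s) (?e s y)"
  have g: "?g s \<in> borel_measurable (face_measure j)" for s
    using measurable_compose[OF embed_hyperplane_measurable, of "\<lambda>x. ennreal ((\<phi> x)\<^sup>2) * indicator (open_face R j s) x" borel j s]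
    by measurable
  have cg: "(\<lambda>y. ennreal r * ?g s y) \<in> borel_measurable (face_measure j)" for r s
    by (intro borel_measurable_times_ennreal borel_measurable_const g)
  have "ennreal (face_energy R \<kappa> j \<phi>) = ennreal (LINT y|face_measure j. indicator (open_face R j R) (?e R y) * (?F (?e R y) - ?F (?e (- R) y)))"
    unfolding face_energy_def integral_partial_cube[OF F R] ..
  also have "\<dots> \<le> (\<integral>\<^sup>+y. ennreal (indicator (open_face R j R) (?e R y) * (?F (?e R y) - ?F (?e (- R) y))) \<partial>face_measure j)"
  proof (rule ennreal_integral_le_nn_integral)
    fix y
    have "(- R + \<kappa>) * (\<phi> (?e (- R) y))\<^sup>2 \<le> 0" "0 \<le> (R + \<kappa>) * (\<phi> (?e R y))\<^sup>2"
      using R k by (auto intro: mult_nonpos_nonneg)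
    then show "0 \<le> indicator (open_face R j R) (?e R y) * (?F (?e R y) - ?F (?e (- R) y))"
      by (simp add: embed_hyperplane_nth)
  qed
  also have "\<dots> = (\<integral>\<^sup>+y. ennreal (R + \<kappa>) * ?g R y + ennreal (R - \<kappa>) * ?g (- R) y \<partial>face_measure j)"
  proof (intro nn_integral_cong)
    fix y
    have split: "ennreal ((R + \<kappa>) * r\<^sup>2 - (\<kappa> - R) * q\<^sup>2) = ennreal (R + \<kappa>) * ennreal (r\<^sup>2) + ennreal (R - \<kappa>) * ennreal (q\<^sup>2)" for r q
    proof -
      have "(R + \<kappa>) * r\<^sup>2 - (\<kappa> - R) * q\<^sup>2 = (R + \<kappa>) * r\<^sup>2 + (R - \<kappa>) * q\<^sup>2" by (simp add: algebra_simps)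
      then show ?thesis using R k by (simp only: ennreal_plus ennreal_mult mult_nonneg_nonneg zero_le_power2 add_nonneg_nonneg diff_ge_0_iff_ge less_imp_le)
    qed
    have "embed_hyperplane j (- R) y \<in> open_face R j (- R) \<longleftrightarrow> embed_hyperplane j R y \<in> open_face R j R"
      by (simp add: embed_hyperplane_in_open_face)
    then show "ennreal (indicator (open_face R j R) (?e R y) * (?F (?e R y) - ?F (?e (- R) y)))
        = ennreal (R + \<kappa>) * ?g R y + ennreal (R - \<kappa>) * ?g (- R) y"
      by (simp add: embed_hyperplane_nth indicator_def split)
  qed
  also have "\<dots> = ennreal (R + \<kappa>) * (\<integral>\<^sup>+y. ?g R y \<partial>face_measure j) + ennreal (R - \<kappa>) * (\<integral>\<^sup>+y. ?g (- R) y \<partial>face_measure j)"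
    by (simp only: nn_integral_add[OF cg cg] nn_integral_cmult[OF g])
  also have "\<dots> \<le> ennreal (R + \<kappa>) * (\<integral>\<^sup>+x\<in>open_face R j R. ennreal ((\<phi> x)\<^sup>2) \<partial>surface_measure R)
     + ennreal (R - \<kappa>) * (\<integral>\<^sup>+x\<in>open_face R j (- R). ennreal ((\<phi> x)\<^sup>2) \<partial>surface_measure R)"
    by (intro add_mono mult_left_mono face_nn_integral_le[OF m R]) auto
  finally show ?thesis .
qed

lemma tendsto_0_ennreal_bound:
  fixes a :: "nat \<Rightarrow> real"
  assumes "\<And>k. 0 \<le> a k" "\<And>k. ennreal (a k) \<le> ennreal c * b k" "b \<longlonglongrightarrow> 0"
  shows "a \<longlonglongrightarrow> 0"
proof -
  have "(\<lambda>k. ennreal c * b k) \<longlonglongrightarrow> ennreal c * 0"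
    by (intro ennreal_tendsto_cmult assms) simp
  then have l: "(\<lambda>k. ennreal c * b k) \<longlonglongrightarrow> 0" by simp
  have "(\<lambda>k. ennreal (a k)) \<longlonglongrightarrow> ennreal 0"
    unfolding ennreal_0 by (rule tendsto_sandwich[OF _ _ tendsto_const l]) (auto intro!: always_eventually assms)
  then show ?thesis by (rule tendsto_ennrealD) (auto intro!: always_eventually assms)
qed

subsection \<open>Cutting off near a pair of faces\<close>

text \<open>A polynomial that vanishes on both faces \<open>x\<^sub>i = \<plusminus> R\<close> and increases to \<open>1\<close> in the interior as \<open>m\<close> grows. It does not
  depend on the other coordinates, so it may be used whenever no derivative in direction \<open>i\<close> falls on it.\<close>

definition cutoff :: "real \<Rightarrow> 'n::finite \<Rightarrow> nat \<Rightarrow> real ^ 'n \<Rightarrow> real" where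
  "cutoff R i m x = 1 - (1 / R * x $ i) ^ (2 * m)"

lemma smooth_cutoff: "smooth (cutoff R i m)"
proof -
  have "smooth (\<lambda>x :: real ^ 'a. 1 + (-1) * (1 / R * x $ i) ^ (2 * m))"
    by (intro smooth_add smooth_mult smooth_power smooth_const smooth_coordinate)
  then show ?thesis by (simp add: cutoff_def[abs_def])
qed

lemma cutoff_face:
  assumes "s \<in> {R, - R}" "0 < R" "x \<in> open_face R i s" shows "cutoff R i m x = 0"
proof -
  have "R \<noteq> 0" "x $ i = R \<or> x $ i = - R" using assms by (auto simp: open_face_def)
  then have "(1 / R * x $ i)\<^sup>2 = 1" by auto
  then show ?thesis by (simp add: cutoff_def power_mult)
qed

lemma partial_cutoff:
  fixes x :: "real ^ 'n::finite" assumes "j \<noteq> i" shows "partial j (cutoff R i m) x = 0"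
proof -
  have "((\<lambda>t. 1 - (c * t) ^ (2 * m)) has_real_derivative - (of_nat (2 * m) * (c * (x $ i)) ^ (2 * m - Suc 0) * c)) (at (x $ i))" for c
    by (auto intro!: derivative_eq_intros)
  from partial_comp_coordinate[where h="\<lambda>t. 1 - (1 / R * t) ^ (2 * m)", OF this, of j] assms
  show ?thesis by (simp add: cutoff_def[abs_def])
qed

lemma cutoff_limit:
  fixes f :: "real ^ 'n::finite \<Rightarrow> real"
  assumes f: "integrable (leb R) f" and R: "0 < R"
  shows "(\<lambda>m. LINT x|leb R. cutoff R i m x * f x) \<longlonglongrightarrow> (LINT x|leb R. f x)"
proof (rule integral_dominated_convergence[where w="\<lambda>x. \<bar>f x\<bar>"])
  have le: "\<bar>1 / R * x $ i\<bar> < 1" if "x \<in> cube R" for x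
    using that R by (auto simp: mem_cube abs_less_iff divide_less_eq minus_less_iff less_divide_eq)
  show "f \<in> borel_measurable (leb R)" using f by auto
  show "(\<lambda>x. cutoff R i m x * f x) \<in> borel_measurable (leb R)" for m
    using f C1_closure_measurable(1)[OF smooth_imp_C1_closure[OF smooth_cutoff]] by (intro borel_measurable_times) auto
  show "integrable (leb R) (\<lambda>x. \<bar>f x\<bar>)" using f by simp
  show "AE x in leb R. (\<lambda>m. cutoff R i m x * f x) \<longlonglongrightarrow> f x"
  proof (rule AE_I2)
    fix x :: "real ^ 'n" assume "x \<in> space (leb R)"
    then have x: "\<bar>1 / R * x $ i\<bar> < 1" using le by simp
    have "(1 / R * x $ i)\<^sup>2 < 1" using x by (simp only: abs_square_less_1)
    then have "norm ((1 / R * x $ i)\<^sup>2) < 1" by (simp only: real_norm_def abs_of_nonneg zero_le_power2)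
    then have "(\<lambda>m. ((1 / R * x $ i)\<^sup>2) ^ m) \<longlonglongrightarrow> 0" by (rule LIMSEQ_power_zero)
    then have "(\<lambda>m. (1 - ((1 / R * x $ i)\<^sup>2) ^ m) * f x) \<longlonglongrightarrow> (1 - 0) * f x"
      by (intro tendsto_mult tendsto_diff tendsto_const)
    then show "(\<lambda>m. cutoff R i m x * f x) \<longlonglongrightarrow> f x" by (simp add: cutoff_def power_mult)
  qed
  show "AE x in leb R. norm (cutoff R i m x * f x) \<le> \<bar>f x\<bar>" for m
  proof (rule AE_I2)
    fix x :: "real ^ 'n" assume "x \<in> space (leb R)"
    then have x: "\<bar>1 / R * x $ i\<bar> < 1" using le by simp
    have "(1 / R * x $ i)\<^sup>2 \<le> 1" using x by (simp add: abs_square_le_1)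
    then have "((1 / R * x $ i)\<^sup>2) ^ m \<le> 1" by (rule power_le_one[OF zero_le_power2])
    moreover have "0 \<le> ((1 / R * x $ i)\<^sup>2) ^ m" by simp
    ultimately have "\<bar>cutoff R i m x\<bar> \<le> 1" unfolding cutoff_def power_mult by (simp add: abs_le_iff)
    then show "norm (cutoff R i m x * f x) \<le> \<bar>f x\<bar>" by (simp add: abs_mult mult_left_le_one_le)
  qed
qed

lemma cutoff_integral_zero:
  assumes f: "integrable (leb R) f" and R: "0 < R"
    and "\<And>m. (LINT x|leb R. cutoff R i m x * f x) = 0"
  shows "(LINT x|leb R. f x) = 0"
  using cutoff_limit[OF f R, of i] unfolding assms(3) LIMSEQ_const_iff by simp

subsection \<open>Weak form of the boundary conditions\<close>

text \<open>Here \<open>DDv i j\<close> is the derivative of \<open>Dv i\<close> in direction \<open>j\<close>. Gradient and Hessian are parameters, rather than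
  chosen weak derivatives, because for a product with a weight they are given by the product rule. The
  third condition says that tangential derivatives vanish on every face, the fourth that the normal
  derivative vanishes on the top face. The Hessian is symmetric only in the sense of integrals, which
  suffices for integration by parts.\<close>

definition carleman_admissible ::
  "real \<Rightarrow> 'n::finite \<Rightarrow> (real ^ 'n \<Rightarrow> real) \<Rightarrow> ('n \<Rightarrow> real ^ 'n \<Rightarrow> real) \<Rightarrow> ('n \<Rightarrow> 'n \<Rightarrow> real ^ 'n \<Rightarrow> real) \<Rightarrow> bool" where
  "carleman_admissible R n v Dv DDv \<longleftrightarrow>
     (\<forall>j. zero_trace R 0 j v Dv) \<and>
     (\<forall>i. in_H1 R (Dv i) (DDv i)) \<and>
     (\<forall>i j. i \<noteq> j \<longrightarrow> zero_trace R 0 j (Dv i) (DDv i)) \<and>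
     zero_trace R R n (Dv n) (DDv n) \<and>
     (\<forall>i j \<psi>. C1 R \<psi> \<longrightarrow> (LINT x|leb R. \<psi> x * (DDv i j x - DDv j i x)) = 0)"

lemma has_trace_H1_approx:
  assumes w: "w \<in> L2 (cube R)" "\<And>i. weak_partial (cube R) i w \<in> L2 (cube R)"
    and "has_trace R \<Gamma> w g"
  obtains \<phi> where "\<And>k. smooth (\<phi> k)" "H1_approx R \<phi> w (\<lambda>i. weak_partial (cube R) i w)"
    "(\<lambda>k. \<integral>\<^sup>+x\<in>\<Gamma>. ennreal ((\<phi> k x - g x)\<^sup>2) \<partial>surface_measure R) \<longlonglongrightarrow> 0"
proof -
  obtain \<phi> where \<phi>: "\<forall>k. smooth (\<phi> k)" "(\<lambda>k. LINT x|leb R. (\<phi> k x - w x)\<^sup>2) \<longlonglongrightarrow> 0"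
      "\<forall>i. (\<lambda>k. LINT x|leb R. (partial i (\<phi> k) x - weak_partial (cube R) i w x)\<^sup>2) \<longlonglongrightarrow> 0"
      "(\<lambda>k. \<integral>\<^sup>+x\<in>\<Gamma>. ennreal ((\<phi> k x - g x)\<^sup>2) \<partial>surface_measure R) \<longlonglongrightarrow> 0"
    using assms(3) unfolding has_trace_def by blast
  have C: "C1 R (\<phi> k)" for k using \<phi>(1) smooth_imp_C1_closure by blast
  have "H1_approx R \<phi> w (\<lambda>i. weak_partial (cube R) i w)"
    unfolding H1_approx_def tends_L2_def using C1_closure_L2[OF C] C w \<phi> by simp
  then show ?thesis using that \<phi>(1,4) by blast
qed

lemma zero_trace_of_has_trace:
  assumes w: "w \<in> L2 (cube R)" "\<And>i. weak_partial (cube R) i w \<in> L2 (cube R)" and R: "0 < R"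
    and "has_trace R (frontier (cube R)) w (\<lambda>x. 0)"
  shows "zero_trace R 0 j w (\<lambda>i. weak_partial (cube R) i w)"
proof -
  obtain \<phi> where \<phi>: "\<And>k. smooth (\<phi> k)" "H1_approx R \<phi> w (\<lambda>i. weak_partial (cube R) i w)"
    "(\<lambda>k. \<integral>\<^sup>+x\<in>frontier (cube R). ennreal ((\<phi> k x - 0)\<^sup>2) \<partial>surface_measure R) \<longlonglongrightarrow> 0"
    using has_trace_H1_approx[OF w assms(4)] by blast
  have "ennreal (face_energy R 0 j (\<phi> k)) \<le> ennreal (2 * R) * (\<integral>\<^sup>+x\<in>frontier (cube R). ennreal ((\<phi> k x)\<^sup>2) \<partial>surface_measure R)" for k
  proof -
    let ?I = "\<integral>\<^sup>+x\<in>frontier (cube R). ennreal ((\<phi> k x)\<^sup>2) \<partial>surface_measure R"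
    have "(\<integral>\<^sup>+x\<in>open_face R j s. ennreal ((\<phi> k x)\<^sup>2) \<partial>surface_measure R) \<le> ?I" if "s \<in> {R, - R}" for s
      using open_face_subset_frontier[OF R that, of j] by (intro nn_integral_mono) (auto simp: indicator_def)
    note face_le = this[of R, OF insertI1] this[of "- R", OF insertI2[OF singletonI]]
    have "ennreal (face_energy R 0 j (\<phi> k)) \<le> ennreal (R + 0) * ?I + ennreal (R - 0) * ?I"
      by (rule order_trans[OF face_energy_le_surface[OF \<phi>(1) R order_refl less_imp_le[OF R]]])
         (intro add_mono mult_left_mono face_le zero_le)
    moreover have "ennreal (2 * R) = ennreal (R + 0) + ennreal (R - 0)"
      using R by (simp add: ennreal_plus[symmetric] del: ennreal_plus)
    ultimately show ?thesis by (simp only: distrib_right)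
  qed
  then have "(\<lambda>k. face_energy R 0 j (\<phi> k)) \<longlonglongrightarrow> 0"
    by (rule tendsto_0_ennreal_bound[OF face_energy_nonneg[OF smooth_imp_C1_closure[OF \<phi>(1)] R order_refl less_imp_le[OF R]]
          _ \<phi>(3)[simplified]])
  then show ?thesis using \<phi>(2) by (auto simp: zero_trace_def)
qed

lemma outward_normal_open_face:
  assumes "x \<in> open_face R n R" "0 < R" shows "outward_normal R x = axis n 1"
proof -
  have "(\<chi> i. if x $ i = R then 1 else if x $ i = - R then - 1 else 0) = (axis n 1 :: real ^ 'a)"
    using assms by (auto simp: open_face_def axis_def vec_eq_iff)
  then show ?thesis by (simp add: outward_normal_def sgn_div_norm)
qed

lemma zero_top_of_has_normal_trace:
  assumes R: "0 < R" and w: "w \<in> Hk (cube R) 2"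
    and tr: "has_normal_trace R (Gamma_plus R n) w (\<lambda>x. 0)"
  shows "zero_trace R R n (weak_partial (cube R) n w) (\<lambda>j. weak_partial (cube R) j (weak_partial (cube R) n w))"
proof -
  note L = H2_weak_partials_L2[OF w]
  obtain g where g: "\<And>i. has_trace R (Gamma_plus R n) (weak_partial (cube R) i w) (g i)"
    and AE: "AE x in surface_measure R. x \<in> Gamma_plus R n \<longrightarrow> 0 = (\<Sum>i\<in>UNIV. outward_normal R x $ i * g i x)"
    using tr unfolding has_normal_trace_def by blast
  obtain \<phi> where \<phi>: "\<And>k. smooth (\<phi> k)"
    "H1_approx R \<phi> (weak_partial (cube R) n w) (\<lambda>j. weak_partial (cube R) j (weak_partial (cube R) n w))"
    "(\<lambda>k. \<integral>\<^sup>+x\<in>Gamma_plus R n. ennreal ((\<phi> k x - g n x)\<^sup>2) \<partial>surface_measure R) \<longlonglongrightarrow> 0"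
    using has_trace_H1_approx[OF L(2) L(3) g] by blast
  have sub: "open_face R n R \<subseteq> Gamma_plus R n"
    using open_face_subset_frontier[OF R, of R n] by (auto simp: Gamma_plus_def open_face_def)
  have "ennreal (face_energy R R n (\<phi> k)) \<le> ennreal (R + R) * (\<integral>\<^sup>+x\<in>open_face R n R. ennreal ((\<phi> k x)\<^sup>2) \<partial>surface_measure R)" for k
    using face_energy_le_surface[OF \<phi>(1) R, of R n k] R by simp
  moreover have "ennreal (R + R) * (\<integral>\<^sup>+x\<in>open_face R n R. ennreal ((\<phi> k x)\<^sup>2) \<partial>surface_measure R)
      \<le> ennreal (R + R) * (\<integral>\<^sup>+x\<in>Gamma_plus R n. ennreal ((\<phi> k x - g n x)\<^sup>2) \<partial>surface_measure R)" for k
  proof (intro mult_left_mono nn_integral_mono_AE)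
    show "AE x in surface_measure R. ennreal ((\<phi> k x)\<^sup>2) * indicator (open_face R n R) x
        \<le> ennreal ((\<phi> k x - g n x)\<^sup>2) * indicator (Gamma_plus R n) x"
      using AE
    proof eventually_elim
      case (elim x)
      show ?case
      proof (cases "x \<in> open_face R n R")
        case True
        have "outward_normal R x $ i * g i x = (if i = n then g n x else 0)" for i
          unfolding outward_normal_open_face[OF True R] by (simp add: axis_def)
        then have "g n x = 0" using elim True sub by auto
        then show ?thesis using True sub by (auto simp: indicator_def)
      qed simp
    qed
  qed simp
  ultimately have "ennreal (face_energy R R n (\<phi> k))
      \<le> ennreal (R + R) * (\<integral>\<^sup>+x\<in>Gamma_plus R n. ennreal ((\<phi> k x - g n x)\<^sup>2) \<partial>surface_measure R)" for k
    by (rule order_trans)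
  then have "(\<lambda>k. face_energy R R n (\<phi> k)) \<longlonglongrightarrow> 0"
    by (rule tendsto_0_ennreal_bound[OF face_energy_nonneg[OF smooth_imp_C1_closure[OF \<phi>(1)] R less_imp_le[OF R] order_refl]
          _ \<phi>(3)])
  then show ?thesis using \<phi>(2) by (auto simp: zero_trace_def)
qed

text \<open>For \<open>\<psi>\<close> vanishing on the faces in the directions \<open>i\<close> and \<open>j\<close>, both integrals \<open>\<integral> \<psi> u\<^sub>i\<^sub>j\<close> and \<open>\<integral> \<psi> u\<^sub>j\<^sub>i\<close> reduce to first
  derivatives of \<open>u\<close>, which are limits of those of the smooth functions \<open>\<phi>\<^sub>k\<close>, for which the claim is the symmetry of
  second derivatives. Cutting off in both directions reaches all \<open>\<psi>\<close>.\<close>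

lemma weak_hessian_symmetric:
  assumes \<phi>: "\<And>k. smooth (\<phi> k)" "H1_approx R \<phi> u Du"
    and H1: "\<And>i. in_H1 R (Du i) (DDu i)" and R: "0 < R" and \<psi>: "C1 R \<psi>"
  shows "(LINT x|leb R. \<psi> x * (DDu i j x - DDu j i x)) = 0"
proof -
  have *: "(LINT x|leb R. \<psi> x * (DDu i j x - DDu j i x)) = 0"
    if \<psi>: "C1 R \<psi>" and z: "\<And>x s l. s \<in> {R, - R} \<Longrightarrow> l \<in> {i, j} \<Longrightarrow> x \<in> open_face R l s \<Longrightarrow> \<psi> x = 0" for \<psi>
  proof -
    have parts: "(LINT x|leb R. partial l \<psi> x * w x) = - (LINT x|leb R. \<psi> x * Dw l x)"
      if w: "in_H1 R w Dw" and l: "l \<in> {i, j}" for w Dw l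
    proof -
      have "(LINT x|leb R. partial l \<psi> x * w x + \<psi> x * Dw l x) = 0"
        using vanishing_coefficient_by_parts[OF \<psi> z[OF _ l] w in_H1_C1[OF C1_closure_const[of _ 1]] R] by simp
      then show ?thesis
        by (simp add: L2_integrable_mult C1_closure_L2 \<psi> in_H1_L2[OF w])
    qed
    have smooth_case: "(LINT x|leb R. partial j \<psi> x * partial i (\<phi> k) x)
        = (LINT x|leb R. partial i \<psi> x * partial j (\<phi> k) x)" for k
      using parts[OF in_H1_C1[OF smooth_imp_C1_closure[OF smooth_partial[OF \<phi>(1)]]], of j i k]
        parts[OF in_H1_C1[OF smooth_imp_C1_closure[OF smooth_partial[OF \<phi>(1)]]], of i j k]
        partial_commute[OF \<phi>(1), of i j] by simp
    have lim: "(\<lambda>k. LINT x|leb R. partial l \<psi> x * partial l' (\<phi> k) x) \<longlonglongrightarrow> (LINT x|leb R. partial l \<psi> x * Du l' x)" for l l'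
      by (rule tends_L2_integral_mult[OF tends_L2_const[OF C1_closure_L2(2)[OF \<psi>]] H1_approxD(3)[OF \<phi>(2)]])
    have "(LINT x|leb R. partial j \<psi> x * Du i x) = (LINT x|leb R. partial i \<psi> x * Du j x)"
      using LIMSEQ_unique[OF lim[of j i] lim[of i j, folded smooth_case]] .
    then have "(LINT x|leb R. \<psi> x * DDu i j x) = (LINT x|leb R. \<psi> x * DDu j i x)"
      using parts[OF H1, of j i] parts[OF H1, of i j] by simp
    then show ?thesis
      by (simp add: right_diff_distrib L2_integrable_mult C1_closure_L2 \<psi> in_H1_L2[OF H1])
  qed
  have int: "integrable (leb R) (\<lambda>x. \<eta> x * (DDu i j x - DDu j i x))" if "C1 R \<eta>" for \<eta>
    by (intro L2_integrable_mult L2_diff C1_closure_L2 that in_H1_L2[OF H1])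
  note cut = smooth_imp_C1_closure[OF smooth_cutoff, of "cube R" R]
  show ?thesis
  proof (rule cutoff_integral_zero[OF int[OF \<psi>] R, of i])
    fix m
    have "(LINT x|leb R. (cutoff R i m x * \<psi> x) * (DDu i j x - DDu j i x)) = 0"
    proof (rule cutoff_integral_zero[OF int[OF C1_closure_mult[OF cut \<psi>]] R, of j])
      fix m'
      have "(LINT x|leb R. (cutoff R j m' x * (cutoff R i m x * \<psi> x)) * (DDu i j x - DDu j i x)) = 0"
        by (rule *) (auto intro!: C1_closure_mult cut \<psi> simp: cutoff_face[of R R, OF _ R] cutoff_face[of "- R" R, OF _ R])
      then show "(LINT x|leb R. cutoff R j m' x * (cutoff R i m x * \<psi> x * (DDu i j x - DDu j i x))) = 0"
        by (simp add: mult.assoc)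
    qed
    then show "(LINT x|leb R. cutoff R i m x * (\<psi> x * (DDu i j x - DDu j i x))) = 0"
      by (simp add: mult.assoc)
  qed
qed

text \<open>For smooth \<open>\<psi>\<close> the zero boundary values of \<open>u\<close> give \<open>\<integral> u\<^sub>i \<psi>\<^sub>j = - \<integral> u \<psi>\<^sub>i\<^sub>j = \<integral> u\<^sub>j \<psi>\<^sub>i\<close>. If moreover \<open>\<psi>\<close> vanishes on the
  faces in direction \<open>i\<close>, this equals \<open>- \<integral> u\<^sub>j\<^sub>i \<psi> = - \<integral> u\<^sub>i\<^sub>j \<psi>\<close>, which is the integration by parts in direction \<open>j\<close> without
  boundary term. As \<open>j \<noteq> i\<close>, a cutoff in direction \<open>i\<close> extends this to all smooth functions. Applied
  to \<open>x\<^sub>j V\<^sub>k\<close> it shows, in the limit, that the face energy of \<open>u\<^sub>i\<close> is zero.\<close>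

lemma tangential_zero_trace:
  assumes u: "\<And>j. zero_trace R 0 j u Du" and ij: "i \<noteq> j"
    and V: "\<And>k. smooth (V k)" "H1_approx R V (Du i) (DDu i)"
    and H1: "\<And>i. in_H1 R (Du i) (DDu i)" and R: "0 < R"
    and sym: "\<And>\<psi>. C1 R \<psi> \<Longrightarrow> (LINT x|leb R. \<psi> x * (DDu i j x - DDu j i x)) = 0"
  shows "zero_trace R 0 j (Du i) (DDu i)"
proof -
  have parts: "(LINT x|leb R. Du l x * \<psi> x) = - (LINT x|leb R. u x * partial l \<psi> x)"
    if "C1 R \<psi>" for \<psi> l
    using zero_trace_by_parts[OF u[of l] in_H1_C1[OF that] R]
    by (simp add: L2_integrable_mult C1_closure_L2 that in_H1_L2[OF H1] in_H1_L2(1)[OF zero_trace_in_H1[OF u]])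
  have swap: "(LINT x|leb R. Du i x * partial j \<psi> x) = (LINT x|leb R. Du j x * partial i \<psi> x)"
    if s: "smooth \<psi>" for \<psi>
    using parts[OF smooth_imp_C1_closure[OF smooth_partial[OF s]]] partial_commute[OF s, of i j] by simp
  have smooth_case: "(LINT x|leb R. DDu i j x * \<eta> x + Du i x * partial j \<eta> x) = 0"
    if s: "smooth \<eta>" for \<eta>
  proof (rule cutoff_integral_zero[OF _ R, of _ i])
    note \<eta> = smooth_imp_C1_closure[OF s, of "cube R"]
    show "integrable (leb R) (\<lambda>x. DDu i j x * \<eta> x + Du i x * partial j \<eta> x)"
      by (intro Bochner_Integration.integrable_add L2_integrable_mult C1_closure_L2 \<eta> in_H1_L2[OF H1])
    fix m
    let ?\<psi> = "\<lambda>x. cutoff R i m x * \<eta> x"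
    have \<psi>s: "smooth ?\<psi>" by (intro smooth_mult smooth_cutoff s)
    note \<psi> = smooth_imp_C1_closure[OF \<psi>s, of "cube R"]
    have z: "?\<psi> x = 0" if "s \<in> {R, - R}" "x \<in> open_face R i s" for x s
      using cutoff_face[OF that(1) R that(2)] by simp
    have "(LINT x|leb R. partial i ?\<psi> x * Du j x + ?\<psi> x * DDu j i x) = 0"
      using vanishing_coefficient_by_parts[OF \<psi> z H1 in_H1_C1[OF C1_closure_const[of _ 1]] R] by simp
    moreover have "(LINT x|leb R. partial i ?\<psi> x * Du j x + ?\<psi> x * DDu j i x)
        = (LINT x|leb R. partial i ?\<psi> x * Du j x) + (LINT x|leb R. ?\<psi> x * DDu j i x)"
      by (rule Bochner_Integration.integral_add) (intro L2_integrable_mult C1_closure_L2 \<psi> in_H1_L2[OF H1])+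
    moreover have "(LINT x|leb R. ?\<psi> x * (DDu i j x - DDu j i x))
        = (LINT x|leb R. ?\<psi> x * DDu i j x) - (LINT x|leb R. ?\<psi> x * DDu j i x)"
      unfolding right_diff_distrib
      by (rule Bochner_Integration.integral_diff) (intro L2_integrable_mult C1_closure_L2 \<psi> in_H1_L2[OF H1])+
    moreover note sym[OF \<psi>] swap[OF \<psi>s]
    moreover have "(LINT x|leb R. partial i ?\<psi> x * Du j x) = (LINT x|leb R. Du j x * partial i ?\<psi> x)"
      by (simp add: mult.commute)
    ultimately have sum0: "(LINT x|leb R. Du i x * partial j ?\<psi> x) + (LINT x|leb R. ?\<psi> x * DDu i j x) = 0"
      by linarith
    have "partial j ?\<psi> x = cutoff R i m x * partial j \<eta> x" for x
      using ij by (simp add: partial_mult smooth_differentiable s smooth_cutoff partial_cutoff)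
    then have "(LINT x|leb R. cutoff R i m x * (DDu i j x * \<eta> x + Du i x * partial j \<eta> x))
      = (LINT x|leb R. Du i x * partial j ?\<psi> x + ?\<psi> x * DDu i j x)"
      by (simp add: algebra_simps)
    also have "\<dots> = (LINT x|leb R. Du i x * partial j ?\<psi> x) + (LINT x|leb R. ?\<psi> x * DDu i j x)"
      by (rule Bochner_Integration.integral_add) (intro L2_integrable_mult C1_closure_L2 \<psi> in_H1_L2[OF H1])+
    finally show "(LINT x|leb R. cutoff R i m x * (DDu i j x * \<eta> x + Du i x * partial j \<eta> x)) = 0"
      using sum0 by simp
  qed
  let ?W = "\<lambda>k x. x $ j * V k x"
  have W: "H1_approx R ?W (\<lambda>x. x $ j * Du i x) (\<lambda>l x. (if l = j then 1 else 0) * Du i x + x $ j * DDu i l x)"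
    using H1_approx_mult[OF C1_closure_coordinate V(2)] by simp
  have WC: "C1 R (?W k)" for k by (rule H1_approxD(1)[OF W])
  note L = in_H1_L2[OF H1]
  have "(\<lambda>k. (LINT x|leb R. DDu i j x * ?W k x) + (LINT x|leb R. Du i x * partial j (?W k) x))
    \<longlonglongrightarrow> (LINT x|leb R. DDu i j x * (x $ j * Du i x)) + (LINT x|leb R. Du i x * ((if j = j then 1 else 0) * Du i x + x $ j * DDu i j x))"
    by (intro tendsto_add tends_L2_integral_mult tends_L2_const L H1_approxD(2)[OF W] H1_approxD(3)[OF W])
  moreover have "(LINT x|leb R. DDu i j x * ?W k x) + (LINT x|leb R. Du i x * partial j (?W k) x) = 0" for k
  proof -
    have "smooth (?W k)" by (intro smooth_mult smooth_coordinate V(1))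
    from smooth_case[OF this] show ?thesis
      by (subst Bochner_Integration.integral_add[symmetric]) (auto intro!: L2_integrable_mult L C1_closure_L2 WC)
  qed
  ultimately have z: "(LINT x|leb R. DDu i j x * (x $ j * Du i x)) + (LINT x|leb R. Du i x * ((if j = j then 1 else 0) * Du i x + x $ j * DDu i j x)) = 0"
    by (simp only: LIMSEQ_const_iff)
  have "(LINT x|leb R. (Du i x + x $ j * DDu i j x) * Du i x + (x $ j * Du i x) * DDu i j x)
      = (LINT x|leb R. DDu i j x * (x $ j * Du i x) + Du i x * (Du i x + x $ j * DDu i j x))"
    by (simp add: algebra_simps)
  also have "\<dots> = (LINT x|leb R. DDu i j x * (x $ j * Du i x)) + (LINT x|leb R. Du i x * (Du i x + x $ j * DDu i j x))"
    by (intro Bochner_Integration.integral_add L2_integrable_mult L2_add C1_closure_mult_L2 C1_closure_coordinate L)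
  also have "\<dots> = 0" using z by simp
  finally have "(\<lambda>k. face_energy R 0 j (V k)) \<longlonglongrightarrow> 0" using H1_approx_face_energy[OF V(2), of j] by simp
  then show ?thesis using V(2) by (auto simp: zero_trace_def)
qed

text \<open>Every first derivative has a trace on the top face and hence, by the meaning of traces, smooth approximations on the
  whole cube. These approximations carry the proof for the directions other than \<open>n\<close> as well.\<close>

lemma H2_0_sharp_admissible:
  assumes u: "u \<in> H2_0_sharp R n" and R: "0 < R"
  shows "carleman_admissible R n u (\<lambda>i. weak_partial (cube R) i u)
    (\<lambda>i j. weak_partial (cube R) j (weak_partial (cube R) i u))"
proof -
  have Hk: "u \<in> Hk (cube R) 2" and tr: "has_trace R (frontier (cube R)) u (\<lambda>x. 0)"
    and ntr: "has_normal_trace R (Gamma_plus R n) u (\<lambda>x. 0)"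
    using u by (auto simp: H2_0_sharp_def)
  note L = H2_weak_partials_L2[OF Hk]
  let ?D = "\<lambda>i. weak_partial (cube R) i u" and ?DD = "\<lambda>i j. weak_partial (cube R) j (weak_partial (cube R) i u)"
  obtain \<phi> where \<phi>: "\<And>k. smooth (\<phi> k)" "H1_approx R \<phi> u ?D"
    using has_trace_H1_approx[OF L(1) L(2) tr] by blast
  obtain g where g: "\<And>i. has_trace R (Gamma_plus R n) (?D i) (g i)"
    using ntr unfolding has_normal_trace_def by blast
  have ex: "\<exists>V. (\<forall>k. smooth (V k)) \<and> H1_approx R V (?D i) (?DD i)" for i
    using has_trace_H1_approx[OF L(2) L(3) g] by blast
  then have H1: "in_H1 R (?D i) (?DD i)" for i by (auto simp: in_H1_def)
  have zt: "zero_trace R 0 j u ?D" for j by (rule zero_trace_of_has_trace[OF L(1,2) R tr])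
  have sym: "(LINT x|leb R. \<psi> x * (?DD i j x - ?DD j i x)) = 0" if "C1 R \<psi>" for i j \<psi>
    by (rule weak_hessian_symmetric[OF \<phi> H1 R that])
  have tang: "zero_trace R 0 j (?D i) (?DD i)" if ij: "i \<noteq> j" for i j
  proof -
    obtain V where V: "\<And>k. smooth (V k)" "H1_approx R V (?D i) (?DD i)" using ex by blast
    show ?thesis by (rule tangential_zero_trace[OF zt ij V H1 R sym])
  qed
  show ?thesis
    unfolding carleman_admissible_def
    using zt H1 tang sym zero_top_of_has_normal_trace[OF R Hk ntr] by blast
qed

section \<open>Multiplication by the Carleman weight\<close>

lemma carleman_admissibleD:
  assumes "carleman_admissible R n v Dv DDv"
  shows "zero_trace R 0 j v Dv" "in_H1 R (Dv i) (DDv i)" "i \<noteq> j \<Longrightarrow> zero_trace R 0 j (Dv i) (DDv i)"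
    "zero_trace R R n (Dv n) (DDv n)"
    "C1 R \<psi> \<Longrightarrow> (LINT x|leb R. \<psi> x * (DDv i j x - DDv j i x)) = 0"
  using assms unfolding carleman_admissible_def by blast+

lemma carleman_admissible_mult:
  assumes v: "carleman_admissible R n v Dv DDv" and R: "0 < R"
    and E: "C1 R E" and e: "\<And>i. C1 R (e i)"
    and Ee: "\<And>i x. x \<in> cube R \<Longrightarrow> partial i E x = e i x"
    and ee: "\<And>i j x. x \<in> cube R \<Longrightarrow> partial j (e i) x = partial i (e j) x"
  shows "carleman_admissible R n (\<lambda>x. E x * v x) (\<lambda>i x. e i x * v x + E x * Dv i x)
    (\<lambda>i j x. (partial j (e i) x * v x + e i x * Dv j x) + (e j x * Dv i x + E x * DDv i j x))"
    (is "carleman_admissible R n ?v ?D ?DD")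
proof -
  note V = carleman_admissibleD[OF v]
  have zt: "zero_trace R 0 j ?v ?D" for j
    by (rule zero_trace_cong[OF zero_trace_mult[OF E V(1) R]]) (use R in \<open>simp_all add: Ee\<close>)
  have ev: "zero_trace R 0 j (\<lambda>x. e i x * v x) (\<lambda>j x. partial j (e i) x * v x + e i x * Dv j x)" for i j
    using R by (intro zero_trace_mult e V(1)) auto
  have H1: "in_H1 R (?D i) (?DD i)" for i
    by (rule in_H1_cong[OF in_H1_add[OF zero_trace_in_H1[OF ev[of _ i]] in_H1_mult[OF E V(2)[of i]]]]) (simp_all add: Ee)
  have tang: "zero_trace R 0 j (?D i) (?DD i)" if "i \<noteq> j" for i j
    by (rule zero_trace_cong[OF zero_trace_add[OF ev[of j i] zero_trace_mult[OF E V(3)[OF that] R] R]])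
       (use R in \<open>simp_all add: Ee\<close>)
  have top: "zero_trace R R n (?D n) (?DD n)"
    by (rule zero_trace_cong[OF zero_trace_add[OF zero_trace_one_face[OF ev[of n n] R] zero_trace_mult[OF E V(4) R] R]])
       (use R in \<open>simp_all add: Ee\<close>)
  have sym: "(LINT x|leb R. \<psi> x * (?DD i j x - ?DD j i x)) = 0" if "C1 R \<psi>" for i j \<psi>
  proof -
    have "(LINT x|leb R. \<psi> x * (?DD i j x - ?DD j i x))
      = (LINT x|leb R. (\<psi> x * E x) * (DDv i j x - DDv j i x))"
      by (intro Bochner_Integration.integral_cong) (auto simp: ee[of _ j i] algebra_simps)
    also have "\<dots> = 0" by (rule V(5)[OF C1_closure_mult[OF that E]])
    finally show ?thesis .
  qed
  show ?thesis unfolding carleman_admissible_def using zt H1 tang top sym by blast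
qed

section \<open>Integral identities\<close>

text \<open>The boundary integral of \<open>c f g\<close> in direction \<open>j\<close>, expanded by the product rule.\<close>

definition weak_flux where
  "weak_flux R j c f Df g Dg = (LINT x|leb R. partial j c x * (f x * g x))
    + (LINT x|leb R. c x * (Df j x * g x)) + (LINT x|leb R. c x * (f x * Dg j x))"

lemma C1_closure_mult_integrable:
  assumes "C1 R c" "f \<in> L2 (cube R)" "g \<in> L2 (cube R)"
  shows "integrable (leb R) (\<lambda>x. c x * (f x * g x))"
    "integrable (leb R) (\<lambda>x. partial i c x * (f x * g x))"
  using L2_integrable_mult[OF C1_closure_mult_L2(1)[OF assms(1,2)] assms(3)]
    L2_integrable_mult[OF C1_closure_mult_L2(2)[OF assms(1,2)] assms(3)] by (simp_all add: mult.assoc)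

lemma weak_flux_eq:
  assumes c: "C1 R c" and f: "in_H1 R f Df" and g: "in_H1 R g Dg"
  shows "weak_flux R j c f Df g Dg
    = (LINT x|leb R. (partial j c x * f x + c x * Df j x) * g x + (c x * f x) * Dg j x)"
proof -
  note L = in_H1_L2[OF f] in_H1_L2[OF g]
  have "(LINT x|leb R. (partial j c x * f x + c x * Df j x) * g x + (c x * f x) * Dg j x)
    = (LINT x|leb R. partial j c x * (f x * g x) + c x * (Df j x * g x) + c x * (f x * Dg j x))"
    by (simp add: algebra_simps)
  also have "\<dots> = weak_flux R j c f Df g Dg"
    unfolding weak_flux_def
    by (simp add: C1_closure_mult_integrable c L)
  finally show ?thesis by simp
qed

lemma weak_flux_commute: "weak_flux R j c f Df g Dg = weak_flux R j c g Dg f Df"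
  unfolding weak_flux_def by (simp add: mult.commute)

lemma weak_flux_zero_trace:
  assumes c: "C1 R c" and f: "in_H1 R f Df" and g: "zero_trace R 0 j g Dg" and R: "0 < R"
  shows "weak_flux R j c f Df g Dg = 0"
  unfolding weak_flux_eq[OF c f zero_trace_in_H1[OF g]]
  using zero_trace_by_parts[OF g in_H1_mult[OF c f] R] by (simp add: algebra_simps)

lemma weak_flux_vanishing:
  assumes c: "C1 R c" and f: "in_H1 R f Df" and g: "in_H1 R g Dg" and R: "0 < R"
    and z: "\<And>x s. s \<in> {R, - R} \<Longrightarrow> x \<in> open_face R j s \<Longrightarrow> c x = 0"
  shows "weak_flux R j c f Df g Dg = 0"
  unfolding weak_flux_eq[OF c f g] by (rule vanishing_coefficient_by_parts[OF c z f g R])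

lemma weak_flux_top:
  assumes c: "C1 R c" "\<And>x. x \<in> closure (cube R) \<Longrightarrow> 0 \<le> c x"
    and f: "zero_trace R R n f Df" and R: "0 < R"
  shows "weak_flux R n c f Df f Df \<le> 0"
  unfolding weak_flux_eq[OF c(1) zero_trace_in_H1[OF f] zero_trace_in_H1[OF f]]
  by (rule one_face_by_parts[OF f c R])

text \<open>The symmetry of the Hessian extends from functions regular up to the boundary to their limits in \<open>H\<^sup>1\<close>.\<close>

lemma hessian_symmetric_H1:
  assumes v: "carleman_admissible R n v Dv DDv" and c: "C1 R c" and w: "in_H1 R w Dw"
  shows "(LINT x|leb R. c x * (w x * DDv i j x)) = (LINT x|leb R. c x * (w x * DDv j i x))"
proof -
  obtain W where W: "H1_approx R W w Dw" using w by (auto simp: in_H1_def)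
  note L = in_H1_L2(2)[OF carleman_admissibleD(2)[OF v]]
  note cW = H1_approx_mult[OF c W]
  have "(\<lambda>m. LINT x|leb R. (c x * W m x) * (DDv i j x - DDv j i x))
    \<longlonglongrightarrow> (LINT x|leb R. (c x * w x) * (DDv i j x - DDv j i x))"
    by (intro tends_L2_integral_mult H1_approxD(2)[OF cW] tends_L2_const L2_diff L)
  moreover have "(LINT x|leb R. (c x * W m x) * (DDv i j x - DDv j i x)) = 0" for m
    by (rule carleman_admissibleD(5)[OF v H1_approxD(1)[OF cW]])
  ultimately have "(LINT x|leb R. (c x * w x) * (DDv i j x - DDv j i x)) = 0"
    by (simp only: LIMSEQ_const_iff)
  moreover have "(LINT x|leb R. (c x * w x) * (DDv i j x - DDv j i x))
    = (LINT x|leb R. c x * (w x * DDv i j x)) - (LINT x|leb R. c x * (w x * DDv j i x))"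
    using Bochner_Integration.integral_diff[OF C1_closure_mult_integrable(1)[OF c in_H1_L2(1)[OF w] L[of i j]]
        C1_closure_mult_integrable(1)[OF c in_H1_L2(1)[OF w] L[of j i]]]
    by (simp add: algebra_simps)
  ultimately show ?thesis by simp
qed

lemma sum_UNIV_single:
  fixes f :: "'n::finite \<Rightarrow> 'a::comm_monoid_add"
  assumes "\<And>i. i \<noteq> n \<Longrightarrow> f i = 0" shows "(\<Sum>i\<in>UNIV. f i) = f n"
proof -
  have "f i = (if i = n then f n else 0)" for i using assms by auto
  then have "(\<Sum>i\<in>UNIV. f i) = (\<Sum>i\<in>UNIV. if i = n then f n else 0)" by (intro sum.cong) auto
  then show ?thesis by simp
qed

locale carleman_coefficients =
  fixes R :: real and n :: "'n::finite" and a :: "'n \<Rightarrow> 'n \<Rightarrow> real ^ 'n \<Rightarrow> real"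
  assumes R: "0 < R"
    and a_C1: "\<And>i j. C1 R (a i j)"
    and a_sym: "\<And>i j x. a i j x = a j i x"
    and a_lateral: "\<And>j s x. j \<noteq> n \<Longrightarrow> s \<in> {R, - R} \<Longrightarrow> x \<in> open_face R j s \<Longrightarrow> a j n x = 0"
begin

text \<open>With \<open>c = w a\<^sub>k\<^sub>l a\<^sub>i\<^sub>n\<close>, the derivative in direction \<open>l\<close> is moved off \<open>v\<^sub>k\<close>, which produces \<open>\<integral> c v\<^sub>k v\<^sub>i\<^sub>l\<close>. By symmetry of the
  Hessian and of \<open>a\<close>, the sum of these is half the sum of \<open>\<integral> c (v\<^sub>k v\<^sub>l)\<^sub>i\<close>, and a second integration by parts leaves only
  first derivatives of \<open>v\<close>. All boundary terms vanish except the one with \<open>k = l = i = n\<close>, which occurs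
  once and minus one half times and is not positive.\<close>

lemma rellich_inequality:
  assumes v: "carleman_admissible R n v Dv DDv" and w: "C1 R w" "\<And>x. x \<in> closure (cube R) \<Longrightarrow> 0 \<le> w x"
  shows "(\<Sum>k\<in>UNIV. \<Sum>l\<in>UNIV. \<Sum>i\<in>UNIV. LINT x|leb R. (w x * (a k l x * a i n x)) * (DDv k l x * Dv i x))
    \<le> - (\<Sum>k\<in>UNIV. \<Sum>l\<in>UNIV. \<Sum>i\<in>UNIV. LINT x|leb R. partial l (\<lambda>x. w x * (a k l x * a i n x)) x * (Dv k x * Dv i x))
      + (\<Sum>k\<in>UNIV. \<Sum>l\<in>UNIV. \<Sum>i\<in>UNIV. LINT x|leb R. partial i (\<lambda>x. w x * (a k l x * a i n x)) x * (Dv k x * Dv l x)) / 2"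
proof -
  note V = carleman_admissibleD[OF v]
  define c where "c k l i x = w x * (a k l x * a i n x)" for k l i x
  have c: "C1 R (c k l i)" for k l i
    unfolding c_def by (intro C1_closure_mult w a_C1)
  define T1 where "T1 k l i = (LINT x|leb R. c k l i x * (DDv k l x * Dv i x))" for k l i
  define T2 where "T2 k l i = (LINT x|leb R. c k l i x * (Dv k x * DDv i l x))" for k l i
  define T3 where "T3 k l i = (LINT x|leb R. c k l i x * (Dv k x * DDv l i x))" for k l i
  define T4 where "T4 k l i = (LINT x|leb R. c k l i x * (DDv k i x * Dv l x))" for k l i
  define P1 where "P1 k l i = (LINT x|leb R. partial l (c k l i) x * (Dv k x * Dv i x))" for k l i
  define P2 where "P2 k l i = (LINT x|leb R. partial i (c k l i) x * (Dv k x * Dv l x))" for k l i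
  define B1 where "B1 k l i = weak_flux R l (c k l i) (Dv k) (DDv k) (Dv i) (DDv i)" for k l i
  define B2 where "B2 k l i = weak_flux R i (c k l i) (Dv k) (DDv k) (Dv l) (DDv l)" for k l i
  have vanish: "weak_flux R j (c k l i) (Dv k') (DDv k') (Dv l') (DDv l') = 0" if "j \<noteq> n" "i = j" for j k l i k' l'
    by (rule weak_flux_vanishing[OF c V(2) V(2) R]) (simp add: c_def a_lateral[OF that(1)] that(2))
  have B1_0: "B1 k l i = 0" if "k \<noteq> n \<or> l \<noteq> n \<or> i \<noteq> n" for k l i
  proof (cases "i = l")
    case False
    then show ?thesis unfolding B1_def by (rule weak_flux_zero_trace[OF c V(2) V(3) R])
  next
    case il: True
    show ?thesis
    proof (cases "l = n")
      case True
      then have "k \<noteq> l" using il that by auto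
      then show ?thesis unfolding B1_def
        by (subst weak_flux_commute) (rule weak_flux_zero_trace[OF c V(2) V(3) R])
    next
      case False then show ?thesis unfolding B1_def using il by (intro vanish)
    qed
  qed
  have B2_0: "B2 k l i = 0" if "k \<noteq> n \<or> l \<noteq> n \<or> i \<noteq> n" for k l i
  proof (cases "i = n")
    case False then show ?thesis unfolding B2_def by (intro vanish refl)
  next
    case i: True
    show ?thesis
    proof (cases "l = n")
      case False
      then show ?thesis unfolding B2_def using i by (intro weak_flux_zero_trace[OF c V(2) V(3) R]) simp
    next
      case True
      then have "k \<noteq> i" using i that by auto
      then show ?thesis unfolding B2_def
        by (subst weak_flux_commute) (rule weak_flux_zero_trace[OF c V(2) V(3) R])
    qed
  qed
  have sB1: "(\<Sum>k\<in>UNIV. \<Sum>l\<in>UNIV. \<Sum>i\<in>UNIV. B1 k l i) = B1 n n n"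
    by (subst sum_UNIV_single[of n]; (simp add: B1_0)?)+
  have sB2: "(\<Sum>k\<in>UNIV. \<Sum>l\<in>UNIV. \<Sum>i\<in>UNIV. B2 k l i) = B2 n n n"
    by (subst sum_UNIV_single[of n]; (simp add: B2_0)?)+
  have nnn: "B1 n n n = B2 n n n" by (simp add: B1_def B2_def)
  have B_le: "B2 n n n \<le> 0"
    unfolding B2_def by (rule weak_flux_top[OF c _ V(4) R]) (simp add: c_def w)
  have B1: "T1 k l i = B1 k l i - P1 k l i - T2 k l i" for k l i
    by (simp add: B1_def weak_flux_def T1_def T2_def P1_def)
  have B2: "T3 k l i + T4 k l i = B2 k l i - P2 k l i" for k l i
    by (simp add: B2_def weak_flux_def T3_def T4_def P2_def)
  have T23: "T2 k l i = T3 k l i" for k l i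
    unfolding T2_def T3_def by (rule hessian_symmetric_H1[OF v c V(2)])
  have T43: "T4 k l i = T3 l k i" for k l i
  proof -
    have "c k l i x = c l k i x" for x by (simp add: c_def a_sym[of k l])
    then show ?thesis unfolding T4_def T3_def by (simp add: mult.commute)
  qed
  have sT4: "(\<Sum>k\<in>UNIV. \<Sum>l\<in>UNIV. \<Sum>i\<in>UNIV. T4 k l i) = (\<Sum>k\<in>UNIV. \<Sum>l\<in>UNIV. \<Sum>i\<in>UNIV. T3 k l i)"
    unfolding T43 by (rule sum.swap)
  have "(\<Sum>k\<in>UNIV. \<Sum>l\<in>UNIV. \<Sum>i\<in>UNIV. T1 k l i)
    = B1 n n n - (\<Sum>k\<in>UNIV. \<Sum>l\<in>UNIV. \<Sum>i\<in>UNIV. P1 k l i) - (\<Sum>k\<in>UNIV. \<Sum>l\<in>UNIV. \<Sum>i\<in>UNIV. T3 k l i)"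
    unfolding B1 T23 sum_subtractf sB1 ..
  moreover have "(\<Sum>k\<in>UNIV. \<Sum>l\<in>UNIV. \<Sum>i\<in>UNIV. T3 k l i + T4 k l i) = B2 n n n - (\<Sum>k\<in>UNIV. \<Sum>l\<in>UNIV. \<Sum>i\<in>UNIV. P2 k l i)"
    unfolding B2 sum_subtractf sB2 ..
  then have "2 * (\<Sum>k\<in>UNIV. \<Sum>l\<in>UNIV. \<Sum>i\<in>UNIV. T3 k l i) = B2 n n n - (\<Sum>k\<in>UNIV. \<Sum>l\<in>UNIV. \<Sum>i\<in>UNIV. P2 k l i)"
    by (simp add: sum.distrib sT4)
  ultimately have "(\<Sum>k\<in>UNIV. \<Sum>l\<in>UNIV. \<Sum>i\<in>UNIV. T1 k l i)
    \<le> - (\<Sum>k\<in>UNIV. \<Sum>l\<in>UNIV. \<Sum>i\<in>UNIV. P1 k l i) + (\<Sum>k\<in>UNIV. \<Sum>l\<in>UNIV. \<Sum>i\<in>UNIV. P2 k l i) / 2"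
    using nnn B_le by linarith
  then show ?thesis by (simp add: T1_def P1_def P2_def c_def[abs_def])
qed

lemma hessian_by_parts:
  assumes v: "carleman_admissible R n v Dv DDv" and c: "C1 R c"
  shows "(LINT x|leb R. c x * (DDv k l x * v x))
    = - (LINT x|leb R. partial l c x * (Dv k x * v x)) - (LINT x|leb R. c x * (Dv k x * Dv l x))"
  using weak_flux_zero_trace[OF c carleman_admissibleD(2)[OF v, of k] carleman_admissibleD(1)[OF v, of l] R]
  by (simp add: weak_flux_def)

lemma gradient_by_parts:
  assumes v: "carleman_admissible R n v Dv DDv" and c: "C1 R c"
  shows "(LINT x|leb R. c x * (Dv i x * v x)) = - (LINT x|leb R. partial i c x * (v x)\<^sup>2) / 2"
  using weak_flux_zero_trace[OF c zero_trace_in_H1[OF carleman_admissibleD(1)[OF v]] carleman_admissibleD(1)[OF v, of i] R]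
  by (simp add: weak_flux_def power2_eq_square mult.commute)

end

section \<open>Estimates of the integrals\<close>

lemma abs_mult_le_half_squares: "\<bar>x * y\<bar> \<le> (x\<^sup>2 + y\<^sup>2) / (2::real)"
proof -
  have "0 \<le> (\<bar>x\<bar> - \<bar>y\<bar>)\<^sup>2" by simp
  then show ?thesis by (simp add: power2_diff abs_mult)
qed

lemma C1_mult_integrable:
  assumes c: "C1 R c" and f: "integrable (leb R) f"
  shows "integrable (leb R) (\<lambda>x. c x * f x)"
proof -
  obtain K where K: "\<And>x. x \<in> closure (cube R) \<Longrightarrow> \<bar>c x\<bar> \<le> K" using C1_closure_cube_bounded[OF c] by metis
  show ?thesis
  proof (rule Bochner_Integration.integrable_bound)
    show "integrable (leb R) (\<lambda>x. K * f x)" using f by simp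
    show "(\<lambda>x. c x * f x) \<in> borel_measurable (leb R)"
      using f C1_closure_measurable(1)[OF c] by auto
    have "\<bar>c x\<bar> \<le> \<bar>K\<bar>" if "x \<in> cube R" for x using K[of x] that closure_subset by fastforce
    then show "AE x in leb R. norm (c x * f x) \<le> norm (K * f x)"
      by (intro AE_I2) (simp add: abs_mult mult_right_mono)
  qed
qed

lemma triple_sum_bound:
  fixes D :: "'n::finite \<Rightarrow> 'n \<Rightarrow> 'n \<Rightarrow> real" and y :: "'n \<Rightarrow> real"
  assumes B: "\<And>k l i. \<bar>D k l i\<bar> \<le> B"
  shows "\<bar>\<Sum>k\<in>UNIV. \<Sum>l\<in>UNIV. \<Sum>i\<in>UNIV. D k l i * (y k * y i)\<bar> \<le> B * (real CARD('n))\<^sup>2 * (\<Sum>i\<in>UNIV. (y i)\<^sup>2)"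
proof -
  have B0: "0 \<le> B" using B[of undefined undefined undefined] by linarith
  have t: "\<bar>D k l i * (y r * y s)\<bar> \<le> B * (((y r)\<^sup>2 + (y s)\<^sup>2) / 2)" for k l i r s
    unfolding abs_mult[of "D k l i"]
    by (rule mult_mono[OF B abs_mult_le_half_squares B0]) simp
  have s: "\<bar>\<Sum>k\<in>UNIV. \<Sum>l\<in>UNIV. \<Sum>i\<in>UNIV. f k l i\<bar> \<le> (\<Sum>k\<in>UNIV. \<Sum>l\<in>UNIV. \<Sum>i\<in>UNIV. \<bar>f k l i\<bar>)"
    for f :: "'n \<Rightarrow> 'n \<Rightarrow> 'n \<Rightarrow> real"
    by (intro order_trans[OF sum_abs] sum_mono order_refl)
  have "\<bar>\<Sum>k\<in>UNIV. \<Sum>l\<in>UNIV. \<Sum>i\<in>UNIV. D k l i * (y k * y i)\<bar> \<le> (\<Sum>k\<in>UNIV. \<Sum>l\<in>(UNIV::'n set). \<Sum>i\<in>UNIV. B * (((y k)\<^sup>2 + (y i)\<^sup>2) / 2))"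
    by (rule order_trans[OF s]) (intro sum_mono t)
  also have "\<dots> = B * (real CARD('n))\<^sup>2 * (\<Sum>i\<in>UNIV. (y i)\<^sup>2)"
    by (simp add: sum.distrib sum_distrib_left[symmetric] sum_divide_distrib[symmetric] power2_eq_square)
  finally show "\<bar>\<Sum>k\<in>UNIV. \<Sum>l\<in>UNIV. \<Sum>i\<in>UNIV. D k l i * (y k * y i)\<bar> \<le> B * (real CARD('n))\<^sup>2 * (\<Sum>i\<in>UNIV. (y i)\<^sup>2)" .
qed

lemma triple_sum_bound':
  fixes D :: "'n::finite \<Rightarrow> 'n \<Rightarrow> 'n \<Rightarrow> real" and y :: "'n \<Rightarrow> real"
  assumes B: "\<And>k l i. \<bar>D k l i\<bar> \<le> B"
  shows "\<bar>\<Sum>k\<in>UNIV. \<Sum>l\<in>UNIV. \<Sum>i\<in>UNIV. D k l i * (y k * y l)\<bar> \<le> B * (real CARD('n))\<^sup>2 * (\<Sum>i\<in>UNIV. (y i)\<^sup>2)"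
proof -
  have "(\<Sum>k\<in>UNIV. \<Sum>l\<in>UNIV. \<Sum>i\<in>UNIV. D k l i * (y k * y l)) = (\<Sum>k\<in>UNIV. \<Sum>i\<in>UNIV. \<Sum>l\<in>UNIV. D k l i * (y k * y l))"
    by (intro sum.cong refl sum.swap)
  then show ?thesis using triple_sum_bound[of "\<lambda>k l i. D k i l" B y, OF B] by simp
qed

text \<open>The parameter \<open>e\<close> allows the gradient part to be made small at the expense of the part with \<open>z\<close>.\<close>

lemma double_sum_bound:
  fixes D :: "'n::finite \<Rightarrow> 'n \<Rightarrow> real" and y :: "'n \<Rightarrow> real"
  assumes B: "\<And>k l. \<bar>D k l\<bar> \<le> B" and e: "0 < e"
  shows "\<bar>\<Sum>k\<in>UNIV. \<Sum>l\<in>UNIV. D k l * (y k * z)\<bar> \<le> (e * (\<Sum>i\<in>UNIV. (y i)\<^sup>2) + (real CARD('n))^3 * B\<^sup>2 / e * z\<^sup>2) / 2"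
proof -
  let ?N = "real CARD('n)"
  have B0: "0 \<le> B" using B[of undefined undefined] by linarith
  have t: "?N * (B * \<bar>y k * z\<bar>) \<le> (e * (y k)\<^sup>2 + ?N\<^sup>2 * B\<^sup>2 / e * z\<^sup>2) / 2" for k
  proof -
    have "0 \<le> (e * \<bar>y k\<bar> - ?N * B * \<bar>z\<bar>)\<^sup>2 / e" using e by simp
    also have "\<dots> = e * (y k)\<^sup>2 + ?N\<^sup>2 * B\<^sup>2 / e * z\<^sup>2 - 2 * (?N * (B * \<bar>y k * z\<bar>))"
      using e by (simp add: power2_diff power_mult_distrib abs_mult power2_eq_square field_simps)
    finally show ?thesis by simp
  qed
  have "\<bar>\<Sum>k\<in>UNIV. \<Sum>l\<in>UNIV. D k l * (y k * z)\<bar> \<le> (\<Sum>k\<in>UNIV. \<Sum>l\<in>(UNIV::'n set). B * \<bar>y k * z\<bar>)"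
    by (intro order_trans[OF sum_abs] sum_mono order_trans[OF sum_abs]) (auto simp: abs_mult[of "D _ _"] intro!: mult_right_mono B)
  also have "\<dots> = (\<Sum>k\<in>UNIV. ?N * (B * \<bar>y k * z\<bar>))" by simp
  also have "\<dots> \<le> (\<Sum>k\<in>UNIV. (e * (y k)\<^sup>2 + ?N\<^sup>2 * B\<^sup>2 / e * z\<^sup>2) / 2)" by (intro sum_mono t)
  also have "\<dots> = (e * (\<Sum>i\<in>UNIV. (y i)\<^sup>2) + ?N^3 * B\<^sup>2 / e * z\<^sup>2) / 2"
    by (simp add: sum.distrib sum_distrib_left[symmetric] sum_divide_distrib[symmetric] power2_eq_square power3_eq_cube)
  finally show ?thesis .
qed

text \<open>The weight functions \<open>w\<close>, \<open>w'\<close> and \<open>w''\<close> stand for the first three derivatives of the exponent \<open>\<phi>\<close> of the Carleman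
  weight, as functions of the coordinate \<open>x\<^sub>n\<close>.\<close>

locale carleman_setting = carleman_coefficients R n a
  for R :: real and n :: "'n::finite" and a :: "'n \<Rightarrow> 'n \<Rightarrow> real ^ 'n \<Rightarrow> real" +
  fixes \<mu> M :: real and w w' w'' :: "real \<Rightarrow> real" and W1 W2 :: real
  assumes mu: "0 < \<mu>"
    and elliptic: "\<And>x \<xi>. x \<in> cube R \<Longrightarrow> \<mu> * (\<Sum>i\<in>UNIV. (\<xi> i)\<^sup>2) \<le> (\<Sum>k\<in>UNIV. \<Sum>l\<in>UNIV. a k l x * (\<xi> k * \<xi> l))"
    and a_bound: "\<And>i j x. x \<in> cube R \<Longrightarrow> \<bar>a i j x\<bar> \<le> M"
    and da_bound: "\<And>i j k x. x \<in> cube R \<Longrightarrow> \<bar>partial k (a i j) x\<bar> \<le> M"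
    and w_deriv: "\<And>t. - R \<le> t \<Longrightarrow> t \<le> R \<Longrightarrow> (w has_real_derivative w' t) (at t)"
    and w'_deriv: "\<And>t. - R \<le> t \<Longrightarrow> t \<le> R \<Longrightarrow> (w' has_real_derivative w'' t) (at t)"
    and w''_cont: "continuous_on {- R..R} w''"
    and w_pos: "\<And>t. - R \<le> t \<Longrightarrow> t \<le> R \<Longrightarrow> 0 < w t"
    and w'_bound: "\<And>t. - R \<le> t \<Longrightarrow> t \<le> R \<Longrightarrow> \<bar>w' t\<bar> \<le> W1"
    and w''_bound: "\<And>t. - R \<le> t \<Longrightarrow> t \<le> R \<Longrightarrow> \<bar>w'' t\<bar> \<le> W2"
begin

lemma M_nonneg: "0 \<le> M"
proof -
  have "0 \<in> (cube R :: (real ^ 'n) set)" using R by (simp add: mem_cube)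
  from a_bound[OF this, of n n] show ?thesis by linarith
qed

lemma ann_lower: "x \<in> cube R \<Longrightarrow> \<mu> \<le> a n n x"
proof -
  assume x: "x \<in> cube R"
  let ?xi = "\<lambda>i. if i = n then 1 else 0 :: real"
  have "(\<Sum>i\<in>UNIV. (?xi i)\<^sup>2) = ?xi n ^ 2" by (rule sum_UNIV_single) simp
  moreover have "(\<Sum>k\<in>UNIV. \<Sum>l\<in>UNIV. a k l x * (?xi k * ?xi l)) = (\<Sum>l\<in>UNIV. a n l x * (?xi n * ?xi l))"
    by (rule sum_UNIV_single) simp
  moreover have "\<dots> = a n n x * (?xi n * ?xi n)" by (rule sum_UNIV_single) simp
  ultimately show ?thesis using elliptic[OF x, of ?xi] by simp
qed

lemma coordinate_range: "x \<in> closure (cube R) \<Longrightarrow> - R \<le> x $ n \<and> x $ n \<le> R" for x :: "real ^ 'n"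
  by (simp add: closure_cube R)

lemma coordinate_range': "x \<in> cube R \<Longrightarrow> - R \<le> x $ n" "x \<in> cube R \<Longrightarrow> x $ n \<le> R" for x :: "real ^ 'n"
  by (auto simp: mem_cube less_imp_le)

lemma coordinate_image: "(\<lambda>x. x $ n) ` closure (cube R :: (real ^ 'n) set) \<subseteq> {- R..R}"
  using coordinate_range by auto

lemma w'_cont: "continuous_on {- R..R} w'"
  by (intro continuous_at_imp_continuous_on ballI DERIV_isCont[OF w'_deriv]) auto

lemma w_C1: "C1 R (\<lambda>x :: real ^ 'n. w (x $ n))"
  by (rule C1_closure_comp_coordinate[where h'=w'])
     (auto intro: continuous_on_subset[OF w'_cont coordinate_image] w_deriv dest: coordinate_range)

lemma w'_C1: "C1 R (\<lambda>x :: real ^ 'n. w' (x $ n))"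
  by (rule C1_closure_comp_coordinate[where h'=w''])
     (auto intro: continuous_on_subset[OF w''_cont coordinate_image] w'_deriv dest: coordinate_range)

lemma partial_w: "x \<in> cube R \<Longrightarrow> partial l (\<lambda>x :: real ^ 'n. w (x $ n)) x = (if l = n then w' (x $ n) else 0)"
  by (rule partial_comp_coordinate[where h=w]) (auto intro: w_deriv coordinate_range')

lemma partial_w': "x \<in> cube R \<Longrightarrow> partial l (\<lambda>x :: real ^ 'n. w' (x $ n)) x = (if l = n then w'' (x $ n) else 0)"
  by (rule partial_comp_coordinate[where h=w']) (auto intro: w'_deriv coordinate_range')

lemma partial_mult_C1:
  "x \<in> cube R \<Longrightarrow> C1 R f \<Longrightarrow> C1 R g \<Longrightarrow>
    partial i (\<lambda>x. f x * g x) x = partial i f x * g x + f x * partial i g x"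
  by (intro partial_mult C1_closureD(2))

lemma partial_aa_bound:
  assumes "x \<in> cube R" shows "\<bar>partial m (\<lambda>x. a k l x * a i j x) x\<bar> \<le> 2 * M\<^sup>2"
proof -
  have "\<bar>partial m (\<lambda>x. a k l x * a i j x) x\<bar> \<le> \<bar>partial m (a k l) x\<bar> * \<bar>a i j x\<bar> + \<bar>a k l x\<bar> * \<bar>partial m (a i j) x\<bar>"
    unfolding partial_mult_C1[OF assms a_C1 a_C1] by (rule order_trans[OF abs_triangle_ineq]) (simp add: abs_mult)
  also have "\<dots> \<le> M * M + M * M"
    by (intro add_mono mult_mono a_bound da_bound assms M_nonneg) auto
  finally show ?thesis by (simp add: power2_eq_square)
qed

lemma aa_bound:
  assumes "x \<in> cube R" shows "\<bar>a k l x * a i j x\<bar> \<le> M\<^sup>2"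
proof -
  have "\<bar>a k l x\<bar> * \<bar>a i j x\<bar> \<le> M * M" by (intro mult_mono a_bound assms M_nonneg) auto
  then show ?thesis by (simp add: abs_mult power2_eq_square)
qed

definition principal :: "('n \<Rightarrow> 'n \<Rightarrow> real ^ 'n \<Rightarrow> real) \<Rightarrow> real ^ 'n \<Rightarrow> real" where
  "principal H x = (\<Sum>k\<in>UNIV. \<Sum>l\<in>UNIV. a k l x * H k l x)"

definition conormal :: "('n \<Rightarrow> real ^ 'n \<Rightarrow> real) \<Rightarrow> real ^ 'n \<Rightarrow> real" where
  "conormal D x = (\<Sum>i\<in>UNIV. a i n x * D i x)"

definition energy :: "('n \<Rightarrow> real ^ 'n \<Rightarrow> real) \<Rightarrow> real ^ 'n \<Rightarrow> real" where
  "energy D x = (\<Sum>k\<in>UNIV. \<Sum>l\<in>UNIV. a k l x * (D k x * D l x))"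

definition grad2 :: "('n \<Rightarrow> real ^ 'n \<Rightarrow> real) \<Rightarrow> real ^ 'n \<Rightarrow> real" where
  "grad2 D x = (\<Sum>i\<in>UNIV. (D i x)\<^sup>2)"

lemma grad2_nonneg: "0 \<le> grad2 D x"
  by (simp add: grad2_def sum_nonneg)

lemma energy_lower: "x \<in> cube R \<Longrightarrow> \<mu> * grad2 D x \<le> energy D x"
  using elliptic[of x "\<lambda>i. D i x"] by (simp add: grad2_def energy_def)

context
  fixes v :: "real ^ 'n \<Rightarrow> real" and Dv and DDv
  assumes v: "carleman_admissible R n v Dv DDv"
begin

lemma L2s: "v \<in> L2 (cube R)" "Dv i \<in> L2 (cube R)" "DDv i j \<in> L2 (cube R)"
  using in_H1_L2[OF carleman_admissibleD(2)[OF v]] in_H1_L2[OF zero_trace_in_H1[OF carleman_admissibleD(1)[OF v]]] by auto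

lemma principal_L2: "principal DDv \<in> L2 (cube R)"
  unfolding principal_def[abs_def] by (intro L2_sum C1_closure_mult_L2 a_C1 L2s)

lemma conormal_L2: "conormal Dv \<in> L2 (cube R)"
  unfolding conormal_def[abs_def] by (intro L2_sum C1_closure_mult_L2 a_C1 L2s)

lemma grad2_integrable: "integrable (leb R) (grad2 Dv)"
  unfolding grad2_def[abs_def] by (intro Bochner_Integration.integrable_sum L2_integrable_square L2s)

lemma v2_integrable: "integrable (leb R) (\<lambda>x. (v x)\<^sup>2)"
  by (intro L2_integrable_square L2s)

lemma energy_integrable: "integrable (leb R) (energy Dv)"
  unfolding energy_def[abs_def]
  by (intro Bochner_Integration.integrable_sum C1_mult_integrable a_C1 L2_integrable_mult L2s)

lemma triple_integral_sum:
  assumes "\<And>k l i. integrable (leb R) (f k l i :: real ^ 'n \<Rightarrow> real)"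
  shows "(\<Sum>k\<in>UNIV. \<Sum>l\<in>UNIV. \<Sum>i\<in>UNIV. LINT x|leb R. f k l i x)
    = (LINT x|leb R. (\<Sum>k\<in>(UNIV::'n set). \<Sum>l\<in>(UNIV::'n set). \<Sum>i\<in>(UNIV::'n set). f k l i x))"
  using assms by simp

text \<open>In the right-hand side of \<open>rellich_inequality\<close>, the derivative falling on the weight gives the two terms with \<open>w'\<close>. If it
  falls on the coefficients, the factor \<open>w\<close> stays, and \<open>2 M\<^sup>2\<close> bounds the derivative of a product of two
  coefficients.\<close>

lemma weighted_conormal_estimate:
  "(LINT x|leb R. w (x $ n) * (principal DDv x * conormal Dv x))
   \<le> (LINT x|leb R. - (w' (x $ n) * (conormal Dv x * conormal Dv x))
        + w' (x $ n) * (a n n x * energy Dv x) / 2 + 3 * M\<^sup>2 * (real CARD('n))\<^sup>2 * (w (x $ n) * grad2 Dv x))"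
proof -
  let ?c = "\<lambda>k l i x. w (x $ n) * (a k l x * a i n x)"
  have c: "C1 R (?c k l i)" for k l i by (intro C1_closure_mult w_C1 a_C1)
  have wn: "0 \<le> w (x $ n)" if "x \<in> closure (cube R)" for x :: "real ^ 'n"
    using w_pos coordinate_range[OF that] by (simp add: less_imp_le)
  have int1: "integrable (leb R) (\<lambda>x. ?c k l i x * (DDv k l x * Dv i x))" for k l i
    by (intro C1_closure_mult_integrable c L2s)
  have int2: "integrable (leb R) (\<lambda>x. partial l (?c k l i) x * (Dv k x * Dv i x))" for k l i
    by (intro C1_closure_mult_integrable c L2s)
  have int3: "integrable (leb R) (\<lambda>x. partial i (?c k l i) x * (Dv k x * Dv l x))" for k l i
    by (intro C1_closure_mult_integrable c L2s)
  let ?s1 = "\<lambda>x. \<Sum>k\<in>UNIV. \<Sum>l\<in>UNIV. \<Sum>i\<in>UNIV. partial l (?c k l i) x * (Dv k x * Dv i x)"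
  let ?s2 = "\<lambda>x. \<Sum>k\<in>UNIV. \<Sum>l\<in>UNIV. \<Sum>i\<in>UNIV. partial i (?c k l i) x * (Dv k x * Dv l x)"
  have i1: "integrable (leb R) ?s1" by (intro Bochner_Integration.integrable_sum int2)
  have i2: "integrable (leb R) ?s2" by (intro Bochner_Integration.integrable_sum int3)
  have prod: "w (x $ n) * (principal DDv x * conormal Dv x) = (\<Sum>k\<in>UNIV. \<Sum>l\<in>UNIV. \<Sum>i\<in>UNIV. ?c k l i x * (DDv k l x * Dv i x))" for x
    unfolding principal_def sum_distrib_right
    unfolding conormal_def sum_distrib_left
    by (intro sum.cong refl) (simp add: mult_ac)
  have "(LINT x|leb R. w (x $ n) * (principal DDv x * conormal Dv x))
    = (\<Sum>k\<in>UNIV. \<Sum>l\<in>UNIV. \<Sum>i\<in>UNIV. LINT x|leb R. ?c k l i x * (DDv k l x * Dv i x))"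
    unfolding prod by (rule triple_integral_sum[OF int1, symmetric])
  also have "\<dots> \<le> - (\<Sum>k\<in>UNIV. \<Sum>l\<in>UNIV. \<Sum>i\<in>UNIV. LINT x|leb R. partial l (?c k l i) x * (Dv k x * Dv i x))
      + (\<Sum>k\<in>UNIV. \<Sum>l\<in>UNIV. \<Sum>i\<in>UNIV. LINT x|leb R. partial i (?c k l i) x * (Dv k x * Dv l x)) / 2"
    by (rule rellich_inequality[OF v w_C1 wn])
  also have "\<dots> = - (LINT x|leb R. ?s1 x) + (LINT x|leb R. ?s2 x) / 2"
    unfolding triple_integral_sum[OF int2] triple_integral_sum[OF int3] ..
  also have "\<dots> = (LINT x|leb R. - ?s1 x + ?s2 x / 2)"
    using i1 i2 by simp
  also have "\<dots> \<le> (LINT x|leb R. - (w' (x $ n) * (conormal Dv x * conormal Dv x))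
        + w' (x $ n) * (a n n x * energy Dv x) / 2 + 3 * M\<^sup>2 * (real CARD('n))\<^sup>2 * (w (x $ n) * grad2 Dv x))"
  proof (rule integral_mono)
    show "integrable (leb R) (\<lambda>x. - ?s1 x + ?s2 x / 2)" using i1 i2 by simp
    show "integrable (leb R) (\<lambda>x. - (w' (x $ n) * (conormal Dv x * conormal Dv x))
        + w' (x $ n) * (a n n x * energy Dv x) / 2 + 3 * M\<^sup>2 * (real CARD('n))\<^sup>2 * (w (x $ n) * grad2 Dv x))"
      by (intro Bochner_Integration.integrable_add Bochner_Integration.integrable_minus integrable_divide integrable_mult_right
          C1_mult_integrable w_C1 w'_C1 a_C1 L2_integrable_mult conormal_L2 energy_integrable grad2_integrable)
    fix x :: "real ^ 'n" assume "x \<in> space (leb R)"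
    then have x: "x \<in> cube R" by simp
    have w0: "0 \<le> w (x $ n)" using wn x closure_subset by blast
    let ?D = "\<lambda>m k l i. partial m (\<lambda>x. a k l x * a i n x) x"
    have p: "partial m (?c k l i) x = (if m = n then w' (x $ n) * (a k l x * a i n x) else 0) + w (x $ n) * ?D m k l i" for m k l i
      using partial_mult_C1[OF x w_C1 C1_closure_mult[OF a_C1 a_C1], of m k l i n] partial_w[OF x, of m] by simp
    have s1: "?s1 x = w' (x $ n) * (conormal Dv x * conormal Dv x)
        + w (x $ n) * (\<Sum>k\<in>UNIV. \<Sum>l\<in>UNIV. \<Sum>i\<in>UNIV. ?D l k l i * (Dv k x * Dv i x))"
    proof -
      have "?s1 x = (\<Sum>k\<in>UNIV. \<Sum>l\<in>UNIV. \<Sum>i\<in>UNIV. (if l = n then w' (x $ n) * (a k l x * a i n x) * (Dv k x * Dv i x) else 0))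
        + w (x $ n) * (\<Sum>k\<in>UNIV. \<Sum>l\<in>UNIV. \<Sum>i\<in>UNIV. ?D l k l i * (Dv k x * Dv i x))"
        unfolding p sum_distrib_left sum.distrib[symmetric]
        by (intro sum.cong refl) (auto simp: algebra_simps)
      also have "(\<Sum>k\<in>UNIV. \<Sum>l\<in>UNIV. \<Sum>i\<in>UNIV. (if l = n then w' (x $ n) * (a k l x * a i n x) * (Dv k x * Dv i x) else 0))
        = (\<Sum>k\<in>UNIV. \<Sum>i\<in>UNIV. w' (x $ n) * (a k n x * a i n x) * (Dv k x * Dv i x))"
        by (rule sum.cong[OF refl], rule trans[OF sum_UNIV_single[of n]]) auto
      also have "\<dots> = w' (x $ n) * (conormal Dv x * conormal Dv x)"
        unfolding conormal_def sum_product
        unfolding sum_distrib_left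
        by (intro sum.cong refl) (simp add: mult_ac)
      finally show ?thesis .
    qed
    have s2: "?s2 x = w' (x $ n) * (a n n x * energy Dv x)
        + w (x $ n) * (\<Sum>k\<in>UNIV. \<Sum>l\<in>UNIV. \<Sum>i\<in>UNIV. ?D i k l i * (Dv k x * Dv l x))"
    proof -
      have "?s2 x = (\<Sum>k\<in>UNIV. \<Sum>l\<in>UNIV. \<Sum>i\<in>UNIV. (if i = n then w' (x $ n) * (a k l x * a i n x) * (Dv k x * Dv l x) else 0))
        + w (x $ n) * (\<Sum>k\<in>UNIV. \<Sum>l\<in>UNIV. \<Sum>i\<in>UNIV. ?D i k l i * (Dv k x * Dv l x))"
        unfolding p sum_distrib_left sum.distrib[symmetric]
        by (intro sum.cong refl) (auto simp: algebra_simps)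
      also have "(\<Sum>k\<in>UNIV. \<Sum>l\<in>UNIV. \<Sum>i\<in>UNIV. (if i = n then w' (x $ n) * (a k l x * a i n x) * (Dv k x * Dv l x) else 0))
        = w' (x $ n) * (a n n x * energy Dv x)"
        unfolding energy_def sum_distrib_left
        by (intro sum.cong refl, subst sum_UNIV_single[of n]) (auto simp: mult_ac)
      finally show ?thesis .
    qed
    note B = triple_sum_bound[of "\<lambda>k l i. ?D l k l i" "2 * M\<^sup>2" "\<lambda>i. Dv i x", OF partial_aa_bound[OF x]]
      triple_sum_bound'[of "\<lambda>k l i. ?D i k l i" "2 * M\<^sup>2" "\<lambda>i. Dv i x", OF partial_aa_bound[OF x]]
    have e1: "- (w (x $ n) * s) \<le> w (x $ n) * (2 * M\<^sup>2 * (real CARD('n))\<^sup>2 * grad2 Dv x)"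
      if "\<bar>s\<bar> \<le> 2 * M\<^sup>2 * (real CARD('n))\<^sup>2 * (\<Sum>i\<in>UNIV. (Dv i x)\<^sup>2)" for s
      using mult_left_mono[OF abs_le_D2[OF that] w0] by (simp add: grad2_def)
    have e2: "w (x $ n) * s \<le> w (x $ n) * (2 * M\<^sup>2 * (real CARD('n))\<^sup>2 * grad2 Dv x)"
      if "\<bar>s\<bar> \<le> 2 * M\<^sup>2 * (real CARD('n))\<^sup>2 * (\<Sum>i\<in>UNIV. (Dv i x)\<^sup>2)" for s
      using mult_left_mono[OF abs_le_D1[OF that] w0] by (simp add: grad2_def)
    have eq: "w (x $ n) * (2 * M\<^sup>2 * (real CARD('n))\<^sup>2 * grad2 Dv x) + w (x $ n) * (2 * M\<^sup>2 * (real CARD('n))\<^sup>2 * grad2 Dv x) / 2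
        = 3 * M\<^sup>2 * (real CARD('n))\<^sup>2 * (w (x $ n) * grad2 Dv x)" by (simp add: algebra_simps)
    show "- ?s1 x + ?s2 x / 2 \<le> - (w' (x $ n) * (conormal Dv x * conormal Dv x))
        + w' (x $ n) * (a n n x * energy Dv x) / 2 + 3 * M\<^sup>2 * (real CARD('n))\<^sup>2 * (w (x $ n) * grad2 Dv x)"
      unfolding s1 s2 add_divide_distrib using e1[OF B(1)] e2[OF B(2)] eq by linarith
  qed
  finally show ?thesis .
qed

text \<open>Here the derivative of the coefficient multiplies \<open>v\<^sub>k v\<close> only. Since the gradient part can be made small, the
  constant may depend on all derivatives of the weight.\<close>

lemma weighted_potential_estimate:
  assumes e: "0 < e"
  shows "(LINT x|leb R. w' (x $ n) * a n n x * (principal DDv x * v x))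
   \<le> (LINT x|leb R. - (w' (x $ n) * (a n n x * energy Dv x))
        + (e * grad2 Dv x + (real CARD('n))^3 * ((W2 + 2 * W1) * M\<^sup>2)\<^sup>2 / e * (v x)\<^sup>2) / 2)"
proof -
  let ?c = "\<lambda>k l x. w' (x $ n) * (a n n x * a k l x)"
  have c: "C1 R (?c k l)" for k l by (intro C1_closure_mult w'_C1 a_C1)
  have int1: "integrable (leb R) (\<lambda>x. ?c k l x * (DDv k l x * v x))" for k l
    by (intro C1_closure_mult_integrable c L2s)
  have int2: "integrable (leb R) (\<lambda>x. partial l (?c k l) x * (Dv k x * v x))" for k l
    by (intro C1_closure_mult_integrable c L2s)
  have int3: "integrable (leb R) (\<lambda>x. ?c k l x * (Dv k x * Dv l x))" for k l
    by (intro C1_closure_mult_integrable c L2s)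
  let ?s1 = "\<lambda>x. \<Sum>k\<in>UNIV. \<Sum>l\<in>UNIV. partial l (?c k l) x * (Dv k x * v x)"
  have i1: "integrable (leb R) ?s1" by (intro Bochner_Integration.integrable_sum int2)
  have i2: "integrable (leb R) (\<lambda>x. w' (x $ n) * (a n n x * energy Dv x))"
    by (intro C1_mult_integrable w'_C1 a_C1 energy_integrable)
  have prod: "w' (x $ n) * a n n x * (principal DDv x * v x) = (\<Sum>k\<in>UNIV. \<Sum>l\<in>UNIV. ?c k l x * (DDv k l x * v x))" for x
    unfolding principal_def sum_distrib_left sum_distrib_right
    by (intro sum.cong refl) (simp add: mult_ac)
  have en: "w' (x $ n) * (a n n x * energy Dv x) = (\<Sum>k\<in>UNIV. \<Sum>l\<in>UNIV. ?c k l x * (Dv k x * Dv l x))" for x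
    unfolding energy_def sum_distrib_left by (intro sum.cong refl) (simp add: mult_ac)
  have "(LINT x|leb R. w' (x $ n) * a n n x * (principal DDv x * v x))
    = (\<Sum>k\<in>UNIV. \<Sum>l\<in>UNIV. LINT x|leb R. ?c k l x * (DDv k l x * v x))"
    unfolding prod using int1 by simp
  also have "\<dots> = - (\<Sum>k\<in>UNIV. \<Sum>l\<in>UNIV. LINT x|leb R. partial l (?c k l) x * (Dv k x * v x))
      - (\<Sum>k\<in>UNIV. \<Sum>l\<in>UNIV. LINT x|leb R. ?c k l x * (Dv k x * Dv l x))"
    unfolding hessian_by_parts[OF v c] sum_subtractf sum_negf ..
  also have "\<dots> = - (LINT x|leb R. ?s1 x) - (LINT x|leb R. w' (x $ n) * (a n n x * energy Dv x))"
    unfolding en using int2 int3 by simp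
  also have "\<dots> = (LINT x|leb R. - ?s1 x - w' (x $ n) * (a n n x * energy Dv x))"
    using i1 i2 by simp
  also have "\<dots> \<le> (LINT x|leb R. - (w' (x $ n) * (a n n x * energy Dv x))
        + (e * grad2 Dv x + (real CARD('n))^3 * ((W2 + 2 * W1) * M\<^sup>2)\<^sup>2 / e * (v x)\<^sup>2) / 2)"
  proof (rule integral_mono)
    show "integrable (leb R) (\<lambda>x. - ?s1 x - w' (x $ n) * (a n n x * energy Dv x))" using i1 i2 by simp
    show "integrable (leb R) (\<lambda>x. - (w' (x $ n) * (a n n x * energy Dv x))
        + (e * grad2 Dv x + (real CARD('n))^3 * ((W2 + 2 * W1) * M\<^sup>2)\<^sup>2 / e * (v x)\<^sup>2) / 2)"
      by (intro Bochner_Integration.integrable_add Bochner_Integration.integrable_minus integrable_divide integrable_mult_right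
          i2 grad2_integrable v2_integrable)
    fix x :: "real ^ 'n" assume "x \<in> space (leb R)"
    then have x: "x \<in> cube R" by simp
    have "\<bar>partial l (?c k l) x\<bar> \<le> (W2 + 2 * W1) * M\<^sup>2" for k l
    proof -
      have W1: "\<bar>w' (x $ n)\<bar> \<le> W1" and W2': "\<bar>w'' (x $ n)\<bar> \<le> W2"
        by (intro w'_bound w''_bound coordinate_range' x)+
      then have W0: "0 \<le> W1" "0 \<le> W2" by linarith+
      then have W2: "\<bar>if l = n then w'' (x $ n) else 0\<bar> \<le> W2" using W2' by simp
      have "\<bar>partial l (?c k l) x\<bar> \<le> \<bar>if l = n then w'' (x $ n) else 0\<bar> * \<bar>a n n x * a k l x\<bar>
          + \<bar>w' (x $ n)\<bar> * \<bar>partial l (\<lambda>x. a n n x * a k l x) x\<bar>"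
        unfolding partial_mult_C1[OF x w'_C1 C1_closure_mult[OF a_C1 a_C1]] partial_w'[OF x]
        by (rule order_trans[OF abs_triangle_ineq]) (simp add: abs_mult)
      also have "\<dots> \<le> W2 * M\<^sup>2 + W1 * (2 * M\<^sup>2)"
        by (intro add_mono mult_mono aa_bound partial_aa_bound x W1 W2 W0 abs_ge_zero)
      finally show ?thesis by (simp add: algebra_simps)
    qed
    from double_sum_bound[of "\<lambda>k l. partial l (?c k l) x", OF this e, of "\<lambda>k. Dv k x" "v x"]
    show "- ?s1 x - w' (x $ n) * (a n n x * energy Dv x) \<le> - (w' (x $ n) * (a n n x * energy Dv x))
        + (e * grad2 Dv x + (real CARD('n))^3 * ((W2 + 2 * W1) * M\<^sup>2)\<^sup>2 / e * (v x)\<^sup>2) / 2"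
      unfolding grad2_def by linarith
  qed
  finally show ?thesis .
qed

text \<open>As \<open>v v\<^sub>i\<close> is half the derivative of \<open>v\<^sup>2\<close>, one integration by parts leaves only \<open>v\<^sup>2\<close>; the coefficient \<open>3/2\<close> stems from
  the derivative of \<open>w\<^sup>3\<close>.\<close>

lemma weighted_transport_estimate:
  "(LINT x|leb R. w (x $ n) ^ 3 * a n n x * (conormal Dv x * v x))
   \<le> (LINT x|leb R. (- (3 / 2) * ((w (x $ n))\<^sup>2 * w' (x $ n) * (a n n x)\<^sup>2) + M\<^sup>2 * (real CARD('n)) * w (x $ n) ^ 3) * (v x)\<^sup>2)"
proof -
  let ?c = "\<lambda>i x. w (x $ n) ^ 3 * (a n n x * a i n x)"
  have c: "C1 R (?c i)" for i by (intro C1_closure_mult C1_closure_power w_C1 a_C1)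
  have int1: "integrable (leb R) (\<lambda>x. ?c i x * (Dv i x * v x))" for i
    by (intro C1_closure_mult_integrable c L2s)
  have int2: "integrable (leb R) (\<lambda>x. partial i (?c i) x * (v x)\<^sup>2)" for i
    using C1_closure_mult_integrable(2)[OF c L2s(1) L2s(1)] by (simp add: power2_eq_square)
  have prod: "w (x $ n) ^ 3 * a n n x * (conormal Dv x * v x) = (\<Sum>i\<in>UNIV. ?c i x * (Dv i x * v x))" for x
    unfolding conormal_def sum_distrib_left sum_distrib_right
    by (intro sum.cong refl) (simp add: mult_ac)
  have "(LINT x|leb R. w (x $ n) ^ 3 * a n n x * (conormal Dv x * v x))
    = (\<Sum>i\<in>UNIV. LINT x|leb R. ?c i x * (Dv i x * v x))"
    unfolding prod using int1 by simp
  also have "\<dots> = (\<Sum>i\<in>UNIV. - (LINT x|leb R. partial i (?c i) x * (v x)\<^sup>2) / 2)"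
    unfolding gradient_by_parts[OF v c] ..
  also have "\<dots> = (LINT x|leb R. (\<Sum>i\<in>UNIV. - (partial i (?c i) x * (v x)\<^sup>2) / 2))"
    using int2 by simp
  also have "\<dots> \<le> (LINT x|leb R. (- (3 / 2) * ((w (x $ n))\<^sup>2 * w' (x $ n) * (a n n x)\<^sup>2) + M\<^sup>2 * (real CARD('n)) * w (x $ n) ^ 3) * (v x)\<^sup>2)"
  proof (rule integral_mono)
    show "integrable (leb R) (\<lambda>x. \<Sum>i\<in>UNIV. - (partial i (?c i) x * (v x)\<^sup>2) / 2)"
      using int2 by (intro Bochner_Integration.integrable_sum integrable_divide Bochner_Integration.integrable_minus)
    show "integrable (leb R) (\<lambda>x. (- (3 / 2) * ((w (x $ n))\<^sup>2 * w' (x $ n) * (a n n x)\<^sup>2) + M\<^sup>2 * (real CARD('n)) * w (x $ n) ^ 3) * (v x)\<^sup>2)"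
      by (intro C1_mult_integrable v2_integrable C1_closure_add C1_closure_mult C1_closure_power C1_closure_const w_C1 w'_C1 a_C1)
    fix x :: "real ^ 'n" assume "x \<in> space (leb R)"
    then have x: "x \<in> cube R" by simp
    have w0: "0 \<le> w (x $ n) ^ 3" using w_pos coordinate_range'[OF x] by (simp add: less_imp_le)
    let ?D = "\<lambda>i. partial i (\<lambda>x. a n n x * a i n x) x"
    have p3: "partial i (\<lambda>x. w (x $ n) ^ 3) x = (if i = n then 3 * (w (x $ n))\<^sup>2 * w' (x $ n) else 0)" for i
    proof -
      have "((\<lambda>t. w t ^ 3) has_real_derivative 3 * (w (x $ n))\<^sup>2 * w' (x $ n)) (at (x $ n))"
        using w_deriv[of "x $ n"] coordinate_range'[OF x] by (auto intro!: derivative_eq_intros)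
      from partial_comp_coordinate[where h="\<lambda>t. w t ^ 3", OF this] show ?thesis by simp
    qed
    have p: "partial i (?c i) x = (if i = n then 3 * (w (x $ n))\<^sup>2 * w' (x $ n) * (a n n x * a i n x) else 0) + w (x $ n) ^ 3 * ?D i" for i
      using partial_mult_C1[OF x C1_closure_power[OF w_C1] C1_closure_mult[OF a_C1 a_C1], of i 3 n n i n] p3[of i] by simp
    have s: "(\<Sum>i\<in>UNIV. partial i (?c i) x) = 3 * ((w (x $ n))\<^sup>2 * w' (x $ n) * (a n n x)\<^sup>2) + w (x $ n) ^ 3 * (\<Sum>i\<in>UNIV. ?D i)"
      unfolding p sum.distrib sum_distrib_left[symmetric] by (simp add: power2_eq_square mult_ac)
    have "\<bar>\<Sum>i\<in>UNIV. ?D i\<bar> \<le> (\<Sum>i\<in>(UNIV::'n set). 2 * M\<^sup>2)"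
      by (intro order_trans[OF sum_abs] sum_mono partial_aa_bound x)
    then have "- (\<Sum>i\<in>UNIV. ?D i) \<le> 2 * M\<^sup>2 * (real CARD('n))" by (simp add: mult.commute abs_le_iff)
    from mult_left_mono[OF this w0]
    have e: "- (w (x $ n) ^ 3 * (\<Sum>i\<in>UNIV. ?D i)) \<le> 2 * (M\<^sup>2 * (real CARD('n)) * w (x $ n) ^ 3)"
      by (simp add: mult_ac)
    have "(\<Sum>i\<in>UNIV. - (partial i (?c i) x * (v x)\<^sup>2) / 2) = (- (\<Sum>i\<in>UNIV. partial i (?c i) x) / 2) * (v x)\<^sup>2"
      by (simp add: sum_negf sum_distrib_right sum_divide_distrib)
    also have "\<dots> \<le> (- (3 / 2) * ((w (x $ n))\<^sup>2 * w' (x $ n) * (a n n x)\<^sup>2) + M\<^sup>2 * (real CARD('n)) * w (x $ n) ^ 3) * (v x)\<^sup>2"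
    proof (rule mult_right_mono[OF _ zero_le_power2])
      have "- (3 * P + t) / 2 \<le> - (3 / 2) * P + B" if "- t \<le> 2 * B" for P t B :: real
        using that by (simp add: field_simps)
      from this[OF e] show "- (\<Sum>i\<in>UNIV. partial i (?c i) x) / 2
          \<le> - (3 / 2) * ((w (x $ n))\<^sup>2 * w' (x $ n) * (a n n x)\<^sup>2) + M\<^sup>2 * real CARD('n) * w (x $ n) ^ 3"
        unfolding s .
    qed
    finally show "(\<Sum>i\<in>UNIV. - (partial i (?c i) x * (v x)\<^sup>2) / 2)
      \<le> (- (3 / 2) * ((w (x $ n))\<^sup>2 * w' (x $ n) * (a n n x)\<^sup>2) + M\<^sup>2 * (real CARD('n)) * w (x $ n) ^ 3) * (v x)\<^sup>2" .
  qed
  finally show ?thesis .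
qed

end

end

section \<open>The Carleman estimate\<close>

text \<open>This is \<open>2 P\<^sub>1 P\<^sub>2 - Q\<^sup>2 \<le> (P\<^sub>1 + P\<^sub>2 + Q)\<^sup>2\<close> with the product on the left expanded. It follows from
  \<open>(P\<^sub>1 + P\<^sub>2)\<^sup>2 \<le> 2 F\<^sup>2 + 2 Q\<^sup>2\<close> and \<open>4 P\<^sub>1 P\<^sub>2 \<le> (P\<^sub>1 + P\<^sub>2)\<^sup>2\<close>.\<close>

lemma cross_term_le_square:
  fixes A S a v w w' lam F :: real
  assumes F: "F = A - 2 * lam * w * S + (lam\<^sup>2 * w\<^sup>2 - lam * w') * (a * v)"
  shows "- 4 * lam * (w * (A * S)) - 4 * lam * (w' * a * (A * v)) - 4 * lam^3 * (w^3 * a * (S * v))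
      - 4 * lam^3 * (w\<^sup>2 * w' * a\<^sup>2 * v\<^sup>2) - lam\<^sup>2 * (w'\<^sup>2 * a\<^sup>2 * v\<^sup>2) \<le> F\<^sup>2"
proof -
  define P1 P2 Q where "P1 = A + lam\<^sup>2 * w\<^sup>2 * (a * v)" and "P2 = - 2 * lam * w * S - 2 * lam * w' * (a * v)"
    and "Q = lam * w' * (a * v)"
  have FP: "F = P1 + P2 + Q" by (simp add: F P1_def P2_def Q_def algebra_simps)
  have "0 \<le> (F + Q)\<^sup>2" "0 \<le> (P1 - P2)\<^sup>2" by simp_all
  then have "2 * (P1 * P2) - Q\<^sup>2 \<le> F\<^sup>2"
    unfolding FP by (simp add: power2_eq_square algebra_simps)
  moreover have "2 * (P1 * P2) - Q\<^sup>2 = - 4 * lam * (w * (A * S)) - 4 * lam * (w' * a * (A * v)) - 4 * lam^3 * (w^3 * a * (S * v))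
      - 4 * lam^3 * (w\<^sup>2 * w' * a\<^sup>2 * v\<^sup>2) - lam\<^sup>2 * (w'\<^sup>2 * a\<^sup>2 * v\<^sup>2)"
    by (simp add: P1_def P2_def Q_def power2_eq_square power3_eq_cube algebra_simps)
  ultimately show ?thesis by simp
qed

text \<open>The terms with \<open>w' a Q\<close> add up to \<open>+ 2 lam w' a Q\<close> and the terms with \<open>w\<^sup>2 w' a\<^sup>2 v\<^sup>2\<close> to \<open>+ 2 lam\<^sup>3 w\<^sup>2 w' a\<^sup>2 v\<^sup>2\<close>. By \<open>dom\<close>, half of
  each absorbs the errors with \<open>w\<close> in place of \<open>w'\<close>. Of what is left, half of the gradient term
  absorbs \<open>e G\<close>, and a quarter of the zero order term each \<open>X v\<^sup>2\<close> and the last term, which have lower order in \<open>lam\<close>.\<close>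

lemma estimate_of_quadratic_terms:
  fixes lam \<mu> M n w w' d1 d2 W1 a Q G S v X e :: real
  assumes lam: "1 \<le> lam" and mu: "0 < \<mu>" and a: "\<mu> \<le> a" "a \<le> M" and Q: "\<mu> * G \<le> Q" and G: "0 \<le> G"
    and d: "0 < d1" "d1 \<le> w" "0 < d2" "d2 \<le> w'" and W1: "w' \<le> W1" and n: "1 \<le> n"
    and dom: "12 * M\<^sup>2 * n\<^sup>2 * w \<le> \<mu>\<^sup>2 * w'" and e: "e = \<mu>\<^sup>2 * d2 / 4"
    and H1: "8 * X \<le> lam * (\<mu>\<^sup>2 * d1\<^sup>2 * d2)" and H2: "4 * (W1\<^sup>2 * M\<^sup>2) \<le> lam * (\<mu>\<^sup>2 * d1\<^sup>2 * d2)"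
  shows "\<mu>\<^sup>2 / 2 * lam * (d2 * G + lam\<^sup>2 * (d1\<^sup>2 * d2 * v\<^sup>2))
    \<le> - 4 * lam * (- (w' * (S * S)) + w' * (a * Q) / 2 + 3 * M\<^sup>2 * n\<^sup>2 * (w * G))
      - 4 * lam * (- (w' * (a * Q)) + (e * G + X * v\<^sup>2) / 2)
      - 4 * lam^3 * ((- (3 / 2) * (w\<^sup>2 * w' * a\<^sup>2) + M\<^sup>2 * n * w^3) * v\<^sup>2)
      - 4 * lam^3 * (w\<^sup>2 * w' * a\<^sup>2 * v\<^sup>2) - lam\<^sup>2 * (w'\<^sup>2 * a\<^sup>2 * v\<^sup>2)"
proof -
  have pos: "0 < w" "0 < w'" "0 < a" "0 < lam" "0 < M" using d a mu lam by linarith+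
  have S: "0 \<le> 4 * lam * (w' * (S * S))" using pos by simp
  have "\<mu>\<^sup>2 * G \<le> a * Q"
    using mult_mono[OF a(1) Q] mu G pos by (simp add: power2_eq_square mult.assoc)
  then have q: "w' * (\<mu>\<^sup>2 * G) \<le> w' * (a * Q)" using pos by (intro mult_left_mono) auto
  have g: "12 * M\<^sup>2 * n\<^sup>2 * (w * G) \<le> w' * (\<mu>\<^sup>2 * G)"
    using mult_right_mono[OF dom G] by (simp add: mult_ac)
  have g2: "d2 * (\<mu>\<^sup>2 * G) \<le> w' * (\<mu>\<^sup>2 * G)" using d G by (intro mult_right_mono) auto
  have "\<mu>\<^sup>2 / 2 * (d2 * G) \<le> 2 * (w' * (a * Q)) - 12 * M\<^sup>2 * n\<^sup>2 * (w * G) - 2 * (e * G)"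
    using q g g2 by (simp add: e field_simps)
  from mult_left_mono[OF this, of lam]
  have grad: "lam * (\<mu>\<^sup>2 / 2 * (d2 * G)) \<le> lam * (2 * (w' * (a * Q)) - 12 * M\<^sup>2 * n\<^sup>2 * (w * G) - 2 * (e * G))"
    using pos by simp
  let ?D = "\<mu>\<^sup>2 * d1\<^sup>2 * d2"
  have D: "0 \<le> ?D" using d by simp
  have "\<mu>\<^sup>2 \<le> a\<^sup>2" using a mu by (intro power_mono) auto
  then have z1: "w\<^sup>2 * w' * \<mu>\<^sup>2 \<le> w\<^sup>2 * w' * a\<^sup>2" using pos by (intro mult_left_mono) auto
  have "4 * M\<^sup>2 * n * w \<le> 12 * M\<^sup>2 * n\<^sup>2 * w"
  proof -
    have "4 * n \<le> 12 * n\<^sup>2" using n mult_mono[of 1 n n n] by (simp add: power2_eq_square)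
    then have "4 * n * (M\<^sup>2 * w) \<le> 12 * n\<^sup>2 * (M\<^sup>2 * w)" using pos by (intro mult_right_mono) auto
    then show ?thesis by (simp add: mult_ac)
  qed
  from order_trans[OF this dom]
  have "w\<^sup>2 * (4 * M\<^sup>2 * n * w) \<le> w\<^sup>2 * (\<mu>\<^sup>2 * w')" by (rule mult_left_mono) simp
  then have z2: "4 * (M\<^sup>2 * n * w^3) \<le> w\<^sup>2 * w' * \<mu>\<^sup>2" by (simp add: power2_eq_square power3_eq_cube mult_ac)
  have "d1\<^sup>2 * d2 \<le> w\<^sup>2 * w'" using d by (intro mult_mono power_mono) auto
  then have z3: "?D \<le> w\<^sup>2 * w' * \<mu>\<^sup>2" using mult_left_mono[of "d1\<^sup>2 * d2" "w\<^sup>2 * w'" "\<mu>\<^sup>2"] by (simp add: mult_ac)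
  have z123: "?D \<le> 2 * (w\<^sup>2 * w' * a\<^sup>2) - 4 * (M\<^sup>2 * n * w^3)" using z1 z2 z3 by linarith
  have l3: "lam^3 * ?D \<le> lam^3 * (2 * (w\<^sup>2 * w' * a\<^sup>2) - 4 * (M\<^sup>2 * n * w^3))"
    using z123 pos by (intro mult_left_mono) auto
  have "lam * ?D \<le> lam\<^sup>2 * ?D" using lam D by (intro mult_right_mono) (auto simp: power2_eq_square)
  then have "8 * X \<le> lam\<^sup>2 * ?D" using H1 by linarith
  from mult_left_mono[OF this, of lam]
  have x: "8 * (lam * X) \<le> lam^3 * ?D" using pos by (simp add: power2_eq_square power3_eq_cube mult_ac)
  have "w'\<^sup>2 * a\<^sup>2 \<le> W1\<^sup>2 * M\<^sup>2" using W1 a pos by (intro mult_mono power_mono) auto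
  then have "4 * (w'\<^sup>2 * a\<^sup>2) \<le> lam * ?D" using H2 by linarith
  from mult_left_mono[OF this, of "lam\<^sup>2"]
  have y: "4 * (lam\<^sup>2 * (w'\<^sup>2 * a\<^sup>2)) \<le> lam^3 * ?D" using pos by (simp add: power2_eq_square power3_eq_cube mult_ac)
  have "lam^3 * ?D / 2 \<le> lam^3 * (2 * (w\<^sup>2 * w' * a\<^sup>2) - 4 * (M\<^sup>2 * n * w^3)) - 2 * (lam * X) - lam\<^sup>2 * (w'\<^sup>2 * a\<^sup>2)"
    using l3 x y by linarith
  from mult_right_mono[OF this, of "v\<^sup>2"]
  have zero: "lam^3 * ?D / 2 * v\<^sup>2 \<le> (lam^3 * (2 * (w\<^sup>2 * w' * a\<^sup>2) - 4 * (M\<^sup>2 * n * w^3)) - 2 * (lam * X) - lam\<^sup>2 * (w'\<^sup>2 * a\<^sup>2)) * v\<^sup>2"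
    by simp
  have "\<mu>\<^sup>2 / 2 * lam * (d2 * G + lam\<^sup>2 * (d1\<^sup>2 * d2 * v\<^sup>2)) = lam * (\<mu>\<^sup>2 / 2 * (d2 * G)) + lam^3 * ?D / 2 * v\<^sup>2"
    by (simp add: power2_eq_square power3_eq_cube algebra_simps)
  also have "\<dots> \<le> 4 * lam * (w' * (S * S)) + lam * (2 * (w' * (a * Q)) - 12 * M\<^sup>2 * n\<^sup>2 * (w * G) - 2 * (e * G))
    + (lam^3 * (2 * (w\<^sup>2 * w' * a\<^sup>2) - 4 * (M\<^sup>2 * n * w^3)) - 2 * (lam * X) - lam\<^sup>2 * (w'\<^sup>2 * a\<^sup>2)) * v\<^sup>2"
    using S grad zero by linarith
  also have "\<dots> = - 4 * lam * (- (w' * (S * S)) + w' * (a * Q) / 2 + 3 * M\<^sup>2 * n\<^sup>2 * (w * G))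
      - 4 * lam * (- (w' * (a * Q)) + (e * G + X * v\<^sup>2) / 2)
      - 4 * lam^3 * ((- (3 / 2) * (w\<^sup>2 * w' * a\<^sup>2) + M\<^sup>2 * n * w^3) * v\<^sup>2)
      - 4 * lam^3 * (w\<^sup>2 * w' * a\<^sup>2 * v\<^sup>2) - lam\<^sup>2 * (w'\<^sup>2 * a\<^sup>2 * v\<^sup>2)"
    by (simp add: algebra_simps)
  finally show ?thesis .
qed

context carleman_setting
begin

text \<open>The gradient and the Hessian of \<open>exp (lam \<phi>) u\<close>, with \<open>E\<close> the value of the exponential at \<open>x\<close>, are inserted into the
  principal part. The first order terms are then expressed by the derivatives of the product again,
  which changes the sign of the term \<open>lam\<^sup>2 w\<^sup>2\<close>.\<close>

lemma conjugated_operator: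
  assumes x: "x \<in> cube R"
    and Dv: "\<And>i. Dv i x = (if i = n then lam * w (x $ n) * E else 0) * u x + E * Du i x"
    and DDv: "\<And>k l. DDv k l x = ((if k = n \<and> l = n then (lam * w' (x $ n) + lam\<^sup>2 * (w (x $ n))\<^sup>2) * E else 0) * u x
        + (if k = n then lam * w (x $ n) * E else 0) * Du l x)
        + ((if l = n then lam * w (x $ n) * E else 0) * Du k x + E * DDu k l x)"
  shows "E * principal DDu x = principal DDv x - 2 * lam * w (x $ n) * conormal Dv x
    + (lam\<^sup>2 * (w (x $ n))\<^sup>2 - lam * w' (x $ n)) * (a n n x * (E * u x))"
proof -
  let ?f = "lam * w (x $ n) * E" and ?g = "(lam * w' (x $ n) + lam\<^sup>2 * (w (x $ n))\<^sup>2) * E"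
  have s1: "(\<Sum>k\<in>UNIV. \<Sum>l\<in>UNIV. a k l x * ((if k = n \<and> l = n then ?g else 0) * u x)) = a n n x * (?g * u x)"
    by (rule trans[OF sum_UNIV_single[of n]], simp, rule trans[OF sum_UNIV_single[of n]]) simp_all
  have s2: "(\<Sum>k\<in>UNIV. \<Sum>l\<in>UNIV. a k l x * ((if k = n then ?f else 0) * Du l x)) = ?f * conormal Du x"
    by (rule trans[OF sum_UNIV_single[of n]]) (simp_all add: conormal_def sum_distrib_left a_sym[of n] mult_ac)
  have s3: "(\<Sum>k\<in>UNIV. \<Sum>l\<in>UNIV. a k l x * ((if l = n then ?f else 0) * Du k x)) = ?f * conormal Du x"
    unfolding conormal_def sum_distrib_left
    by (rule sum.cong[OF refl], rule trans[OF sum_UNIV_single[of n]]) (simp_all add: mult_ac)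
  have s4: "(\<Sum>k\<in>UNIV. \<Sum>l\<in>UNIV. a k l x * (E * DDu k l x)) = E * principal DDu x"
    unfolding principal_def sum_distrib_left by (intro sum.cong refl) (simp add: mult_ac)
  have "principal DDv x = ((\<Sum>k\<in>UNIV. \<Sum>l\<in>UNIV. a k l x * ((if k = n \<and> l = n then ?g else 0) * u x))
      + (\<Sum>k\<in>UNIV. \<Sum>l\<in>UNIV. a k l x * ((if k = n then ?f else 0) * Du l x)))
    + ((\<Sum>k\<in>UNIV. \<Sum>l\<in>UNIV. a k l x * ((if l = n then ?f else 0) * Du k x))
      + (\<Sum>k\<in>UNIV. \<Sum>l\<in>UNIV. a k l x * (E * DDu k l x)))"
    unfolding principal_def DDv distrib_left sum.distrib ..
  then have p: "principal DDv x = (a n n x * (?g * u x) + ?f * conormal Du x) + (?f * conormal Du x + E * principal DDu x)"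
    unfolding s1 s2 s3 s4 .
  have s5: "(\<Sum>i\<in>UNIV. a i n x * ((if i = n then ?f else 0) * u x)) = a n n x * (?f * u x)"
    by (rule trans[OF sum_UNIV_single[of n]]) simp_all
  have s6: "(\<Sum>i\<in>UNIV. a i n x * (E * Du i x)) = E * conormal Du x"
    unfolding conormal_def sum_distrib_left by (intro sum.cong refl) (simp add: mult_ac)
  have "conormal Dv x = (\<Sum>i\<in>UNIV. a i n x * ((if i = n then ?f else 0) * u x)) + (\<Sum>i\<in>UNIV. a i n x * (E * Du i x))"
    unfolding conormal_def Dv distrib_left sum.distrib ..
  then have c: "conormal Dv x = a n n x * (?f * u x) + E * conormal Du x" unfolding s5 s6 .
  show ?thesis unfolding p c by (simp add: algebra_simps power2_eq_square)
qed

text \<open>The weight is moved into \<open>v = E u\<close>, the square of the conjugated operator is bounded below by the cross terms, and these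
  by the three weighted estimates. The constant arises on the way back from \<open>v\<close> to \<open>u\<close>, as
  \<open>E u\<^sub>i = v\<^sub>i - \<delta>\<^sub>i\<^sub>n lam w v\<close>.\<close>

lemma carleman_large_parameter:
  fixes \<phi> :: "real \<Rightarrow> real"
  assumes u: "carleman_admissible R n u Du DDu"
    and phi: "\<And>t. - R \<le> t \<Longrightarrow> t \<le> R \<Longrightarrow> (\<phi> has_real_derivative w t) (at t)"
    and lam: "1 \<le> lam" and d0: "0 < d1" "0 < d2"
    and d1: "\<And>t. - R \<le> t \<Longrightarrow> t \<le> R \<Longrightarrow> d1 \<le> w t" and d2: "\<And>t. - R \<le> t \<Longrightarrow> t \<le> R \<Longrightarrow> d2 \<le> w' t"
    and W0: "\<And>t. - R \<le> t \<Longrightarrow> t \<le> R \<Longrightarrow> w t \<le> W0"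
    and dom: "\<And>t. - R \<le> t \<Longrightarrow> t \<le> R \<Longrightarrow> 12 * M\<^sup>2 * (real CARD('n))\<^sup>2 * w t \<le> \<mu>\<^sup>2 * w' t"
    and H1: "8 * (real CARD('n) ^ 3 * ((W2 + 2 * W1) * M\<^sup>2)\<^sup>2 / (\<mu>\<^sup>2 * d2 / 4)) \<le> lam * (\<mu>\<^sup>2 * d1\<^sup>2 * d2)"
    and H2: "4 * (W1\<^sup>2 * M\<^sup>2) \<le> lam * (\<mu>\<^sup>2 * d1\<^sup>2 * d2)"
  shows "\<mu>\<^sup>2 / (2 * (2 / d2 + (2 * W0\<^sup>2 + 1) / (d1\<^sup>2 * d2))) * lam *
      (LINT x|leb R. (grad2 Du x + lam\<^sup>2 * (u x)\<^sup>2) * exp (2 * lam * \<phi> (x $ n)))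
    \<le> (LINT x|leb R. (principal DDu x)\<^sup>2 * exp (2 * lam * \<phi> (x $ n)))"
proof -
  define E where "E x = exp (lam * \<phi> (x $ n))" for x :: "real ^ 'n"
  \<comment> \<open>the derivatives of \<open>E\<close> in the form of functions that are themselves regular up to the boundary\<close>
  define e where "e i x = (if i = n then lam * w (x $ n) * E x else 0)" for i :: 'n and x :: "real ^ 'n"
  have dE: "((\<lambda>t. exp (lam * \<phi> t)) has_real_derivative lam * w t * exp (lam * \<phi> t)) (at t)" if "- R \<le> t" "t \<le> R" for t
    using phi[OF that] by (auto intro!: derivative_eq_intros)
  have w_cont: "continuous_on {- R..R} w"
    by (intro continuous_at_imp_continuous_on ballI DERIV_isCont[OF w_deriv]) auto
  have phi_cont: "continuous_on {- R..R} \<phi>"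
    by (intro continuous_at_imp_continuous_on ballI DERIV_isCont[OF phi]) auto
  have E_C1: "C1 R E"
    unfolding E_def[abs_def]
  proof (rule C1_closure_comp_coordinate[where h="\<lambda>t. exp (lam * \<phi> t)" and h'="\<lambda>t. lam * w t * exp (lam * \<phi> t)"])
    show "((\<lambda>t. exp (lam * \<phi> t)) has_real_derivative lam * w (x $ n) * exp (lam * \<phi> (x $ n))) (at (x $ n))"
      if "x \<in> closure (cube R)" for x :: "real ^ 'n" using coordinate_range[OF that] by (intro dE) auto
    show "continuous_on ((\<lambda>x. x $ n) ` closure (cube R :: (real ^ 'n) set)) (\<lambda>t. lam * w t * exp (lam * \<phi> t))"
      by (rule continuous_on_subset[OF _ coordinate_image]) (intro continuous_intros w_cont phi_cont)
  qed
  have f_C1: "C1 R (\<lambda>x. lam * w (x $ n) * E x)"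
    by (intro C1_closure_mult C1_closure_const w_C1 E_C1)
  have e_C1: "C1 R (e i)" for i
    using f_C1 by (cases "i = n") (simp_all add: e_def[abs_def])
  have pE: "partial i E x = e i x" if "x \<in> cube R" for i x
  proof -
    have "partial i (\<lambda>x. exp (lam * \<phi> (x $ n))) x = (if i = n then lam * w (x $ n) * exp (lam * \<phi> (x $ n)) else 0)"
      by (rule partial_comp_coordinate[where h="\<lambda>t. exp (lam * \<phi> t)"]) (intro dE coordinate_range' that)
    then show ?thesis by (simp add: E_def[abs_def] e_def)
  qed
  have pe: "partial j (e i) x = (if i = n \<and> j = n then (lam * w' (x $ n) + lam\<^sup>2 * (w (x $ n))\<^sup>2) * E x else 0)" if x: "x \<in> cube R" for i j x
  proof (cases "i = n")
    case True
    have "partial j (\<lambda>x. lam * w (x $ n) * E x) x = partial j (\<lambda>x. lam * w (x $ n)) x * E x + lam * w (x $ n) * partial j E x"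
      by (intro partial_mult_C1 x C1_closure_mult C1_closure_const w_C1 E_C1)
    also have "partial j (\<lambda>x. lam * w (x $ n)) x = partial j (\<lambda>x. lam) x * w (x $ n) + lam * partial j (\<lambda>x. w (x $ n)) x"
      by (intro partial_mult_C1 x C1_closure_const w_C1)
    finally show ?thesis using True
      by (simp add: e_def[abs_def] pE[OF x] partial_w[OF x] power2_eq_square algebra_simps)
  next
    case False
    then have "e i = (\<lambda>x. 0)" by (auto simp: e_def)
    then show ?thesis using False by simp
  qed
  define v where "v x = E x * u x" for x
  define Dv where "Dv i x = e i x * u x + E x * Du i x" for i x
  define DDv where "DDv i j x = (partial j (e i) x * u x + e i x * Du j x) + (e j x * Du i x + E x * DDu i j x)" for i j x
  have v: "carleman_admissible R n v Dv DDv"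
    unfolding v_def[abs_def] Dv_def[abs_def] DDv_def[abs_def]
    by (rule carleman_admissible_mult[OF u R E_C1 e_C1 pE]) (simp_all add: pe conj_commute)
  note L2v = principal_L2[OF v] conormal_L2[OF v] L2s(1)[OF v]
  have F: "E x * principal DDu x = principal DDv x - 2 * lam * w (x $ n) * conormal Dv x
      + (lam\<^sup>2 * (w (x $ n))\<^sup>2 - lam * w' (x $ n)) * (a n n x * v x)" if x: "x \<in> cube R" for x
    unfolding v_def
    by (rule conjugated_operator[where Du=Du and DDu=DDu, OF x]) (simp_all only: Dv_def DDv_def pe[OF x] e_def)
  let ?N = "real CARD('n)"
  \<comment> \<open>the gradient error \<open>2 * lam * \<epsilon>\<close> is half of the available \<open>lam * \<mu>\<^sup>2 * d2\<close>\<close>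
  define \<epsilon> where "\<epsilon> = \<mu>\<^sup>2 * d2 / 4"
  have eps: "0 < \<epsilon>" using mu d0 by (simp add: \<epsilon>_def)
  define X where "X = ?N ^ 3 * ((W2 + 2 * W1) * M\<^sup>2)\<^sup>2 / \<epsilon>"
  let ?i1 = "\<lambda>x. w (x $ n) * (principal DDv x * conormal Dv x)"
  let ?i2 = "\<lambda>x. w' (x $ n) * a n n x * (principal DDv x * v x)"
  let ?i3 = "\<lambda>x. w (x $ n) ^ 3 * a n n x * (conormal Dv x * v x)"
  let ?i4 = "\<lambda>x. (w (x $ n))\<^sup>2 * w' (x $ n) * (a n n x)\<^sup>2 * (v x)\<^sup>2"
  let ?i5 = "\<lambda>x. (w' (x $ n))\<^sup>2 * (a n n x)\<^sup>2 * (v x)\<^sup>2"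
  let ?j1 = "\<lambda>x. - (w' (x $ n) * (conormal Dv x * conormal Dv x))
        + w' (x $ n) * (a n n x * energy Dv x) / 2 + 3 * M\<^sup>2 * ?N\<^sup>2 * (w (x $ n) * grad2 Dv x)"
  let ?j2 = "\<lambda>x. - (w' (x $ n) * (a n n x * energy Dv x)) + (\<epsilon> * grad2 Dv x + X * (v x)\<^sup>2) / 2"
  let ?j3 = "\<lambda>x. (- (3 / 2) * ((w (x $ n))\<^sup>2 * w' (x $ n) * (a n n x)\<^sup>2) + M\<^sup>2 * ?N * w (x $ n) ^ 3) * (v x)\<^sup>2"
  note C1s = C1_closure_add C1_closure_mult C1_closure_power C1_closure_const w_C1 w'_C1 a_C1
  have int: "integrable (leb R) ?i1" "integrable (leb R) ?i2"
    "integrable (leb R) ?i3" "integrable (leb R) ?i4" "integrable (leb R) ?i5"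
    by (intro C1_mult_integrable C1s L2_integrable_mult L2v v2_integrable[OF v])+
  have j1: "integrable (leb R) ?j1" 
    by (intro Bochner_Integration.integrable_add Bochner_Integration.integrable_minus integrable_divide integrable_mult_right
          C1_mult_integrable w_C1 w'_C1 a_C1 L2_integrable_mult L2v energy_integrable[OF v] grad2_integrable[OF v])
  have j2: "integrable (leb R) ?j2" 
    by (intro Bochner_Integration.integrable_add Bochner_Integration.integrable_minus integrable_divide integrable_mult_right
          C1_mult_integrable w'_C1 a_C1 energy_integrable[OF v] grad2_integrable[OF v] v2_integrable[OF v])
  have j3: "integrable (leb R) ?j3" 
    by (intro C1_mult_integrable C1s v2_integrable[OF v])
  have le1: "integral\<^sup>L (leb R) ?i1 \<le> integral\<^sup>L (leb R) ?j1"
    by (rule weighted_conormal_estimate[OF v])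
  have le2: "integral\<^sup>L (leb R) ?i2 \<le> integral\<^sup>L (leb R) ?j2"
    unfolding X_def by (rule weighted_potential_estimate[OF v eps])
  have le3: "integral\<^sup>L (leb R) ?i3 \<le> integral\<^sup>L (leb R) ?j3"
    by (rule weighted_transport_estimate[OF v])
  \<comment> \<open>chosen such that \<open>C * d2\<close> and \<open>C * (d1\<^sup>2 * d2)\<close> exceed the constants that appear when \<open>v\<close> is replaced by \<open>u\<close>\<close>
  define C where "C = 2 / d2 + (2 * W0\<^sup>2 + 1) / (d1\<^sup>2 * d2)"
  have C: "0 < C" using d0 by (simp add: C_def add_pos_pos add_nonneg_pos)
  have Cd: "2 \<le> C * d2" "2 * W0\<^sup>2 + 1 \<le> C * (d1\<^sup>2 * d2)"
  proof -
    have "C * d2 = 2 + (2 * W0\<^sup>2 + 1) / d1\<^sup>2" using d0 by (simp add: C_def field_simps)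
    then show "2 \<le> C * d2" by simp
    have "C * (d1\<^sup>2 * d2) = 2 * d1\<^sup>2 + (2 * W0\<^sup>2 + 1)" using d0 by (simp add: C_def field_simps)
    then show "2 * W0\<^sup>2 + 1 \<le> C * (d1\<^sup>2 * d2)" by simp
  qed
  have E2: "exp (2 * lam * \<phi> (x $ n)) = (E x)\<^sup>2" for x :: "real ^ 'n"
    by (simp add: E_def power2_eq_square exp_add[symmetric])
  have E2_C1: "C1 R (\<lambda>x. (E x)\<^sup>2)" by (intro C1_closure_power E_C1)
  have undo_weight: "(grad2 Du x + lam\<^sup>2 * (u x)\<^sup>2) * (E x)\<^sup>2 \<le> C * (d2 * grad2 Dv x + lam\<^sup>2 * (d1\<^sup>2 * d2 * (v x)\<^sup>2))"
    if x: "x \<in> cube R" for x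
  proof -
    have "(E x * Du i x)\<^sup>2 \<le> 2 * (Dv i x)\<^sup>2 + (if i = n then 2 * lam\<^sup>2 * (w (x $ n))\<^sup>2 * (v x)\<^sup>2 else 0)" for i
    proof -
      have sq: "(r - s)\<^sup>2 \<le> 2 * r\<^sup>2 + 2 * s\<^sup>2" for r s :: real
        using zero_le_power2[of "r + s"] by (simp add: power2_eq_square algebra_simps)
      have "E x * Du i x = Dv i x - (if i = n then lam * w (x $ n) * v x else 0)" by (simp add: Dv_def e_def v_def)
      then show ?thesis using sq[of "Dv i x" "if i = n then lam * w (x $ n) * v x else 0"]
        by (simp add: power_mult_distrib split: if_splits)
    qed
    then have "(\<Sum>i\<in>UNIV. (E x * Du i x)\<^sup>2) \<le> (\<Sum>i\<in>UNIV. 2 * (Dv i x)\<^sup>2 + (if i = n then 2 * lam\<^sup>2 * (w (x $ n))\<^sup>2 * (v x)\<^sup>2 else 0))"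
      by (intro sum_mono)
    then have g: "(E x)\<^sup>2 * grad2 Du x \<le> 2 * grad2 Dv x + 2 * lam\<^sup>2 * (w (x $ n))\<^sup>2 * (v x)\<^sup>2"
      by (simp add: grad2_def sum.distrib sum_distrib_left power_mult_distrib)
    have "(w (x $ n))\<^sup>2 \<le> W0\<^sup>2"
      using W0 w_pos coordinate_range'[OF x] by (intro power_mono) (auto simp: less_imp_le)
    then have "2 * lam\<^sup>2 * (w (x $ n))\<^sup>2 * (v x)\<^sup>2 \<le> 2 * lam\<^sup>2 * W0\<^sup>2 * (v x)\<^sup>2"
      by (intro mult_right_mono mult_left_mono) auto
    with g have "(grad2 Du x + lam\<^sup>2 * (u x)\<^sup>2) * (E x)\<^sup>2 \<le> 2 * grad2 Dv x + (2 * W0\<^sup>2 + 1) * (lam\<^sup>2 * (v x)\<^sup>2)"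
      by (simp add: v_def power_mult_distrib algebra_simps)
    also have "\<dots> \<le> C * d2 * grad2 Dv x + C * (d1\<^sup>2 * d2) * (lam\<^sup>2 * (v x)\<^sup>2)"
      using Cd by (intro add_mono mult_right_mono grad2_nonneg) auto
    finally show ?thesis by (simp add: algebra_simps)
  qed
  have intF: "integrable (leb R) (\<lambda>x. (E x * principal DDu x)\<^sup>2)"
    by (intro L2_integrable_square C1_closure_mult_L2 E_C1 principal_L2[OF u])
  have intT: "integrable (leb R) (\<lambda>x. (grad2 Du x + lam\<^sup>2 * (u x)\<^sup>2) * (E x)\<^sup>2)"
    unfolding mult.commute[of _ "(E _)\<^sup>2"]
    by (intro C1_mult_integrable[OF E2_C1] Bochner_Integration.integrable_add integrable_mult_right grad2_integrable[OF u] v2_integrable[OF u])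
  have "\<mu>\<^sup>2 / (2 * C) * lam * (LINT x|leb R. (grad2 Du x + lam\<^sup>2 * (u x)\<^sup>2) * (E x)\<^sup>2)
     = (LINT x|leb R. \<mu>\<^sup>2 / (2 * C) * lam * ((grad2 Du x + lam\<^sup>2 * (u x)\<^sup>2) * (E x)\<^sup>2))" by simp
  also have "\<dots> \<le> (LINT x|leb R. - 4 * lam * ?j1 x - 4 * lam * ?j2 x - 4 * lam^3 * ?j3 x - 4 * lam^3 * ?i4 x - lam\<^sup>2 * ?i5 x)"
  proof (rule integral_mono)
    show "integrable (leb R) (\<lambda>x. \<mu>\<^sup>2 / (2 * C) * lam * ((grad2 Du x + lam\<^sup>2 * (u x)\<^sup>2) * (E x)\<^sup>2))"
      by (intro integrable_mult_right intT)
    show "integrable (leb R) (\<lambda>x. - 4 * lam * ?j1 x - 4 * lam * ?j2 x - 4 * lam^3 * ?j3 x - 4 * lam^3 * ?i4 x - lam\<^sup>2 * ?i5 x)"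
      by (intro Bochner_Integration.integrable_diff integrable_mult_right j1 j2 j3 int)
    fix x :: "real ^ 'n" assume "x \<in> space (leb R)"
    then have x: "x \<in> cube R" by simp
    note t = coordinate_range'[OF x]
    have N1: "1 \<le> ?N" using zero_less_card_finite[where 'a='n] by linarith
    have "\<mu>\<^sup>2 / (2 * C) * lam * ((grad2 Du x + lam\<^sup>2 * (u x)\<^sup>2) * (E x)\<^sup>2)
      \<le> \<mu>\<^sup>2 / (2 * C) * lam * (C * (d2 * grad2 Dv x + lam\<^sup>2 * (d1\<^sup>2 * d2 * (v x)\<^sup>2)))"
      using C lam by (intro mult_left_mono undo_weight x) auto
    also have "\<dots> = \<mu>\<^sup>2 / 2 * lam * (d2 * grad2 Dv x + lam\<^sup>2 * (d1\<^sup>2 * d2 * (v x)\<^sup>2))"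
      using C by (simp add: field_simps)
    also have "\<dots> \<le> - 4 * lam * ?j1 x - 4 * lam * ?j2 x - 4 * lam^3 * ?j3 x - 4 * lam^3 * ?i4 x - lam\<^sup>2 * ?i5 x"
    proof (rule estimate_of_quadratic_terms[OF lam mu ann_lower[OF x] _ energy_lower[OF x] grad2_nonneg
          d0(1) d1[OF t] d0(2) d2[OF t] _ N1 dom[OF t] \<epsilon>_def _ H2])
      show "a n n x \<le> M" using a_bound[OF x, of n n] by linarith
      show "w' (x $ n) \<le> W1" using w'_bound[OF t] by linarith
      show "8 * X \<le> lam * (\<mu>\<^sup>2 * d1\<^sup>2 * d2)" using H1 by (simp add: X_def \<epsilon>_def)
    qed
    finally show "\<mu>\<^sup>2 / (2 * C) * lam * ((grad2 Du x + lam\<^sup>2 * (u x)\<^sup>2) * (E x)\<^sup>2)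
      \<le> - 4 * lam * ?j1 x - 4 * lam * ?j2 x - 4 * lam^3 * ?j3 x - 4 * lam^3 * ?i4 x - lam\<^sup>2 * ?i5 x" .
  qed
  also have "\<dots> = - 4 * lam * integral\<^sup>L (leb R) ?j1 - 4 * lam * integral\<^sup>L (leb R) ?j2
      - 4 * lam^3 * integral\<^sup>L (leb R) ?j3 - 4 * lam^3 * integral\<^sup>L (leb R) ?i4
      - lam\<^sup>2 * integral\<^sup>L (leb R) ?i5"
    by (simp only: Bochner_Integration.integral_diff Bochner_Integration.integrable_diff integrable_mult_right
      integral_mult_right_zero j1 j2 j3 int)
  also have "\<dots> \<le> - 4 * lam * integral\<^sup>L (leb R) ?i1 - 4 * lam * integral\<^sup>L (leb R) ?i2
      - 4 * lam^3 * integral\<^sup>L (leb R) ?i3 - 4 * lam^3 * integral\<^sup>L (leb R) ?i4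
      - lam\<^sup>2 * integral\<^sup>L (leb R) ?i5"
    using lam by (intro diff_right_mono diff_mono mult_left_mono_neg le1 le2 le3 order_refl mult_left_mono) auto
  also have "\<dots> = (LINT x|leb R. - 4 * lam * ?i1 x - 4 * lam * ?i2 x - 4 * lam^3 * ?i3 x - 4 * lam^3 * ?i4 x - lam\<^sup>2 * ?i5 x)"
    by (simp only: Bochner_Integration.integral_diff Bochner_Integration.integrable_diff integrable_mult_right
      integral_mult_right_zero int)
  also have "\<dots> \<le> (LINT x|leb R. (E x * principal DDu x)\<^sup>2)"
  proof (rule integral_mono[OF _ intF])
    show "integrable (leb R) (\<lambda>x. - 4 * lam * ?i1 x - 4 * lam * ?i2 x - 4 * lam^3 * ?i3 x - 4 * lam^3 * ?i4 x - lam\<^sup>2 * ?i5 x)"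
      by (intro Bochner_Integration.integrable_diff integrable_mult_right int)
    fix x :: "real ^ 'n" assume "x \<in> space (leb R)"
    then have x: "x \<in> cube R" by simp
    show "- 4 * lam * ?i1 x - 4 * lam * ?i2 x - 4 * lam^3 * ?i3 x - 4 * lam^3 * ?i4 x - lam\<^sup>2 * ?i5 x \<le> (E x * principal DDu x)\<^sup>2"
      by (rule cross_term_le_square[OF F[OF x]])
  qed
  also have "\<dots> = (LINT x|leb R. (principal DDu x)\<^sup>2 * (E x)\<^sup>2)"
    by (simp add: power_mult_distrib mult.commute)
  finally show ?thesis unfolding E2 C_def .
qed

end

lemma C1_norm_bounds:
  fixes f :: "real ^ 'n::finite \<Rightarrow> real"
  assumes f: "C1 R f" and R: "0 < R" and x: "x \<in> cube R"
  shows "\<bar>f x\<bar> \<le> C1_norm (cube R) f" "\<bar>partial k f x\<bar> \<le> C1_norm (cube R) f"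
proof -
  obtain K where K: "\<And>x. x \<in> closure (cube R) \<Longrightarrow> \<bar>f x\<bar> \<le> K" "\<And>x i. x \<in> cube R \<Longrightarrow> \<bar>partial i f x\<bar> \<le> K"
    using C1_closure_cube_bounded[OF f] by metis
  have xc: "x \<in> closure (cube R)" using x closure_subset by blast
  have s: "\<bar>f x\<bar> \<le> (SUP x\<in>closure (cube R). \<bar>f x\<bar>)"
    by (rule cSUP_upper[OF xc]) (use K(1) in \<open>auto intro!: bdd_aboveI2[where M=K]\<close>)
  have p: "\<bar>partial i f x\<bar> \<le> (SUP x\<in>cube R. \<bar>partial i f x\<bar>)" for i
    by (rule cSUP_upper[OF x]) (use K(2) in \<open>auto intro!: bdd_aboveI2[where M=K]\<close>)
  have p0: "0 \<le> (SUP x\<in>cube R. \<bar>partial i f x\<bar>)" for i using order_trans[OF abs_ge_zero p] .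
  have "(SUP x\<in>cube R. \<bar>partial k f x\<bar>) \<le> (\<Sum>i\<in>UNIV. SUP x\<in>cube R. \<bar>partial i f x\<bar>)"
    by (rule member_le_sum) (auto intro: p0)
  moreover have "0 \<le> (\<Sum>i\<in>UNIV. SUP x\<in>cube R. \<bar>partial i f x\<bar>)" by (intro sum_nonneg p0)
  ultimately show "\<bar>f x\<bar> \<le> C1_norm (cube R) f" "\<bar>partial k f x\<bar> \<le> C1_norm (cube R) f"
    using s p[of k] abs_ge_zero[of "f x"] unfolding C1_norm_def by linarith+
qed

text \<open>The hypotheses on the coefficients, with their \<open>C\<^sup>1\<close> norms bounded by a number that is the same for all of them, so
  that the constants below can be chosen before the coefficients.\<close>

definition carleman_coefficient_bounds ::
  "real \<Rightarrow> real \<Rightarrow> real \<Rightarrow> 'n::finite \<Rightarrow> ('n \<Rightarrow> 'n \<Rightarrow> real ^ 'n \<Rightarrow> real) \<Rightarrow> bool" where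
  "carleman_coefficient_bounds \<mu> R M n a \<longleftrightarrow>
     (\<forall>x i j. a i j x = a j i x) \<and>
     (\<forall>x \<xi>. \<mu> * (norm \<xi>)\<^sup>2 \<le> (\<Sum>i\<in>UNIV. \<Sum>j\<in>UNIV. a i j x * \<xi> $ i * \<xi> $ j)) \<and>
     (\<forall>i j. C1 R (a i j) \<and> C1_norm (cube R) (a i j) \<le> M) \<and>
     (\<forall>x \<in> frontier (cube R) - {x. x $ n = R \<or> x $ n = - R}. \<forall>i. i \<noteq> n \<longrightarrow> a i n x = 0)"

lemma norm_vec_square: "(norm (\<xi> :: real ^ 'n::finite))\<^sup>2 = (\<Sum>i\<in>UNIV. (\<xi> $ i)\<^sup>2)"
  unfolding power2_norm_eq_inner inner_vec_def by (simp add: power2_eq_square)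

lemma powr_shift_derivative:
  assumes "0 < t + b"
  shows "((\<lambda>t. c * (t + b) powr r) has_real_derivative c * r * (t + b) powr (r - 1)) (at t)"
proof -
  have "((\<lambda>t. t + b) has_real_derivative 1) (at t)" by (auto intro!: derivative_eq_intros)
  from DERIV_chain2[OF has_real_derivative_powr[OF assms, of r] this]
  have "((\<lambda>t. (t + b) powr r) has_real_derivative r * (t + b) powr (r - 1) * 1) (at t)" .
  from DERIV_cmult[OF this, of c] show ?thesis by (simp add: mult.assoc)
qed

text \<open>The derivatives of \<open>(t + b)\<^sup>p\<close> are monotone for \<open>p \<ge> 3\<close>, so their bounds are their values at \<open>- R\<close> and \<open>R\<close>. The condition on
  \<open>p\<close> makes \<open>w'/w = (p - 1)/(t + b)\<close> large enough for the domination condition of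
  \<open>carleman_large_parameter\<close>. For \<open>lam < \<Lambda>\<close> the estimate for \<open>\<Lambda>\<close> is used and the weights are compared.\<close>

lemma carleman_estimate_power_weight:
  fixes \<mu> b p R M :: real
  assumes R: "0 < R" and b: "R < b" and mu: "0 < \<mu>"
    and p: "3 + (b + R) * (12 * M\<^sup>2 * (real CARD('n::finite))\<^sup>2 / \<mu>\<^sup>2) \<le> p"
  shows "\<exists>C>0. \<forall>(n :: 'n) a. carleman_coefficient_bounds \<mu> R M n a \<longrightarrow>
     (\<forall>lam\<ge>1. \<forall>u\<in>H2_0_sharp R n.
        C * lam * (LINT x|leb R.
            ((norm (weak_grad (cube R) u x))\<^sup>2 + lam\<^sup>2 * (u x)\<^sup>2) * exp (2 * lam * (x $ n + b) powr p))
        \<le> (LINT x|leb R. (L0 (cube R) a u x)\<^sup>2 * exp (2 * lam * (x $ n + b) powr p)))"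
proof -
  let ?N = "real CARD('n)"
  define w where "w t = p * (t + b) powr (p - 1)" for t
  define w' where "w' t = p * (p - 1) * (t + b) powr (p - 2)" for t
  define w'' where "w'' t = p * (p - 1) * (p - 2) * (t + b) powr (p - 3)" for t
  define W0 where "W0 = p * (b + R) powr (p - 1)"
  define W1 where "W1 = p * (p - 1) * (b + R) powr (p - 2)"
  define W2 where "W2 = p * (p - 1) * (p - 2) * (b + R) powr (p - 3)"
  define d1 where "d1 = p * (b - R) powr (p - 1)"
  define d2 where "d2 = p * (p - 1) * (b - R) powr (p - 2)"
  have bR: "0 < b + R" "0 < b - R" using R b by auto
  have "0 \<le> (b + R) * (12 * M\<^sup>2 * ?N\<^sup>2 / \<mu>\<^sup>2)" using bR by simp
  then have p3: "3 \<le> p" using p by linarith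
  have d: "0 < d1" "0 < d2" using p3 bR by (simp_all add: d1_def d2_def)
  have up: "(t + b) powr r \<le> (b + R) powr r" and lo: "(b - R) powr r \<le> (t + b) powr r"
    if "- R \<le> t" "t \<le> R" "0 \<le> r" for t r
    using that bR by (auto intro!: powr_mono2)
  have tb: "0 < t + b" if "- R \<le> t" for t using that bR by linarith
  have w_ge: "d1 \<le> w t" and w_le: "w t \<le> W0" and w'_ge: "d2 \<le> w' t" and w'_le: "w' t \<le> W1"
    and w''_le: "w'' t \<le> W2" and w''_ge: "0 \<le> w'' t" if "- R \<le> t" "t \<le> R" for t
    using up[OF that] lo[OF that] p3
    by (auto simp: w_def w'_def w''_def W0_def W1_def W2_def d1_def d2_def intro!: mult_left_mono)
  have dom: "12 * M\<^sup>2 * ?N\<^sup>2 * w t \<le> \<mu>\<^sup>2 * w' t" if t: "- R \<le> t" "t \<le> R" for t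
  proof -
    have "(b + R) * (12 * M\<^sup>2 * ?N\<^sup>2 / \<mu>\<^sup>2) \<le> p - 1" using p by linarith
    then have "(b + R) * (12 * M\<^sup>2 * ?N\<^sup>2) \<le> (p - 1) * \<mu>\<^sup>2" using mu by (simp add: field_simps)
    moreover have "(t + b) * (12 * M\<^sup>2 * ?N\<^sup>2) \<le> (b + R) * (12 * M\<^sup>2 * ?N\<^sup>2)" using t by (intro mult_right_mono) auto
    ultimately have "(t + b) * (12 * M\<^sup>2 * ?N\<^sup>2) \<le> (p - 1) * \<mu>\<^sup>2" by linarith
    then have "p * (t + b) powr (p - 2) * ((t + b) * (12 * M\<^sup>2 * ?N\<^sup>2)) \<le> p * (t + b) powr (p - 2) * ((p - 1) * \<mu>\<^sup>2)"
      using p3 by (intro mult_left_mono) auto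
    moreover have "(t + b) powr (p - 1) = (t + b) powr (p - 2) * (t + b)"
      using tb[OF t(1)] powr_add[of "t + b" "p - 2" 1] by simp
    ultimately show ?thesis by (simp add: w_def w'_def mult_ac)
  qed
  have deriv: "((\<lambda>t. (t + b) powr p) has_real_derivative w t) (at t)" "(w has_real_derivative w' t) (at t)"
    "(w' has_real_derivative w'' t) (at t)" if "- R \<le> t" "t \<le> R" for t
    using powr_shift_derivative[OF tb[OF that(1)], of 1 p] powr_shift_derivative[OF tb[OF that(1)], of p "p - 1"]
      powr_shift_derivative[OF tb[OF that(1)], of "p * (p - 1)" "p - 2"]
    by (simp_all add: w_def[abs_def] w'_def[abs_def] w''_def)
  have w''_cont: "continuous_on {- R..R} w''"
    unfolding w''_def[abs_def] using tb by (intro continuous_intros) force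
  define c where "c = \<mu>\<^sup>2 / (2 * (2 / d2 + (2 * W0\<^sup>2 + 1) / (d1\<^sup>2 * d2)))"
  define D where "D = \<mu>\<^sup>2 * d1\<^sup>2 * d2"
  define H where "H = 8 * (?N ^ 3 * ((W2 + 2 * W1) * M\<^sup>2)\<^sup>2 / (\<mu>\<^sup>2 * d2 / 4)) + 4 * (W1\<^sup>2 * M\<^sup>2)"
  \<comment> \<open>the sum \<open>H\<close> of the two quantities that have to be dominated by \<open>lam * D\<close>\<close>
  define \<Lambda> where "\<Lambda> = max 1 (H / D)"
  have D: "0 < D" using mu d by (simp add: D_def)
  have "0 < 2 / d2 + (2 * W0\<^sup>2 + 1) / (d1\<^sup>2 * d2)" using d by (intro add_pos_nonneg) auto
  then have c: "0 < c" unfolding c_def using mu by (intro divide_pos_pos mult_pos_pos) auto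
  have \<Lambda>1: "1 \<le> \<Lambda>" by (simp add: \<Lambda>_def)
  have H_le: "H \<le> lam * D" if "\<Lambda> \<le> lam" for lam
    using that D by (simp add: \<Lambda>_def pos_divide_le_eq)
  define \<Phi> where "\<Phi> = (b + R) powr p"
  define C where "C = c * exp (- (2 * \<Lambda> * \<Phi>))"
  have "C * lam * (LINT x|leb R.
            ((norm (weak_grad (cube R) u x))\<^sup>2 + lam\<^sup>2 * (u x)\<^sup>2) * exp (2 * lam * (x $ n + b) powr p))
        \<le> (LINT x|leb R. (L0 (cube R) a u x)\<^sup>2 * exp (2 * lam * (x $ n + b) powr p))"
    if coeff: "carleman_coefficient_bounds \<mu> R M n a" and lam: "1 \<le> lam" and u: "u \<in> H2_0_sharp R n"
    for n :: 'n and a lam u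
  proof -
    interpret carleman_setting R n a \<mu> M w w' w'' W1 W2
    proof
      show "0 < R" "0 < \<mu>" by (fact R mu)+
      show "C1 R (a i j)" "a i j x = a j i x" for i j x
        using coeff by (auto simp: carleman_coefficient_bounds_def)
      show "a j n x = 0" if "j \<noteq> n" "s \<in> {R, - R}" "x \<in> open_face R j s" for j s x
      proof -
        have "x \<in> frontier (cube R)" using open_face_subset_frontier[OF R that(2)] that(3) by blast
        moreover have "- R < x $ n" "x $ n < R" using that(1,3) by (auto simp: open_face_def)
        ultimately show ?thesis using coeff that(1) by (auto simp: carleman_coefficient_bounds_def)
      qed
      show "\<mu> * (\<Sum>i\<in>UNIV. (\<xi> i)\<^sup>2) \<le> (\<Sum>k\<in>UNIV. \<Sum>l\<in>UNIV. a k l x * (\<xi> k * \<xi> l))" for x \<xi>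
      proof -
        have "\<forall>\<xi>. \<mu> * (norm \<xi>)\<^sup>2 \<le> (\<Sum>i\<in>UNIV. \<Sum>j\<in>UNIV. a i j x * \<xi> $ i * \<xi> $ j)"
          using coeff by (simp add: carleman_coefficient_bounds_def)
        from spec[OF this, of "\<chi> i. \<xi> i"] show ?thesis by (simp add: norm_vec_square mult.assoc)
      qed
      show "\<bar>a i j x\<bar> \<le> M" "\<bar>partial k (a i j) x\<bar> \<le> M" if "x \<in> cube R" for i j k x
      proof -
        have a: "C1 R (a i j)" "C1_norm (cube R) (a i j) \<le> M"
          using coeff by (auto simp: carleman_coefficient_bounds_def)
        show "\<bar>a i j x\<bar> \<le> M" "\<bar>partial k (a i j) x\<bar> \<le> M"
          using C1_norm_bounds[OF a(1) R that] a(2) by (meson order_trans)+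
      qed
      show "0 < w t" if "- R \<le> t" "t \<le> R" for t using w_ge[OF that] d by linarith
      show "\<bar>w' t\<bar> \<le> W1" "\<bar>w'' t\<bar> \<le> W2" if "- R \<le> t" "t \<le> R" for t
        using w'_ge[OF that] w'_le[OF that] w''_ge[OF that] w''_le[OF that] d by linarith+
    qed (fact deriv w''_cont)+
    let ?Du = "\<lambda>i. weak_partial (cube R) i u" and ?DDu = "\<lambda>i j. weak_partial (cube R) j (weak_partial (cube R) i u)"
    let ?\<phi> = "\<lambda>x :: real ^ 'n. (x $ n + b) powr p"
    have adm: "carleman_admissible R n u ?Du ?DDu" by (rule H2_0_sharp_admissible[OF u R])
    have L0: "L0 (cube R) a u x = principal ?DDu x" for x by (simp add: L0_def principal_def)
    have grad: "(norm (weak_grad (cube R) u x))\<^sup>2 = grad2 ?Du x" for x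
      by (simp add: norm_vec_square weak_grad_def grad2_def)
    let ?rhs = "\<lambda>lam. LINT x|leb R. (principal ?DDu x)\<^sup>2 * exp (2 * lam * ?\<phi> x)"
    let ?lhs = "\<lambda>lam. LINT x|leb R. (grad2 ?Du x + lam\<^sup>2 * (u x)\<^sup>2) * exp (2 * lam * ?\<phi> x)"
    have large: "c * lam * ?lhs lam \<le> ?rhs lam" if "\<Lambda> \<le> lam" for lam
      unfolding c_def
    proof (rule carleman_large_parameter[where \<phi>="\<lambda>t. (t + b) powr p", OF adm deriv(1) _ d w_ge w'_ge w_le dom])
      show "1 \<le> lam" using that \<Lambda>1 by linarith
      have "0 \<le> 8 * (?N ^ 3 * ((W2 + 2 * W1) * M\<^sup>2)\<^sup>2 / (\<mu>\<^sup>2 * d2 / 4))" "0 \<le> 4 * (W1\<^sup>2 * M\<^sup>2)"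
        using d mu by simp_all
      then show "8 * (?N ^ 3 * ((W2 + 2 * W1) * M\<^sup>2)\<^sup>2 / (\<mu>\<^sup>2 * d2 / 4)) \<le> lam * (\<mu>\<^sup>2 * d1\<^sup>2 * d2)"
        "4 * (W1\<^sup>2 * M\<^sup>2) \<le> lam * (\<mu>\<^sup>2 * d1\<^sup>2 * d2)"
        using H_le[OF that] unfolding H_def D_def by linarith+
    qed
    have lhs_nonneg: "0 \<le> ?lhs lam" for lam by (intro Bochner_Integration.integral_nonneg) (simp add: grad2_nonneg)
    have weight_C1: "C1 R (\<lambda>x. exp (2 * lam * ?\<phi> x))" for lam
    proof (rule C1_closure_comp_coordinate[where h="\<lambda>t. exp (2 * lam * (t + b) powr p)" and h'="\<lambda>t. 2 * lam * w t * exp (2 * lam * (t + b) powr p)"])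
      show "((\<lambda>t. exp (2 * lam * (t + b) powr p)) has_real_derivative 2 * lam * w (x $ n) * exp (2 * lam * (x $ n + b) powr p)) (at (x $ n))"
        if "x \<in> closure (cube R)" for x :: "real ^ 'n"
        using DERIV_fun_exp[OF DERIV_cmult[OF deriv(1), of "x $ n" "2 * lam"]] coordinate_range[OF that]
        by (simp add: mult_ac)
      have "continuous_on {- R..R} w" "continuous_on {- R..R} (\<lambda>t. (t + b) powr p)"
        using deriv(1,2) by (auto intro!: continuous_at_imp_continuous_on DERIV_isCont)
      then show "continuous_on ((\<lambda>x. x $ n) ` closure (cube R :: (real ^ 'n) set)) (\<lambda>t. 2 * lam * w t * exp (2 * lam * (t + b) powr p))"
        by (intro continuous_on_subset[OF _ coordinate_image] continuous_on_mult continuous_on_exp continuous_on_const)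
    qed
    have int_r: "integrable (leb R) (\<lambda>x. (principal ?DDu x)\<^sup>2 * exp (2 * lam * ?\<phi> x))" for lam
      unfolding mult.commute[of _ "exp _"]
      by (intro C1_mult_integrable weight_C1 L2_integrable_square principal_L2[OF adm])
    have int_l: "integrable (leb R) (\<lambda>x. (grad2 ?Du x + lam\<^sup>2 * (u x)\<^sup>2) * exp (2 * lam' * ?\<phi> x))" for lam lam'
      unfolding mult.commute[of _ "exp _"]
      by (intro C1_mult_integrable weight_C1 Bochner_Integration.integrable_add integrable_mult_right
          grad2_integrable[OF adm] v2_integrable[OF adm])
    have "C * lam * ?lhs lam \<le> ?rhs lam"
    proof (cases "\<Lambda> \<le> lam")
      case True
      have "exp (- (2 * \<Lambda> * \<Phi>)) \<le> 1" using \<Lambda>1 by (simp add: \<Phi>_def)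
      then have "C \<le> c" using c by (simp add: C_def mult_left_le)
      then have "C * lam * ?lhs lam \<le> c * lam * ?lhs lam" using lam by (intro mult_right_mono lhs_nonneg) auto
      also have "\<dots> \<le> ?rhs lam" by (rule large[OF True])
      finally show ?thesis .
    next
      case False
      have \<phi>: "0 \<le> ?\<phi> x" "?\<phi> x \<le> \<Phi>" if "x \<in> cube R" for x
        using up[OF coordinate_range'[OF that], of p] p3 by (simp_all add: \<Phi>_def)
      have "lam * ?lhs lam \<le> \<Lambda> * ?lhs \<Lambda>"
      proof (rule mult_mono[OF _ integral_mono[OF int_l int_l] _ lhs_nonneg])
        fix x :: "real ^ 'n" assume "x \<in> space (leb R)"
        then have x: "x \<in> cube R" by simp
        have "lam\<^sup>2 \<le> \<Lambda>\<^sup>2" "2 * lam * ?\<phi> x \<le> 2 * \<Lambda> * ?\<phi> x"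
          using False lam \<phi>(1)[OF x] by (auto intro!: power_mono mult_right_mono)
        then show "(grad2 ?Du x + lam\<^sup>2 * (u x)\<^sup>2) * exp (2 * lam * ?\<phi> x)
            \<le> (grad2 ?Du x + \<Lambda>\<^sup>2 * (u x)\<^sup>2) * exp (2 * \<Lambda> * ?\<phi> x)"
          by (intro mult_mono add_mono mult_right_mono) (auto simp: grad2_nonneg)
      qed (use False \<Lambda>1 in auto)
      then have "C * (lam * ?lhs lam) \<le> C * (\<Lambda> * ?lhs \<Lambda>)" using c by (intro mult_left_mono) (auto simp: C_def)
      also have "\<dots> = exp (- (2 * \<Lambda> * \<Phi>)) * (c * \<Lambda> * ?lhs \<Lambda>)" by (simp add: C_def)
      also have "\<dots> \<le> exp (- (2 * \<Lambda> * \<Phi>)) * ?rhs \<Lambda>" by (intro mult_left_mono large) auto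
      also have "\<dots> = (LINT x|leb R. exp (- (2 * \<Lambda> * \<Phi>)) * ((principal ?DDu x)\<^sup>2 * exp (2 * \<Lambda> * ?\<phi> x)))" by simp
      also have "\<dots> \<le> ?rhs lam"
      proof (rule integral_mono[OF integrable_mult_right[OF int_r] int_r])
        fix x :: "real ^ 'n" assume "x \<in> space (leb R)"
        then have x: "x \<in> cube R" by simp
        have "\<Lambda> * ?\<phi> x \<le> \<Lambda> * \<Phi>" "0 \<le> lam * ?\<phi> x" using \<phi>[OF x] \<Lambda>1 lam by (auto intro!: mult_left_mono)
        then have "exp (- (2 * \<Lambda> * \<Phi>)) * exp (2 * \<Lambda> * ?\<phi> x) \<le> exp (2 * lam * ?\<phi> x)"
          by (simp add: exp_add[symmetric])
        from mult_left_mono[OF this, of "(principal ?DDu x)\<^sup>2"]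
        show "exp (- (2 * \<Lambda> * \<Phi>)) * ((principal ?DDu x)\<^sup>2 * exp (2 * \<Lambda> * ?\<phi> x)) \<le> (principal ?DDu x)\<^sup>2 * exp (2 * lam * ?\<phi> x)"
          by (simp add: mult_ac)
      qed
      finally show ?thesis by (simp add: mult.assoc)
    qed
    then show ?thesis unfolding L0 grad .
  qed
  moreover have "0 < C" using c by (simp add: C_def)
  ultimately show ?thesis by blast
qed

theorem theorem4p1:
  "\<exists>(p\<^sub>0 :: real \<Rightarrow> real \<Rightarrow> real \<Rightarrow> real \<Rightarrow> real \<Rightarrow> real)
    (lam\<^sub>0 :: real \<Rightarrow> real \<Rightarrow> real \<Rightarrow> real \<Rightarrow> real \<Rightarrow> real)
    (C\<^sub>2 :: real \<Rightarrow> real \<Rightarrow> real \<Rightarrow> real \<Rightarrow> real \<Rightarrow> real \<Rightarrow> real).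
   \<forall>(\<mu>\<^sub>1 :: real) (\<mu>\<^sub>2 :: real) (b :: real) (R :: real) (M :: real)
    (n :: 'n::finite) (a :: 'n \<Rightarrow> 'n \<Rightarrow> real ^ 'n \<Rightarrow> real).
     1 \<le> R \<and> R < b \<and> 0 < \<mu>\<^sub>1 \<and> \<mu>\<^sub>1 \<le> \<mu>\<^sub>2 \<and>
     (\<forall>x i j. a i j x = a j i x) \<and>
     (\<forall>x \<xi>. \<mu>\<^sub>1 * (norm \<xi>)\<^sup>2 \<le> (\<Sum>i\<in>UNIV. \<Sum>j\<in>UNIV. a i j x * \<xi> $ i * \<xi> $ j) \<and>
            (\<Sum>i\<in>UNIV. \<Sum>j\<in>UNIV. a i j x * \<xi> $ i * \<xi> $ j) \<le> \<mu>\<^sub>2 * (norm \<xi>)\<^sup>2) \<and>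
     (\<forall>i j. C1_closure (cube R) (a i j)) \<and>
     (\<forall>x \<in> frontier (cube R) - {x. x $ n = R \<or> x $ n = - R}. \<forall>i. i \<noteq> n \<longrightarrow> a i n x = 0) \<and>
     M = Max (range (\<lambda>(i, j). C1_norm (cube R) (a i j)))
     \<longrightarrow>
     1 < p\<^sub>0 \<mu>\<^sub>1 \<mu>\<^sub>2 b R M \<and> 1 \<le> lam\<^sub>0 \<mu>\<^sub>1 \<mu>\<^sub>2 b R M \<and>
     (\<forall>p \<ge> p\<^sub>0 \<mu>\<^sub>1 \<mu>\<^sub>2 b R M.
        0 < C\<^sub>2 \<mu>\<^sub>1 \<mu>\<^sub>2 b p R M \<and>
        (\<forall>lam \<ge> lam\<^sub>0 \<mu>\<^sub>1 \<mu>\<^sub>2 b R M. \<forall>u \<in> H2_0_sharp R n.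
           (LINT x|lebesgue_on (cube R).
              (L0 (cube R) a u x)\<^sup>2 * exp (2 * lam * (x $ n + b) powr p))
           \<ge> C\<^sub>2 \<mu>\<^sub>1 \<mu>\<^sub>2 b p R M * lam *
             (LINT x|lebesgue_on (cube R).
                ((norm (weak_grad (cube R) u x))\<^sup>2 + lam\<^sup>2 * (u x)\<^sup>2)
                * exp (2 * lam * (x $ n + b) powr p))))"
proof -
  define p0 where "p0 \<mu> b R M = 3 + (b + R) * (12 * M\<^sup>2 * (real CARD('n))\<^sup>2 / \<mu>\<^sup>2)" for \<mu> b R M :: real
  define P where "P \<mu> b p R M C \<longleftrightarrow> 0 < C \<and> (\<forall>(n :: 'n) a. carleman_coefficient_bounds \<mu> R M n a \<longrightarrow>
     (\<forall>lam\<ge>1. \<forall>u\<in>H2_0_sharp R n.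
        C * lam * (LINT x|lebesgue_on (cube R).
            ((norm (weak_grad (cube R) u x))\<^sup>2 + lam\<^sup>2 * (u x)\<^sup>2) * exp (2 * lam * (x $ n + b) powr p))
        \<le> (LINT x|lebesgue_on (cube R). (L0 (cube R) a u x)\<^sup>2 * exp (2 * lam * (x $ n + b) powr p))))"
    for \<mu> b p R M C :: real
  have P: "P \<mu> b p R M (SOME C. P \<mu> b p R M C)" if "1 \<le> R" "R < b" "0 < \<mu>" "p0 \<mu> b R M \<le> p" for \<mu> b p R M
  proof (rule someI_ex)
    show "\<exists>C. P \<mu> b p R M C"
      using carleman_estimate_power_weight[where 'n='n, of R b \<mu> M p] that by (auto simp: P_def p0_def)
  qed
  show ?thesis
  proof (rule exI[of _ "\<lambda>\<mu>\<^sub>1 \<mu>\<^sub>2 b R M. p0 \<mu>\<^sub>1 b R M"], rule exI[of _ "\<lambda>\<mu>\<^sub>1 \<mu>\<^sub>2 b R M. 1"],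
      rule exI[of _ "\<lambda>\<mu>\<^sub>1 \<mu>\<^sub>2 b p R M. SOME C. P \<mu>\<^sub>1 b p R M C"], intro allI impI, elim conjE)
    fix \<mu>\<^sub>1 \<mu>\<^sub>2 b R M :: real and n :: 'n and a :: "'n \<Rightarrow> 'n \<Rightarrow> real ^ 'n \<Rightarrow> real"
    assume R: "1 \<le> R" "R < b" and mu: "0 < \<mu>\<^sub>1"
      and sym: "\<forall>x i j. a i j x = a j i x"
      and ell: "\<forall>x \<xi>. \<mu>\<^sub>1 * (norm \<xi>)\<^sup>2 \<le> (\<Sum>i\<in>UNIV. \<Sum>j\<in>UNIV. a i j x * \<xi> $ i * \<xi> $ j) \<and>
            (\<Sum>i\<in>UNIV. \<Sum>j\<in>UNIV. a i j x * \<xi> $ i * \<xi> $ j) \<le> \<mu>\<^sub>2 * (norm \<xi>)\<^sup>2"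
      and C1: "\<forall>i j. C1_closure (cube R) (a i j)"
      and lateral: "\<forall>x \<in> frontier (cube R) - {x. x $ n = R \<or> x $ n = - R}. \<forall>i. i \<noteq> n \<longrightarrow> a i n x = 0"
      and M: "M = Max (range (\<lambda>(i, j). C1_norm (cube R) (a i j)))"
    have "C1_norm (cube R) (a i j) \<le> M" for i j
      unfolding M by (rule Max_ge) (auto intro!: rev_image_eqI[of "(i, j)"])
    then have coeff: "carleman_coefficient_bounds \<mu>\<^sub>1 R M n a"
      using sym ell C1 lateral unfolding carleman_coefficient_bounds_def by blast
    have "0 \<le> (b + R) * (12 * M\<^sup>2 * (real CARD('n))\<^sup>2 / \<mu>\<^sub>1\<^sup>2)" using R by simp
    then have "1 < p0 \<mu>\<^sub>1 b R M" by (simp add: p0_def)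
    then show "1 < p0 \<mu>\<^sub>1 b R M \<and> (1::real) \<le> 1 \<and>
     (\<forall>p \<ge> p0 \<mu>\<^sub>1 b R M. 0 < (SOME C. P \<mu>\<^sub>1 b p R M C) \<and>
        (\<forall>lam \<ge> 1. \<forall>u \<in> H2_0_sharp R n.
           (LINT x|lebesgue_on (cube R).
              (L0 (cube R) a u x)\<^sup>2 * exp (2 * lam * (x $ n + b) powr p))
           \<ge> (SOME C. P \<mu>\<^sub>1 b p R M C) * lam *
             (LINT x|lebesgue_on (cube R).
                ((norm (weak_grad (cube R) u x))\<^sup>2 + lam\<^sup>2 * (u x)\<^sup>2)
                * exp (2 * lam * (x $ n + b) powr p))))"
      using P[OF R mu, of M] coeff unfolding P_def by blast
  qed
qed

end
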